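(* Let $X$ be a compact Hausdorff space with countably infinitely many points. Then $X$ is not a quantum homogeneous space; that is, there is no ergodic action of a compact quantum group on the unital $C^*$-algebra $C(X)$.
   Context: $\otimes$ denotes the minimal tensor product of $C^*$-algebras. A compact quantum group $\mathcal{G}$ is a pair $(A,\Delta)$ with $A$ a unital $C^*$-algebra and $\Delta:A\to A\otimes A$ a unital $*$-homomorphism such that $(id\otimes\Delta)\Delta=(\Delta\otimes id)\Delta$ and the linear spans of $\Delta(A)(1\otimes A)$ and of $\Delta(A)(A\otimes 1)$ are dense in $A\otimes A$. An action of $\mathcal{G}$ on a unital $C^*$-algebra $B$ is a unital $*$-homomorphism $\alpha:B\to B\otimes A$ with $(\alpha\otimes id)\alpha=(id\otimes\Delta)\alpha$ and such that the linear span of $\alpha(B)(1\otimes A)$ is dense in $B\otimes A$. The action is ergodic if $\{b\in B:\alpha(b)=b\otimes 1\}=\mathbb{C}1_B$. A unital $C^*$-algebra $B$ is a quantum homogeneous space if it admits an ergodic action of some compact quantum group; a compact Hausdorff space $X$ is called a quantum homogeneous space if $C(X)$ is one. *)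

theory Defs
  imports "HOL-Analysis.Analysis"
begin

subsection \<open>C*-algebras\<close>

class complex_normed_vector = real_normed_vector +
  fixes scaleC :: "complex \<Rightarrow> 'a \<Rightarrow> 'a"  (infixr "*\<^sub>C" 75)
  assumes scaleC_add_right: "c *\<^sub>C (x + y) = c *\<^sub>C x + c *\<^sub>C y"
    and scaleC_add_left: "(c + d) *\<^sub>C x = c *\<^sub>C x + d *\<^sub>C x"
    and scaleC_scaleC: "c *\<^sub>C (d *\<^sub>C x) = (c * d) *\<^sub>C x"
    and scaleR_scaleC: "r *\<^sub>R x = complex_of_real r *\<^sub>C x"
    and norm_scaleC: "norm (c *\<^sub>C x) = cmod c * norm x"

lemma scaleC_one [simp]: "1 *\<^sub>C (x::'a::complex_normed_vector) = x"
  by (metis of_real_1 scaleR_one scaleR_scaleC)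

lemma scaleC_zero_left [simp]: "0 *\<^sub>C (x::'a::complex_normed_vector) = 0"
  by (metis norm_eq_zero norm_scaleC norm_zero mult_zero_left)

lemma scaleC_zero_right [simp]: "c *\<^sub>C (0::'a::complex_normed_vector) = 0"
  by (metis norm_eq_zero norm_scaleC norm_zero mult_zero_right)

lemma scaleC_minus_right [simp]: "c *\<^sub>C (- x) = - (c *\<^sub>C (x::'a::complex_normed_vector))"
  by (metis add_eq_0_iff neg_eq_iff_add_eq_0 scaleC_add_right scaleC_zero_right)

lemma scaleC_diff_right: "c *\<^sub>C (x - y) = c *\<^sub>C x - c *\<^sub>C (y::'a::complex_normed_vector)"
  using scaleC_add_right[of c x "- y"] by simp

lemma bounded_linear_scaleC: "bounded_linear (\<lambda>x::'a::complex_normed_vector. c *\<^sub>C x)"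
  by (rule bounded_linear_intro[where K = "cmod c"])
     (simp_all add: scaleC_add_right scaleR_scaleC scaleC_scaleC norm_scaleC mult.commute)

text \<open>Unital C*-algebras; as \<^class>\<open>monoid_mult\<close> does not include \<open>0 \<noteq> 1\<close>, the zero algebra
  is allowed.\<close>

class cstar_algebra = complex_normed_vector + real_normed_algebra + monoid_mult + banach +
  fixes star :: "'a \<Rightarrow> 'a"
  assumes scaleC_mult_left: "(c *\<^sub>C x) * y = c *\<^sub>C (x * y)"
    and scaleC_mult_right: "x * (c *\<^sub>C y) = c *\<^sub>C (x * y)"
    and star_add: "star (x + y) = star x + star y"
    and star_scaleC: "star (c *\<^sub>C x) = cnj c *\<^sub>C star x"
    and star_mult: "star (x * y) = star y * star x"
    and star_star [simp]: "star (star x) = x"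
    and norm_star_mult: "norm (star x * x) = (norm x)\<^sup>2"

lemma norm_star [simp]: "norm (star (x::'a::cstar_algebra)) = norm x"
proof -
  have le: "norm y \<le> norm (star y)" for y :: 'a
  proof (cases "y = 0")
    case False
    have "norm y * norm y \<le> norm (star y) * norm y"
      using norm_mult_ineq[of "star y" y] by (simp add: norm_star_mult power2_eq_square)
    with False show ?thesis by simp
  qed simp
  from le[of x] le[of "star x"] show ?thesis by simp
qed

lemma star_zero [simp]: "star (0::'a::cstar_algebra) = 0"
  by (metis norm_eq_zero norm_star)

lemma star_one [simp]: "star (1::'a::cstar_algebra) = 1"
  by (metis mult_1 mult_1_right star_mult star_star)

lemma star_minus: "star (- x) = - star (x::'a::cstar_algebra)"
  by (metis add_eq_0_iff neg_eq_iff_add_eq_0 star_add star_zero)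

lemma star_diff: "star (x - y) = star x - star (y::'a::cstar_algebra)"
  using star_add[of x "- y"] by (simp add: star_minus)

lemma star_scaleR: "star (r *\<^sub>R x) = r *\<^sub>R star (x::'a::cstar_algebra)"
  by (simp add: scaleR_scaleC star_scaleC)

lemma bounded_linear_star: "bounded_linear (star :: 'a::cstar_algebra \<Rightarrow> 'a)"
  by (rule bounded_linear_intro[where K = 1]) (simp_all add: star_add star_scaleR)

instantiation complex :: cstar_algebra
begin
definition scaleC_complex :: "complex \<Rightarrow> complex \<Rightarrow> complex" where "scaleC_complex = (*)"
definition star_complex :: "complex \<Rightarrow> complex" where "star_complex = cnj"
instance
proof
  fix r :: real and x :: complex
  show "r *\<^sub>R x = complex_of_real r *\<^sub>C x"
    by (simp add: scaleC_complex_def scaleR_conv_of_real)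
qed (simp_all add: scaleC_complex_def star_complex_def algebra_simps norm_mult power2_eq_square)
end

definition cspan :: "'a::complex_normed_vector set \<Rightarrow> 'a set" where
  "cspan S = span {c *\<^sub>C x |c x. x \<in> S}"

definition star_hom :: "('a::cstar_algebra \<Rightarrow> 'b::cstar_algebra) \<Rightarrow> bool" where
  "star_hom f \<longleftrightarrow>
     (\<forall>x y. f (x + y) = f x + f y) \<and> (\<forall>c x. f (c *\<^sub>C x) = c *\<^sub>C f x) \<and>
     (\<forall>x y. f (x * y) = f x * f y) \<and> (\<forall>x. f (star x) = star (f x))"

definition unital_star_hom :: "('a::cstar_algebra \<Rightarrow> 'b::cstar_algebra) \<Rightarrow> bool" where
  "unital_star_hom f \<longleftrightarrow> star_hom f \<and> f 1 = 1"

lemma cstar_sqrt_one_minus: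
  fixes x :: "'a::cstar_algebra"
  assumes "star x = x" and "norm x < 1"
  shows "\<exists>c. star c = c \<and> c * c = 1 - x"
proof -
  define r where "r = norm x"
  define f where "f y = (1/2) *\<^sub>R (x + y * y)" for y
  have r: "0 \<le> r" "r < 1" using assms by (auto simp: r_def)
  have "\<exists>!y. y \<in> cball 0 r \<and> f y = y"
  proof (rule Banach_fix[where c = r])
    show "complete (cball (0::'a) r)" by (simp add: complete_eq_closed)
    show "cball (0::'a) r \<noteq> {}" using r by auto
    show "f ` cball 0 r \<subseteq> cball 0 r"
    proof safe
      fix y :: 'a assume "y \<in> cball 0 r"
      then have y: "norm y \<le> r" by simp
      have "norm (y * y) \<le> r * r"
        by (rule order_trans[OF norm_mult_ineq mult_mono]) (use y r in auto)
      also have "\<dots> \<le> r" using r by (simp add: mult_left_le)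
      finally have "norm (x + y * y) \<le> 2 * r"
        using norm_triangle_ineq[of x "y * y"] by (simp add: r_def)
      then show "f y \<in> cball 0 r" by (simp add: f_def)
    qed
    fix y z :: 'a assume "y \<in> cball 0 r" "z \<in> cball 0 r"
    then have yz: "norm y \<le> r" "norm z \<le> r" by auto
    have "y * y - z * z = y * (y - z) + (y - z) * z" by (simp add: algebra_simps)
    then have "norm (y * y - z * z) \<le> norm (y * (y - z)) + norm ((y - z) * z)"
      by (metis norm_triangle_ineq)
    also have "\<dots> \<le> r * norm (y - z) + norm (y - z) * r"
      by (intro add_mono order_trans[OF norm_mult_ineq] mult_mono) (use yz r in auto)
    finally have "norm (y * y - z * z) \<le> 2 * (r * norm (y - z))" by simp
    moreover have "f y - f z = (1/2) *\<^sub>R (y * y - z * z)"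
      by (simp add: f_def algebra_simps)
    ultimately show "dist (f y) (f z) \<le> r * dist y z"
      by (simp add: dist_norm)
  qed (use r in auto)
  then obtain y where y0: "y \<in> cball 0 r \<and> f y = y"
    and uniq0: "\<forall>z. z \<in> cball 0 r \<and> f z = z \<longrightarrow> z = y" by (rule ex1E)
  have y: "norm y \<le> r" "f y = y" using y0 by auto
  have uniq: "z = y" if "norm z \<le> r" "f z = z" for z using uniq0 that by simp
  have "f (star y) = star (f y)"
    by (simp add: f_def star_scaleR star_add star_mult assms)
  then have sy: "star y = y" using y by (intro uniq) simp_all
  have "y * y = y + y - x"
  proof -
    have "2 *\<^sub>R y = 2 *\<^sub>R f y" by (simp only: y(2))
    also have "\<dots> = x + y * y" by (simp add: f_def)
    finally have "2 *\<^sub>R y = x + y * y" .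
    then show ?thesis by (metis scaleR_2 add_diff_cancel_left')
  qed
  then have "(1 - y) * (1 - y) = 1 - x" by (simp add: left_diff_distrib right_diff_distrib)
  moreover have "star (1 - y) = 1 - y" by (simp add: star_diff sy)
  ultimately show ?thesis by blast
qed


subsection \<open>Bounded continuous functions with values in a C*-algebra\<close>

text \<open>For a compact Hausdorff space \<open>X\<close>, every continuous function is bounded, so
  \<open>X \<Rightarrow>\<^sub>C complex\<close> with the supremum norm is \<open>C(X)\<close>. The library proves completeness only for
  metric domains; the argument does not need the metric.\<close>

instance bcontfun :: (topological_space, complete_space) complete_space
proof
  fix f :: "nat \<Rightarrow> ('a, 'b) bcontfun"
  assume "Cauchy f"
  then obtain g where "uniform_limit UNIV f g sequentially"
    using uniformly_convergent_eq_cauchy[of "\<lambda>_. True" f]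
    unfolding Cauchy_def uniform_limit_sequentially_iff
    by (metis dist_fun_lt_imp_dist_val_lt)
  from uniform_limit_bcontfunE[OF this sequentially_bot] show "convergent f"
    by (metis convergentI)
qed

instance bcontfun :: (topological_space, banach) banach ..

lemma apply_Bcontfun:
  fixes f :: "'a::topological_space \<Rightarrow> 'b::real_normed_vector"
  assumes "continuous_on UNIV f" "\<And>x. norm (f x) \<le> b"
  shows "apply_bcontfun (Bcontfun f) = f"
  using bcontfun_normI[OF assms] by (simp add: Bcontfun_inverse)

instantiation bcontfun :: (topological_space, cstar_algebra) cstar_algebra
begin

definition scaleC_bcontfun :: "complex \<Rightarrow> 'a \<Rightarrow>\<^sub>C 'b \<Rightarrow> 'a \<Rightarrow>\<^sub>C 'b" where
  "scaleC_bcontfun c f = Bcontfun (\<lambda>x. c *\<^sub>C f x)"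

definition times_bcontfun :: "'a \<Rightarrow>\<^sub>C 'b \<Rightarrow> 'a \<Rightarrow>\<^sub>C 'b \<Rightarrow> 'a \<Rightarrow>\<^sub>C 'b" where
  "times_bcontfun f g = Bcontfun (\<lambda>x. f x * g x)"

definition one_bcontfun :: "'a \<Rightarrow>\<^sub>C 'b" where
  "one_bcontfun = const_bcontfun 1"

definition star_bcontfun :: "'a \<Rightarrow>\<^sub>C 'b \<Rightarrow> 'a \<Rightarrow>\<^sub>C 'b" where
  "star_bcontfun f = Bcontfun (\<lambda>x. star (f x))"

lemma apply_scaleC_bcontfun: "apply_bcontfun (c *\<^sub>C f) = (\<lambda>x. c *\<^sub>C f x)" for f :: "'a \<Rightarrow>\<^sub>C 'b"
  unfolding scaleC_bcontfun_def
  by (rule apply_Bcontfun[where b = "cmod c * norm f"])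
     (auto simp: norm_scaleC norm_bounded mult_left_mono
       intro!: bounded_linear.continuous_on[OF bounded_linear_scaleC])

lemma apply_times_bcontfun: "apply_bcontfun (f * g) = (\<lambda>x. f x * g x)" for f g :: "'a \<Rightarrow>\<^sub>C 'b"
  unfolding times_bcontfun_def
  by (rule apply_Bcontfun[where b = "norm f * norm g"])
     (auto intro!: continuous_intros order_trans[OF norm_mult_ineq] mult_mono norm_bounded)

lemma apply_one_bcontfun: "apply_bcontfun (1 :: 'a \<Rightarrow>\<^sub>C 'b) = (\<lambda>x. 1)"
  by (simp add: one_bcontfun_def)

lemma apply_star_bcontfun: "apply_bcontfun (star f) = (\<lambda>x. star (f x))" for f :: "'a \<Rightarrow>\<^sub>C 'b"
  unfolding star_bcontfun_def
  by (rule apply_Bcontfun[where b = "norm f"])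
     (auto simp: norm_bounded intro!: bounded_linear.continuous_on[OF bounded_linear_star])

lemma norm_scaleC_bcontfun_le: "norm (c *\<^sub>C f) \<le> cmod c * norm f" for f :: "'a \<Rightarrow>\<^sub>C 'b"
  by (rule norm_bound) (simp add: apply_scaleC_bcontfun norm_scaleC norm_bounded mult_left_mono)

lemmas apply_cstar_bcontfun =
  apply_scaleC_bcontfun apply_times_bcontfun apply_one_bcontfun apply_star_bcontfun

instance
proof
  fix c d :: complex and r :: real and f g h :: "'a \<Rightarrow>\<^sub>C 'b"
  note [simp] = apply_cstar_bcontfun
  show "c *\<^sub>C (f + g) = c *\<^sub>C f + c *\<^sub>C g"
    by (rule bcontfun_eqI) (simp add: scaleC_add_right)
  show "(c + d) *\<^sub>C f = c *\<^sub>C f + d *\<^sub>C f"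
    by (rule bcontfun_eqI) (simp add: scaleC_add_left)
  show "r *\<^sub>R f = complex_of_real r *\<^sub>C f"
    by (rule bcontfun_eqI) (simp add: scaleR_scaleC)
  show "f * g * h = f * (g * h)"
    by (rule bcontfun_eqI) (simp add: mult.assoc)
  show "(f + g) * h = f * h + g * h" "f * (g + h) = f * g + f * h"
    by (rule bcontfun_eqI; simp add: distrib_left distrib_right)+
  show "(r *\<^sub>R f) * g = r *\<^sub>R (f * g)" "f * (r *\<^sub>R g) = r *\<^sub>R (f * g)" "1 * f = f" "f * 1 = f"
    by (rule bcontfun_eqI; simp)+
  show "(c *\<^sub>C f) * g = c *\<^sub>C (f * g)" "f * (c *\<^sub>C g) = c *\<^sub>C (f * g)"
    by (rule bcontfun_eqI; simp add: scaleC_mult_left scaleC_mult_right)+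
  show "star (f + g) = star f + star g" "star (c *\<^sub>C f) = cnj c *\<^sub>C star f"
    "star (f * g) = star g * star f" "star (star f) = f"
    by (rule bcontfun_eqI; simp add: star_add star_scaleC star_mult)+
  show scsc: "c *\<^sub>C (d *\<^sub>C f) = (c * d) *\<^sub>C f" for c d and f :: "'a \<Rightarrow>\<^sub>C 'b"
    by (rule bcontfun_eqI) (simp add: apply_cstar_bcontfun scaleC_scaleC)
  show "norm (c *\<^sub>C f) = cmod c * norm f"
  proof (cases "c = 0")
    case True
    then have "c *\<^sub>C f = 0" by (intro bcontfun_eqI) (simp add: apply_cstar_bcontfun)
    with True show ?thesis by simp
  next
    case False
    have "f = inverse c *\<^sub>C (c *\<^sub>C f)"
      using False by (intro bcontfun_eqI) (simp add: apply_cstar_bcontfun scaleC_scaleC)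
    then have "norm f \<le> cmod (inverse c) * norm (c *\<^sub>C f)"
      by (metis norm_scaleC_bcontfun_le)
    then have "cmod c * norm f \<le> norm (c *\<^sub>C f)"
      using False by (simp add: norm_divide field_simps)
    with norm_scaleC_bcontfun_le[of c f] show ?thesis by simp
  qed
  show mult: "norm (f * g) \<le> norm f * norm g" for f g :: "'a \<Rightarrow>\<^sub>C 'b"
    by (rule norm_bound)
       (auto simp: apply_cstar_bcontfun
         intro!: order_trans[OF norm_mult_ineq] mult_mono norm_bounded)
  show "norm (star f * f) = (norm f)\<^sup>2"
  proof (rule antisym)
    have "norm (star f) \<le> norm f"
      by (rule norm_bound) (simp add: apply_cstar_bcontfun norm_bounded)
    then show "norm (star f * f) \<le> (norm f)\<^sup>2"
      unfolding power2_eq_square by (intro order_trans[OF mult] mult_right_mono) auto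
    have "norm f \<le> sqrt (norm (star f * f))"
    proof (rule norm_bound)
      fix x
      have "(norm (f x))\<^sup>2 = norm ((star f * f) x)"
        by (simp add: apply_cstar_bcontfun norm_star_mult)
      also have "\<dots> \<le> norm (star f * f)" by (rule norm_bounded)
      finally show "norm (f x) \<le> sqrt (norm (star f * f))" by (rule real_le_rsqrt)
    qed
    then show "(norm f)\<^sup>2 \<le> norm (star f * f)"
      by (metis norm_ge_zero power_mono real_sqrt_pow2)
  qed
qed

end


subsection \<open>The Hilbert spaces \<open>\<ell>\<^sup>2(I)\<close>\<close>

typedef 'i ell2 = "{f :: 'i \<Rightarrow> complex. (\<lambda>i. (cmod (f i))\<^sup>2) summable_on UNIV}"
  morphisms coords Abs_ell2
  by (rule exI[of _ "\<lambda>_. 0"]) simp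

lemma coords_summable: "(\<lambda>i. (cmod (coords x i))\<^sup>2) summable_on UNIV"
  using coords[of x] by simp

lemma ell2_eqI: "(\<And>i. coords x i = coords y i) \<Longrightarrow> x = y"
  by (simp add: coords_inject[symmetric] fun_eq_iff)

lemma coords_Abs_ell2:
  "(\<lambda>i. (cmod (f i))\<^sup>2) summable_on UNIV \<Longrightarrow> coords (Abs_ell2 f) = f"
  by (simp add: Abs_ell2_inverse)

lemma cinner_abs_summable: "(\<lambda>i. cmod (cnj (coords x i) * coords y i)) summable_on UNIV"
proof -
  have "(\<lambda>i. cmod (cnj (coords x i) * cnj (coords x i))) summable_on UNIV"
    "(\<lambda>i. cmod (coords y i * coords y i)) summable_on UNIV"
    using coords_summable[of x] coords_summable[of y]
    by (simp_all add: norm_mult power2_eq_square)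
  then show ?thesis by (rule abs_summable_product)
qed

lemma cinner_summable: "(\<lambda>i. cnj (coords x i) * coords y i) summable_on UNIV"
  by (rule abs_summable_summable[OF cinner_abs_summable])

lemma square_summable_add:
  fixes f g :: "'i \<Rightarrow> complex"
  assumes "(\<lambda>i. (cmod (f i))\<^sup>2) summable_on UNIV" "(\<lambda>i. (cmod (g i))\<^sup>2) summable_on UNIV"
  shows "(\<lambda>i. (cmod (f i + g i))\<^sup>2) summable_on UNIV"
proof (rule summable_on_comparison_test)
  show "(\<lambda>i. 2 * (cmod (f i))\<^sup>2 + 2 * (cmod (g i))\<^sup>2) summable_on UNIV"
    by (intro summable_on_add summable_on_cmult_right assms)
  fix i
  have "(cmod (f i + g i))\<^sup>2 \<le> (cmod (f i) + cmod (g i))\<^sup>2"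
    by (intro power_mono norm_triangle_ineq) simp
  also have "\<dots> \<le> 2 * (cmod (f i))\<^sup>2 + 2 * (cmod (g i))\<^sup>2"
    using zero_le_power2[of "cmod (f i) - cmod (g i)"] by (simp add: power2_eq_square algebra_simps)
  finally show "(cmod (f i + g i))\<^sup>2 \<le> 2 * (cmod (f i))\<^sup>2 + 2 * (cmod (g i))\<^sup>2" .
qed simp

lemma square_summable_scale:
  fixes f :: "'i \<Rightarrow> complex"
  assumes "(\<lambda>i. (cmod (f i))\<^sup>2) summable_on UNIV"
  shows "(\<lambda>i. (cmod (c * f i))\<^sup>2) summable_on UNIV"
  using summable_on_cmult_right[OF assms, of "(cmod c)\<^sup>2"] by (simp add: norm_mult power_mult_distrib)

definition cinner :: "'i ell2 \<Rightarrow> 'i ell2 \<Rightarrow> complex" where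
  "cinner x y = (\<Sum>\<^sub>\<infinity>i. cnj (coords x i) * coords y i)"

instantiation ell2 :: (type) real_vector
begin

definition zero_ell2 :: "'a ell2" where "zero_ell2 = Abs_ell2 (\<lambda>_. 0)"
definition plus_ell2 :: "'a ell2 \<Rightarrow> 'a ell2 \<Rightarrow> 'a ell2"
  where "plus_ell2 x y = Abs_ell2 (\<lambda>i. coords x i + coords y i)"
definition uminus_ell2 :: "'a ell2 \<Rightarrow> 'a ell2"
  where "uminus_ell2 x = Abs_ell2 (\<lambda>i. - coords x i)"
definition minus_ell2 :: "'a ell2 \<Rightarrow> 'a ell2 \<Rightarrow> 'a ell2"
  where "minus_ell2 x y = Abs_ell2 (\<lambda>i. coords x i - coords y i)"
definition scaleR_ell2 :: "real \<Rightarrow> 'a ell2 \<Rightarrow> 'a ell2"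
  where "scaleR_ell2 r x = Abs_ell2 (\<lambda>i. complex_of_real r * coords x i)"

lemma coords_plus [simp]: "coords (x + y :: 'a ell2) i = coords x i + coords y i"
  by (simp add: plus_ell2_def coords_Abs_ell2 square_summable_add coords_summable)

lemma coords_zero [simp]: "coords (0 :: 'a ell2) i = 0"
  by (simp add: zero_ell2_def coords_Abs_ell2)

lemma coords_uminus [simp]: "coords (- x :: 'a ell2) i = - coords x i"
  by (simp add: uminus_ell2_def coords_Abs_ell2 coords_summable)

lemma coords_minus [simp]: "coords (x - y :: 'a ell2) i = coords x i - coords y i"
  using square_summable_add[OF coords_summable[of x] coords_summable[of "- y"]]
  by (simp add: minus_ell2_def coords_Abs_ell2)

lemma coords_scaleR [simp]: "coords (r *\<^sub>R x :: 'a ell2) i = complex_of_real r * coords x i"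
  by (simp only: scaleR_ell2_def coords_Abs_ell2[OF square_summable_scale[OF coords_summable]])

instance
proof
  fix x y z :: "'a ell2" and r s :: real
  show "x + y + z = x + (y + z)" "x + y = y + x" "0 + x = x" "- x + x = 0" "x - y = x + - y"
    "r *\<^sub>R (x + y) = r *\<^sub>R x + r *\<^sub>R y" "(r + s) *\<^sub>R x = r *\<^sub>R x + s *\<^sub>R x"
    "r *\<^sub>R (s *\<^sub>R x) = (r * s) *\<^sub>R x" "1 *\<^sub>R x = x"
    by (rule ell2_eqI; simp add: algebra_simps)+
qed

end

instantiation ell2 :: (type) real_inner
begin

definition inner_ell2 :: "'a ell2 \<Rightarrow> 'a ell2 \<Rightarrow> real"
  where "inner_ell2 x y = Re (cinner x y)"
definition norm_ell2 :: "'a ell2 \<Rightarrow> real" where "norm_ell2 x = sqrt (inner x x)"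
definition dist_ell2 :: "'a ell2 \<Rightarrow> 'a ell2 \<Rightarrow> real" where "dist_ell2 x y = norm (x - y)"
definition sgn_ell2 :: "'a ell2 \<Rightarrow> 'a ell2" where "sgn_ell2 x = x /\<^sub>R norm x"
definition uniformity_ell2 :: "('a ell2 \<times> 'a ell2) filter"
  where "uniformity_ell2 = (INF e\<in>{0<..}. principal {(x, y). dist x y < e})"
definition open_ell2 :: "'a ell2 set \<Rightarrow> bool"
  where "open_ell2 U \<longleftrightarrow> (\<forall>x\<in>U. \<forall>\<^sub>F (x', y) in uniformity. x' = x \<longrightarrow> y \<in> U)"

lemma cinner_add_left: "cinner (x + y) z = cinner x z + cinner (y :: 'a ell2) z"
  unfolding cinner_def by (simp add: distrib_right infsum_add cinner_summable)

lemma cinner_commute: "cinner x y = cnj (cinner y (x :: 'a ell2))"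
  unfolding cinner_def by (simp add: mult.commute flip: infsum_cnj)

lemma cinner_self_has_sum: "((\<lambda>i. (cmod (coords x i))\<^sup>2) has_sum inner x x) UNIV"
  for x :: "'a ell2"
proof -
  have "((\<lambda>i. Re (cnj (coords x i) * coords x i)) has_sum Re (cinner x x)) UNIV"
    unfolding cinner_def by (intro has_sum_Re has_sum_infsum cinner_summable)
  moreover have "Re (cnj z * z) = (cmod z)\<^sup>2" for z
    unfolding cmod_power2 by (simp add: power2_eq_square)
  ultimately show ?thesis by (simp add: inner_ell2_def)
qed

instance
proof
  fix x y z :: "'a ell2" and r s :: real
  show "inner x y = inner y x"
    unfolding inner_ell2_def by (subst cinner_commute) simp
  show "inner (x + y) z = inner x z + inner y z"
    by (simp add: inner_ell2_def cinner_add_left)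
  show "inner (r *\<^sub>R x) y = r * inner x y"
  proof -
    have "cinner (r *\<^sub>R x) y = complex_of_real r * cinner x y"
      unfolding cinner_def by (simp add: mult.assoc infsum_cmult_right cinner_summable)
    then show ?thesis by (simp add: inner_ell2_def)
  qed
  show "0 \<le> inner x x" using has_sum_nonneg[OF cinner_self_has_sum] by simp
  show "inner x x = 0 \<longleftrightarrow> x = 0"
  proof
    assume "inner x x = 0"
    then have "(cmod (coords x i))\<^sup>2 = 0" for i
      using nonneg_has_sum_le_0D[OF cinner_self_has_sum[of x], of i] by simp
    then show "x = 0" by (intro ell2_eqI) simp
  next
    assume "x = 0"
    then show "inner x x = 0" by (simp add: inner_ell2_def cinner_def)
  qed
qed (simp_all add: norm_ell2_def dist_ell2_def sgn_ell2_def uniformity_ell2_def open_ell2_def)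

end

lemma norm_ell2_has_sum: "((\<lambda>i. (cmod (coords x i))\<^sup>2) has_sum (norm x)\<^sup>2) UNIV"
  using cinner_self_has_sum[of x] by (simp add: power2_norm_eq_inner)

lemma cinner_self: "cinner x x = complex_of_real ((norm x)\<^sup>2)"
proof -
  have "Im (cinner x x) = 0"
    using cinner_commute[of x x] by (metis complex_cnj_cancel_iff cnj.simps(2) neg_equal_zero)
  then show ?thesis
    by (simp add: complex_eq_iff power2_norm_eq_inner inner_ell2_def)
qed

lemma cinner_add_right: "cinner x (y + z) = cinner x y + cinner x z"
  by (metis cinner_add_left cinner_commute complex_cnj_add)

lemma norm_ell2_le_finite:
  assumes "\<And>F. finite F \<Longrightarrow> (\<Sum>i\<in>F. (cmod (coords x i))\<^sup>2) \<le> b\<^sup>2" and "0 \<le> b"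
  shows "norm x \<le> b"
proof -
  have "(norm x)\<^sup>2 \<le> b\<^sup>2"
    by (rule has_sum_le_finite_sums[OF norm_ell2_has_sum]) (use assms in auto)
  then show ?thesis using assms(2) by (rule power2_le_imp_le)
qed

lemma square_summable_finite:
  fixes f :: "'i \<Rightarrow> complex"
  assumes "\<And>F. finite F \<Longrightarrow> (\<Sum>i\<in>F. (cmod (f i))\<^sup>2) \<le> b"
  shows "(\<lambda>i. (cmod (f i))\<^sup>2) summable_on UNIV"
  by (rule nonneg_bdd_above_summable_on) (auto intro!: bdd_aboveI[where M = b] assms)

lemma sum_coords_le: "finite F \<Longrightarrow> (\<Sum>i\<in>F. (cmod (coords x i))\<^sup>2) \<le> (norm x)\<^sup>2"
  by (rule finite_sum_le_has_sum[OF norm_ell2_has_sum]) auto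

lemma cmod_coords_le: "cmod (coords x i) \<le> norm x"
  using sum_coords_le[of "{i}" x] by (auto intro: power2_le_imp_le)

instantiation ell2 :: (type) complex_normed_vector
begin

definition scaleC_ell2 :: "complex \<Rightarrow> 'a ell2 \<Rightarrow> 'a ell2"
  where "scaleC_ell2 c x = Abs_ell2 (\<lambda>i. c * coords x i)"

lemma coords_scaleC [simp]: "coords (c *\<^sub>C x :: 'a ell2) i = c * coords x i"
  by (simp only: scaleC_ell2_def coords_Abs_ell2[OF square_summable_scale[OF coords_summable]])

instance
proof
  fix x y :: "'a ell2" and c d :: complex and r :: real
  show "c *\<^sub>C (x + y) = c *\<^sub>C x + c *\<^sub>C y" "(c + d) *\<^sub>C x = c *\<^sub>C x + d *\<^sub>C x"
    "c *\<^sub>C (d *\<^sub>C x) = (c * d) *\<^sub>C x" "r *\<^sub>R x = complex_of_real r *\<^sub>C x"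
    by (rule ell2_eqI; simp add: algebra_simps)+
  have "((\<lambda>i. (cmod c)\<^sup>2 * (cmod (coords x i))\<^sup>2) has_sum (cmod c)\<^sup>2 * (norm x)\<^sup>2) UNIV"
    by (intro has_sum_cmult_right norm_ell2_has_sum)
  then have "((\<lambda>i. (cmod (coords (c *\<^sub>C x) i))\<^sup>2) has_sum (cmod c * norm x)\<^sup>2) UNIV"
    by (simp add: norm_mult power_mult_distrib)
  from has_sum_unique[OF this norm_ell2_has_sum]
  show "norm (c *\<^sub>C x) = cmod c * norm x" by simp
qed

end

lemma cinner_scaleC_right: "cinner x (c *\<^sub>C y) = c * cinner x y"
proof -
  have "cinner x (c *\<^sub>C y) = (\<Sum>\<^sub>\<infinity>i. c * (cnj (coords x i) * coords y i))"
    by (simp add: cinner_def algebra_simps)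
  also have "\<dots> = c * cinner x y"
    unfolding cinner_def by (rule infsum_cmult_right[OF cinner_summable])
  finally show ?thesis .
qed

lemma cinner_scaleC_left: "cinner (c *\<^sub>C x) y = cnj c * cinner x y"
  by (metis cinner_commute cinner_scaleC_right complex_cnj_cnj complex_cnj_mult)

lemma cinner_bound: "cmod (cinner x y) \<le> norm x * norm y"
proof -
  define u where "u = sgn (cinner x y)"
  have "complex_of_real (cmod (cinner x y)) = cnj u * cinner x y"
    by (simp add: u_def sgn_div_norm scaleR_conv_of_real field_simps power2_eq_square
        complex_norm_square[symmetric])
  then have "cmod (cinner x y) = Re (cnj u * cinner x y)" by (metis Re_complex_of_real)
  also have "\<dots> = inner (u *\<^sub>C x) y"
    by (simp only: inner_ell2_def cinner_scaleC_left)
  also have "\<dots> \<le> norm (u *\<^sub>C x) * norm y" by (rule norm_cauchy_schwarz)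
  also have "\<dots> \<le> norm x * norm y"
    by (intro mult_right_mono) (auto simp: norm_scaleC u_def norm_sgn)
  finally show ?thesis .
qed

lemma bounded_linear_cinner_right: "bounded_linear (cinner x)"
proof (rule bounded_linear_intro[where K = "norm x"])
  fix y z :: "'a ell2" and r :: real
  show "cinner x (y + z) = cinner x y + cinner x z" by (rule cinner_add_right)
  show "cinner x (r *\<^sub>R y) = r *\<^sub>R cinner x y"
    by (simp add: scaleR_scaleC[of r y] cinner_scaleC_right scaleR_conv_of_real)
  show "norm (cinner x y) \<le> norm y * norm x" using cinner_bound[of x y] by (simp add: mult.commute)
qed

lemma bounded_linear_cinner_left: "bounded_linear (\<lambda>x. cinner x y)"
proof (rule bounded_linear_intro[where K = "norm y"])
  fix x z :: "'a ell2" and r :: real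
  show "cinner (x + z) y = cinner x y + cinner z y" by (rule cinner_add_left)
  show "cinner (r *\<^sub>R x) y = r *\<^sub>R cinner x y"
    by (simp add: scaleR_scaleC[of r x] cinner_scaleC_left scaleR_conv_of_real)
  show "norm (cinner x y) \<le> norm x * norm y" by (rule cinner_bound)
qed

instance ell2 :: (type) banach
proof
  fix X :: "nat \<Rightarrow> 'a ell2"
  assume X: "Cauchy X"
  have "Cauchy (\<lambda>n. coords (X n) i)" for i
  proof (rule CauchyI)
    fix e :: real assume "0 < e"
    then obtain M where M: "\<forall>m\<ge>M. \<forall>n\<ge>M. norm (X m - X n) < e" using CauchyD[OF X] by blast
    show "\<exists>M. \<forall>m\<ge>M. \<forall>n\<ge>M. norm (coords (X m) i - coords (X n) i) < e"
    proof (intro exI allI impI)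
      fix m n assume "M \<le> m" "M \<le> n"
      then show "norm (coords (X m) i - coords (X n) i) < e"
        using M cmod_coords_le[of "X m - X n" i] by (metis coords_minus order_le_less_trans)
    qed
  qed
  then have "\<exists>l. (\<lambda>n. coords (X n) i) \<longlonglongrightarrow> l" for i by (metis Cauchy_convergent convergent_def)
  then obtain f where f: "\<And>i. (\<lambda>n. coords (X n) i) \<longlonglongrightarrow> f i" by metis
  have bound: "(\<Sum>i\<in>F. (cmod (f i - coords (X n) i))\<^sup>2) \<le> e\<^sup>2"
    if F: "finite F" and M: "\<forall>m\<ge>M. norm (X m - X n) < e" for F n M and e :: real
  proof (rule tendsto_upperbound)
    show "(\<lambda>m. \<Sum>i\<in>F. (cmod (coords (X m) i - coords (X n) i))\<^sup>2)
        \<longlonglongrightarrow> (\<Sum>i\<in>F. (cmod (f i - coords (X n) i))\<^sup>2)"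
      by (intro tendsto_intros f)
    show "\<forall>\<^sub>F m in sequentially. (\<Sum>i\<in>F. (cmod (coords (X m) i - coords (X n) i))\<^sup>2) \<le> e\<^sup>2"
    proof (rule eventually_sequentiallyI)
      fix m assume "M \<le> m"
      then have "(norm (X m - X n))\<^sup>2 \<le> e\<^sup>2" using M by (intro power_mono) (auto simp: less_imp_le)
      then show "(\<Sum>i\<in>F. (cmod (coords (X m) i - coords (X n) i))\<^sup>2) \<le> e\<^sup>2"
        using sum_coords_le[OF F, of "X m - X n"] by simp
    qed
  qed simp
  obtain N where N: "\<forall>m\<ge>N. \<forall>n\<ge>N. norm (X m - X n) < 1" using CauchyD[OF X, of 1] by auto
  have "(\<lambda>i. (cmod (f i - coords (X N) i))\<^sup>2) summable_on UNIV"
    by (rule square_summable_finite[OF bound[where M = N and e = 1]]) (use N in auto)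
  from square_summable_add[OF this coords_summable[of "X N"]]
  have l: "coords (Abs_ell2 f) = f" by (simp add: coords_Abs_ell2)
  have "X \<longlonglongrightarrow> Abs_ell2 f"
  proof (rule LIMSEQ_I)
    fix r :: real assume r: "0 < r"
    then obtain M where M: "\<forall>m\<ge>M. \<forall>n\<ge>M. norm (X m - X n) < r / 2"
      using CauchyD[OF X, of "r / 2"] by auto
    show "\<exists>no. \<forall>n\<ge>no. norm (X n - Abs_ell2 f) < r"
    proof (intro exI allI impI)
      fix n assume n: "M \<le> n"
      have "norm (Abs_ell2 f - X n) \<le> r / 2"
        by (rule norm_ell2_le_finite) (use bound[of _ M n "r / 2"] M n r in \<open>auto simp: l\<close>)
      then show "norm (X n - Abs_ell2 f) < r" using r by (simp add: norm_minus_commute)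
    qed
  qed
  then show "convergent X" by (rule convergentI)
qed

definition ell2_basis :: "'i \<Rightarrow> 'i ell2" where
  "ell2_basis i = Abs_ell2 (\<lambda>j. if j = i then 1 else 0)"

lemma coords_ell2_basis [simp]: "coords (ell2_basis i) j = (if j = i then 1 else 0)"
proof -
  have "(\<lambda>j. (cmod (if j = i then 1 else 0))\<^sup>2) summable_on UNIV"
    by (rule finite_nonzero_values_imp_summable_on) (auto intro: finite_subset[of _ "{i}"])
  then show ?thesis by (simp add: ell2_basis_def coords_Abs_ell2)
qed

lemma cinner_basis_left [simp]: "cinner (ell2_basis i) x = coords x i"
proof -
  have "cinner (ell2_basis i) x = (\<Sum>\<^sub>\<infinity>j\<in>{i}. coords x j)"
    unfolding cinner_def by (rule infsum_cong_neutral) auto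
  then show ?thesis by simp
qed

lemma cinner_basis_right [simp]: "cinner x (ell2_basis i) = cnj (coords x i)"
  by (subst cinner_commute) simp

lemma ell2_has_sum_basis: "((\<lambda>i. coords x i *\<^sub>C ell2_basis i) has_sum x) UNIV"
proof -
  let ?s = "\<lambda>F. \<Sum>i\<in>F. coords x i *\<^sub>C ell2_basis i"
  have coords_sum: "coords (\<Sum>i\<in>F. y i) j = (\<Sum>i\<in>F. coords (y i) j)" for F j and y :: "'a \<Rightarrow> 'a ell2"
    by (induction F rule: infinite_finite_induct) auto
  have cs: "coords (?s F) j = (if j \<in> F then coords x j else 0)" if "finite F" for F j
    using that by (simp add: coords_sum if_distrib[of "(*) _"] sum.delta cong: if_cong)
  have eq: "(dist (?s F) x)\<^sup>2 = (norm x)\<^sup>2 - (\<Sum>i\<in>F. (cmod (coords x i))\<^sup>2)" if F: "finite F" for F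
  proof -
    have "((\<lambda>i. (cmod (coords x i))\<^sup>2) has_sum (norm x)\<^sup>2 - (\<Sum>i\<in>F. (cmod (coords x i))\<^sup>2)) (UNIV - F)"
      by (intro has_sum_Diff norm_ell2_has_sum has_sum_finite F) auto
    then have "((\<lambda>i. (cmod (coords (?s F - x) i))\<^sup>2)
        has_sum (norm x)\<^sup>2 - (\<Sum>i\<in>F. (cmod (coords x i))\<^sup>2)) UNIV"
      by (rule has_sum_cong_neutral[THEN iffD1, rotated -1]) (auto simp: cs[OF F])
    from has_sum_unique[OF this norm_ell2_has_sum] show ?thesis by (simp add: dist_norm)
  qed
  have "((\<lambda>F. (norm x)\<^sup>2 - (\<Sum>i\<in>F. (cmod (coords x i))\<^sup>2)) \<longlongrightarrow> (norm x)\<^sup>2 - (norm x)\<^sup>2)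
      (finite_subsets_at_top UNIV)"
    using norm_ell2_has_sum[of x] unfolding has_sum_def by (intro tendsto_intros)
  then have "((\<lambda>F. sqrt ((norm x)\<^sup>2 - (\<Sum>i\<in>F. (cmod (coords x i))\<^sup>2))) \<longlongrightarrow> sqrt 0)
      (finite_subsets_at_top UNIV)"
    by (intro tendsto_intros) simp
  moreover have "\<forall>\<^sub>F F in finite_subsets_at_top UNIV.
      sqrt ((norm x)\<^sup>2 - (\<Sum>i\<in>F. (cmod (coords x i))\<^sup>2)) = dist (?s F) x"
    by (rule eventually_finite_subsets_at_top_weakI) (simp flip: eq)
  ultimately have "((\<lambda>F. dist (?s F) x) \<longlongrightarrow> 0) (finite_subsets_at_top UNIV)"
    by (simp add: filterlim_cong[OF refl refl])
  then show ?thesis unfolding has_sum_def by (subst tendsto_dist_iff)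
qed


subsection \<open>The C*-algebra of bounded operators on \<open>\<ell>\<^sup>2(I)\<close>\<close>

typedef 'i ell2_op = "{T :: 'i ell2 \<Rightarrow>\<^sub>L 'i ell2. \<forall>c x. T (c *\<^sub>C x) = c *\<^sub>C T x}"
  morphisms as_blinfun Abs_ell2_op
  by (rule exI[of _ 0]) simp

definition op_apply :: "'i ell2_op \<Rightarrow> 'i ell2 \<Rightarrow> 'i ell2" where
  "op_apply T = blinfun_apply (as_blinfun T)"

definition mk_op :: "('i ell2 \<Rightarrow> 'i ell2) \<Rightarrow> 'i ell2_op" where
  "mk_op f = Abs_ell2_op (Blinfun f)"

lemma op_eqI: "(\<And>x. op_apply S x = op_apply T x) \<Longrightarrow> S = T"
  by (metis as_blinfun_inject blinfun_eqI op_apply_def)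

lemma op_apply_scaleC: "op_apply T (c *\<^sub>C x) = c *\<^sub>C op_apply T x"
  using as_blinfun[of T] by (simp add: op_apply_def)

lemma bounded_linear_op_apply: "bounded_linear (op_apply T)"
  by (simp add: op_apply_def blinfun.bounded_linear_right)

lemma op_apply_add: "op_apply T (x + y) = op_apply T x + op_apply T y"
  by (simp add: op_apply_def blinfun.add_right)

lemma op_apply_diff: "op_apply T (x - y) = op_apply T x - op_apply T y"
  by (simp add: op_apply_def blinfun.diff_right)

lemma op_apply_zero [simp]: "op_apply T 0 = 0"
  by (simp add: op_apply_def)

lemma op_apply_mk_op:
  assumes add: "\<And>x y. f (x + y) = f x + f y"
    and scale: "\<And>c x. f (c *\<^sub>C x) = c *\<^sub>C f x"
    and bound: "\<And>x. norm (f x) \<le> norm x * b"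
  shows "op_apply (mk_op f) = f"
proof -
  have "bounded_linear f"
    by (rule bounded_linear_intro[where K = b]) (simp_all add: add scaleR_scaleC scale bound)
  then show ?thesis
    by (simp add: op_apply_def mk_op_def Abs_ell2_op_inverse bounded_linear_Blinfun_apply scale)
qed

instantiation ell2_op :: (type) real_vector
begin

definition zero_ell2_op :: "'a ell2_op" where "zero_ell2_op = Abs_ell2_op 0"
definition plus_ell2_op :: "'a ell2_op \<Rightarrow> 'a ell2_op \<Rightarrow> 'a ell2_op"
  where "plus_ell2_op S T = Abs_ell2_op (as_blinfun S + as_blinfun T)"
definition uminus_ell2_op :: "'a ell2_op \<Rightarrow> 'a ell2_op"
  where "uminus_ell2_op T = Abs_ell2_op (- as_blinfun T)"
definition minus_ell2_op :: "'a ell2_op \<Rightarrow> 'a ell2_op \<Rightarrow> 'a ell2_op"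
  where "minus_ell2_op S T = Abs_ell2_op (as_blinfun S - as_blinfun T)"
definition scaleR_ell2_op :: "real \<Rightarrow> 'a ell2_op \<Rightarrow> 'a ell2_op"
  where "scaleR_ell2_op r T = Abs_ell2_op (r *\<^sub>R as_blinfun T)"

lemma as_blinfun_scaleC: "as_blinfun T (c *\<^sub>C x) = c *\<^sub>C as_blinfun T x"
  using as_blinfun[of T] by simp

lemma scaleR_scaleC_commute: "r *\<^sub>R (c *\<^sub>C x) = c *\<^sub>C (r *\<^sub>R (x :: 'c::complex_normed_vector))"
  by (simp add: scaleR_scaleC scaleC_scaleC mult.commute)

lemma as_blinfun_simps:
  "as_blinfun (0 :: 'a ell2_op) = 0"
  "as_blinfun (S + T :: 'a ell2_op) = as_blinfun S + as_blinfun T"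
  "as_blinfun (- T :: 'a ell2_op) = - as_blinfun T"
  "as_blinfun (S - T :: 'a ell2_op) = as_blinfun S - as_blinfun T"
  "as_blinfun (r *\<^sub>R T :: 'a ell2_op) = r *\<^sub>R as_blinfun T"
  unfolding zero_ell2_op_def plus_ell2_op_def uminus_ell2_op_def minus_ell2_op_def
    scaleR_ell2_op_def
  by (subst Abs_ell2_op_inverse; simp add: blinfun.bilinear_simps as_blinfun_scaleC
      scaleC_add_right scaleC_diff_right scaleR_scaleC_commute)+

instance
  by standard (simp_all add: as_blinfun_inject[symmetric] as_blinfun_simps scaleR_add_left
      scaleR_add_right)

end

instantiation ell2_op :: (type) real_normed_vector
begin

definition norm_ell2_op :: "'a ell2_op \<Rightarrow> real" where "norm_ell2_op T = norm (as_blinfun T)"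
definition dist_ell2_op :: "'a ell2_op \<Rightarrow> 'a ell2_op \<Rightarrow> real" where "dist_ell2_op S T = norm (S - T)"
definition sgn_ell2_op :: "'a ell2_op \<Rightarrow> 'a ell2_op" where "sgn_ell2_op x = x /\<^sub>R norm x"
definition uniformity_ell2_op :: "('a ell2_op \<times> 'a ell2_op) filter"
  where "uniformity_ell2_op = (INF e\<in>{0<..}. principal {(x, y). dist x y < e})"
definition open_ell2_op :: "'a ell2_op set \<Rightarrow> bool"
  where "open_ell2_op U \<longleftrightarrow> (\<forall>x\<in>U. \<forall>\<^sub>F (x', y) in uniformity. x' = x \<longrightarrow> y \<in> U)"

instance
  by standard
    (simp_all add: norm_ell2_op_def dist_ell2_op_def sgn_ell2_op_def uniformity_ell2_op_def
      open_ell2_op_def as_blinfun_simps norm_triangle_ineq as_blinfun_inject[symmetric])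

end

lemma norm_op_apply: "norm (op_apply T x) \<le> norm T * norm x"
  by (simp add: norm_ell2_op_def op_apply_def norm_blinfun)

lemma norm_op_bound: "0 \<le> b \<Longrightarrow> (\<And>x. norm (op_apply T x) \<le> b * norm x) \<Longrightarrow> norm T \<le> b"
  by (simp add: norm_ell2_op_def op_apply_def norm_blinfun_bound)

lemma op_apply_simps [simp]:
  "op_apply 0 x = 0" "op_apply (S + T) x = op_apply S x + op_apply T x"
  "op_apply (- T) x = - op_apply T x" "op_apply (S - T) x = op_apply S x - op_apply T x"
  "op_apply (r *\<^sub>R T) x = r *\<^sub>R op_apply T x"
  by (simp_all add: op_apply_def as_blinfun_simps blinfun.bilinear_simps)

instance ell2_op :: (type) banach
proof
  fix X :: "nat \<Rightarrow> 'a ell2_op"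
  assume "Cauchy X"
  then have "Cauchy (\<lambda>n. as_blinfun (X n))"
    by (simp add: Cauchy_def dist_norm norm_ell2_op_def as_blinfun_simps)
  then obtain L where L: "(\<lambda>n. as_blinfun (X n)) \<longlonglongrightarrow> L"
    by (metis Cauchy_convergent convergent_def)
  have Lx: "(\<lambda>n. as_blinfun (X n) x) \<longlonglongrightarrow> L x" for x
    by (intro tendsto_intros L)
  have "L (c *\<^sub>C x) = c *\<^sub>C L x" for c x
  proof -
    have "(\<lambda>n. as_blinfun (X n) (c *\<^sub>C x)) \<longlonglongrightarrow> c *\<^sub>C L x"
      by (simp only: as_blinfun_scaleC) (intro bounded_linear.tendsto[OF bounded_linear_scaleC] Lx)
    with Lx[of "c *\<^sub>C x"] show ?thesis by (rule LIMSEQ_unique)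
  qed
  then have "as_blinfun (Abs_ell2_op L) = L" by (simp add: Abs_ell2_op_inverse)
  then have "X \<longlonglongrightarrow> Abs_ell2_op L"
    using L by (simp add: tendsto_iff dist_norm norm_ell2_op_def as_blinfun_simps)
  then show "convergent X" by (rule convergentI)
qed

definition ell2_adjoint :: "'i ell2_op \<Rightarrow> 'i ell2 \<Rightarrow> 'i ell2" where
  "ell2_adjoint T y = Abs_ell2 (\<lambda>i. cinner (op_apply T (ell2_basis i)) y)"

lemma coords_sum: "coords (\<Sum>i\<in>F. y i) j = (\<Sum>i\<in>F. coords (y i) j)"
  by (induction F rule: infinite_finite_induct) auto

lemma ell2_adjoint:
  shows coords_ell2_adjoint: "coords (ell2_adjoint T y) i = cinner (op_apply T (ell2_basis i)) y"
    and norm_ell2_adjoint: "norm (ell2_adjoint T y) \<le> norm T * norm y"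
proof -
  define f where "f i = cinner (op_apply T (ell2_basis i)) y" for i
  have bound: "(\<Sum>i\<in>F. (cmod (f i))\<^sup>2) \<le> (norm T * norm y)\<^sup>2" if F: "finite F" for F
  proof -
    define v where "v = (\<Sum>i\<in>F. f i *\<^sub>C ell2_basis i)"
    define s where "s = (\<Sum>i\<in>F. (cmod (f i))\<^sup>2)"
    have s0: "0 \<le> s" by (auto simp: s_def intro: sum_nonneg)
    have cv: "coords v j = (if j \<in> F then f j else 0)" for j
      using F by (simp add: v_def coords_sum if_distrib[of "(*) _"] sum.delta cong: if_cong)
    have "((\<lambda>i. (cmod (coords v i))\<^sup>2) has_sum s) F"
      unfolding s_def by (intro has_sum_finiteI F) (simp add: cv)
    then have "((\<lambda>i. (cmod (coords v i))\<^sup>2) has_sum s) UNIV"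
      by (rule has_sum_cong_neutral[THEN iffD1, rotated -1]) (auto simp: cv)
    from has_sum_unique[OF norm_ell2_has_sum this] have nv: "(norm v)\<^sup>2 = s" .
    have "cinner (op_apply T v) y = (\<Sum>i\<in>F. cinner (op_apply T (f i *\<^sub>C ell2_basis i)) y)"
      unfolding v_def
      by (simp add: linear_sum[OF bounded_linear.linear[OF bounded_linear_op_apply]]
          linear_sum[OF bounded_linear.linear[OF bounded_linear_cinner_left]])
    also have "\<dots> = (\<Sum>i\<in>F. cnj (f i) * f i)"
      by (simp add: op_apply_scaleC cinner_scaleC_left f_def)
    also have "\<dots> = complex_of_real s"
      by (simp add: s_def mult.commute complex_norm_square[symmetric])
    finally have "s = cmod (cinner (op_apply T v) y)" using s0 by simp
    also have "\<dots> \<le> norm (op_apply T v) * norm y" by (rule cinner_bound)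
    also have "\<dots> \<le> norm T * norm v * norm y" by (intro mult_right_mono norm_op_apply) simp
    finally have "norm v * norm v \<le> (norm T * norm y) * norm v"
      by (simp add: nv[symmetric] power2_eq_square mult.commute mult.left_commute)
    then have "norm v \<le> norm T * norm y"
      by (cases "norm v = 0") (auto simp: mult_le_cancel_right)
    then have "(norm v)\<^sup>2 \<le> (norm T * norm y)\<^sup>2" by (rule power_mono) simp
    with nv show ?thesis by (simp add: s_def)
  qed
  have c: "coords (ell2_adjoint T y) = f"
    unfolding ell2_adjoint_def f_def[symmetric]
    by (rule coords_Abs_ell2[OF square_summable_finite[OF bound]])
  show "coords (ell2_adjoint T y) i = cinner (op_apply T (ell2_basis i)) y"
    by (simp add: c f_def)
  show "norm (ell2_adjoint T y) \<le> norm T * norm y"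
    by (rule norm_ell2_le_finite) (use bound in \<open>auto simp: c\<close>)
qed

lemma cinner_ell2_adjoint: "cinner x (ell2_adjoint T y) = cinner (op_apply T x) y"
proof -
  have "((\<lambda>i. cinner (op_apply T (coords x i *\<^sub>C ell2_basis i)) y) has_sum cinner (op_apply T x) y) UNIV"
    using has_sum_bounded_linear[OF bounded_linear_compose[OF bounded_linear_cinner_left
          bounded_linear_op_apply] ell2_has_sum_basis[of x]] .
  then have "((\<lambda>i. cnj (coords x i) * coords (ell2_adjoint T y) i) has_sum cinner (op_apply T x) y) UNIV"
    by (simp add: op_apply_scaleC cinner_scaleC_left coords_ell2_adjoint)
  then show ?thesis unfolding cinner_def[of x] by (rule infsumI)
qed

lemma op_apply_mk_op_adjoint: "op_apply (mk_op (ell2_adjoint T)) = ell2_adjoint T"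
proof (rule op_apply_mk_op)
  fix x y c
  show "ell2_adjoint T (x + y) = ell2_adjoint T x + ell2_adjoint T y"
    "ell2_adjoint T (c *\<^sub>C x) = c *\<^sub>C ell2_adjoint T x"
    by (rule ell2_eqI; simp add: coords_ell2_adjoint cinner_add_right cinner_scaleC_right)+
  show "norm (ell2_adjoint T x) \<le> norm x * norm T"
    using norm_ell2_adjoint[of T x] by (simp add: mult.commute)
qed

lemma op_eq_cinnerI:
  assumes "\<And>x y. cinner x (op_apply S y) = cinner x (op_apply T y)"
  shows "S = T"
  using assms[of "ell2_basis _"] by (intro op_eqI ell2_eqI) simp

instantiation ell2_op :: (type) cstar_algebra
begin

definition scaleC_ell2_op :: "complex \<Rightarrow> 'a ell2_op \<Rightarrow> 'a ell2_op"
  where "scaleC_ell2_op c T = mk_op (\<lambda>x. c *\<^sub>C op_apply T x)"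
definition times_ell2_op :: "'a ell2_op \<Rightarrow> 'a ell2_op \<Rightarrow> 'a ell2_op"
  where "times_ell2_op S T = mk_op (\<lambda>x. op_apply S (op_apply T x))"
definition one_ell2_op :: "'a ell2_op"
  where "one_ell2_op = mk_op (\<lambda>x. x)"
definition star_ell2_op :: "'a ell2_op \<Rightarrow> 'a ell2_op"
  where "star_ell2_op T = mk_op (ell2_adjoint T)"

lemma op_apply_scaleC_left [simp]: "op_apply (c *\<^sub>C T :: 'a ell2_op) x = c *\<^sub>C op_apply T x"
proof -
  have "norm (c *\<^sub>C op_apply T x) \<le> norm x * (cmod c * norm T)" for x
    using mult_left_mono[OF norm_op_apply[of T x], of "cmod c"]
    by (simp add: norm_scaleC algebra_simps)
  then show ?thesis
    unfolding scaleC_ell2_op_def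
    by (subst op_apply_mk_op[where b = "cmod c * norm T"])
       (simp_all add: op_apply_add op_apply_scaleC scaleC_add_right scaleC_scaleC mult.commute)
qed

lemma op_apply_times [simp]: "op_apply (S * T :: 'a ell2_op) x = op_apply S (op_apply T x)"
proof -
  have "norm (op_apply S (op_apply T x)) \<le> norm x * (norm S * norm T)" for x
  proof -
    have "norm (op_apply S (op_apply T x)) \<le> norm S * (norm T * norm x)"
      by (rule order_trans[OF norm_op_apply]) (simp add: mult_left_mono norm_op_apply)
    then show ?thesis by (simp add: algebra_simps)
  qed
  then show ?thesis
    unfolding times_ell2_op_def
    by (subst op_apply_mk_op[where b = "norm S * norm T"]) (simp_all add: op_apply_add op_apply_scaleC)
qed

lemma op_apply_one [simp]: "op_apply (1 :: 'a ell2_op) x = x"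
  unfolding one_ell2_op_def by (subst op_apply_mk_op[where b = 1]) simp_all

lemma cinner_star_right: "cinner x (op_apply (star T :: 'a ell2_op) y) = cinner (op_apply T x) y"
  by (simp add: star_ell2_op_def op_apply_mk_op_adjoint cinner_ell2_adjoint)

lemma cinner_star_left: "cinner (op_apply (star T :: 'a ell2_op) x) y = cinner x (op_apply T y)"
  by (metis cinner_commute cinner_star_right)

lemma norm_star_op_le: "norm (star T) \<le> norm (T :: 'a ell2_op)"
  by (rule norm_op_bound) (simp_all add: star_ell2_op_def op_apply_mk_op_adjoint norm_ell2_adjoint)

instance
proof
  fix c d :: complex and r :: real and S T U :: "'a ell2_op"
  show "c *\<^sub>C (S + T) = c *\<^sub>C S + c *\<^sub>C T" by (rule op_eqI) (simp add: scaleC_add_right)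
  show "(c + d) *\<^sub>C S = c *\<^sub>C S + d *\<^sub>C S" by (rule op_eqI) (simp add: scaleC_add_left)
  show "c *\<^sub>C (d *\<^sub>C S) = (c * d) *\<^sub>C S" by (rule op_eqI) (simp add: scaleC_scaleC)
  show "r *\<^sub>R S = complex_of_real r *\<^sub>C S" by (rule op_eqI) (simp add: scaleR_scaleC)
  show "S * T * U = S * (T * U)" "1 * S = S" "S * 1 = S" by (rule op_eqI; simp)+
  show "(S + T) * U = S * U + T * U" "S * (T + U) = S * T + S * U"
    by (rule op_eqI; simp add: op_apply_add)+
  show "(r *\<^sub>R S) * T = r *\<^sub>R (S * T)" by (rule op_eqI) simp
  show "S * (r *\<^sub>R T) = r *\<^sub>R (S * T)"
    by (rule op_eqI) (simp add: scaleR_scaleC op_apply_scaleC)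
  show "(c *\<^sub>C S) * T = c *\<^sub>C (S * T)" "S * (c *\<^sub>C T) = c *\<^sub>C (S * T)"
    by (rule op_eqI; simp add: op_apply_scaleC)+
  show "star (S + T) = star S + star T" "star (c *\<^sub>C S) = cnj c *\<^sub>C star S"
    "star (S * T) = star T * star S" "star (star S) = S"
    by (rule op_eq_cinnerI; simp add: cinner_add_right cinner_add_left cinner_star_right
        cinner_star_left cinner_scaleC_right cinner_scaleC_left)+
  have le: "norm (c *\<^sub>C S) \<le> cmod c * norm S" for c and S :: "'a ell2_op"
    by (rule norm_op_bound)
       (simp_all add: norm_scaleC mult.assoc mult_left_mono norm_op_apply)
  show "norm (c *\<^sub>C S) = cmod c * norm S"
  proof (cases "c = 0")
    case True
    then have "c *\<^sub>C S = 0" by (intro op_eqI) simp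
    with True show ?thesis by simp
  next
    case False
    have "S = inverse c *\<^sub>C (c *\<^sub>C S)"
      using False by (intro op_eqI) (simp add: scaleC_scaleC)
    then have "norm S \<le> cmod (inverse c) * norm (c *\<^sub>C S)" by (metis le)
    then have "cmod c * norm S \<le> norm (c *\<^sub>C S)"
      using False by (simp add: norm_divide field_simps)
    with le[of c S] show ?thesis by simp
  qed
  show mult: "norm (S * T) \<le> norm S * norm T" for S T :: "'a ell2_op"
  proof (rule norm_op_bound)
    fix x
    have "norm (op_apply S (op_apply T x)) \<le> norm S * (norm T * norm x)"
      by (rule order_trans[OF norm_op_apply]) (simp add: mult_left_mono norm_op_apply)
    then show "norm (op_apply (S * T) x) \<le> norm S * norm T * norm x" by (simp add: mult.assoc)
  qed simp
  show "norm (star S * S) = (norm S)\<^sup>2"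
  proof (rule antisym)
    show "norm (star S * S) \<le> (norm S)\<^sup>2"
      unfolding power2_eq_square
      by (rule order_trans[OF mult]) (simp add: mult_right_mono norm_star_op_le)
    have "norm S \<le> sqrt (norm (star S * S))"
    proof (rule norm_op_bound)
      fix x
      have "complex_of_real ((norm (op_apply S x))\<^sup>2) = cinner x (op_apply (star S * S) x)"
        by (simp add: cinner_star_right cinner_self del: of_real_power)
      then have "(norm (op_apply S x))\<^sup>2 = cmod (cinner x (op_apply (star S * S) x))"
        by (metis abs_of_nonneg norm_of_real zero_le_power2)
      also have "\<dots> \<le> norm x * (norm (star S * S) * norm x)"
        by (rule order_trans[OF cinner_bound]) (simp add: mult_left_mono norm_op_apply del: op_apply_times)
      also have "\<dots> = (sqrt (norm (star S * S)) * norm x)\<^sup>2"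
        by (simp add: power_mult_distrib power2_eq_square algebra_simps)
      finally show "norm (op_apply S x) \<le> sqrt (norm (star S * S)) * norm x"
        by (rule power2_le_imp_le) simp
    qed simp
    then show "(norm S)\<^sup>2 \<le> norm (star S * S)"
      by (metis norm_ge_zero power_mono real_sqrt_pow2)
  qed
qed

end

lemma op_eq_basisI:
  assumes "\<And>i. op_apply S (ell2_basis i) = op_apply T (ell2_basis i)"
  shows "S = T"
proof -
  have "star S = star T"
    by (rule op_eqI, rule ell2_eqI)
       (simp add: star_ell2_op_def op_apply_mk_op_adjoint coords_ell2_adjoint assms)
  then show ?thesis by (metis star_star)
qed

text \<open>*-homomorphisms into bounded operators are automatically contractive.\<close>

lemma star_hom_op_contractive:
  fixes \<pi> :: "'a::cstar_algebra \<Rightarrow> 'i ell2_op"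
  assumes "star_hom \<pi>"
  shows "norm (\<pi> a) \<le> norm a"
proof -
  have add: "\<pi> (x + y) = \<pi> x + \<pi> y" and scale: "\<pi> (c *\<^sub>C x) = c *\<^sub>C \<pi> x"
    and mult: "\<pi> (x * y) = \<pi> x * \<pi> y" and star: "\<pi> (star x) = star (\<pi> x)" for x y c
    using assms by (auto simp: star_hom_def)
  have diff: "\<pi> (x - y) = \<pi> x - \<pi> y" for x y using add[of "x - y" y] by simp
  have sq: "cinner x (op_apply (\<pi> (star b * b)) x) = complex_of_real ((norm (op_apply (\<pi> b) x))\<^sup>2)"
    for b x by (simp add: mult star cinner_star_right cinner_self)
  have p: "norm (op_apply (\<pi> 1) x) \<le> norm x" for x
  proof -
    have "complex_of_real ((norm (op_apply (\<pi> 1) x))\<^sup>2) = cinner x (op_apply (\<pi> 1) x)"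
      using sq[of x 1] by simp
    then have "(norm (op_apply (\<pi> 1) x))\<^sup>2 = cmod (cinner x (op_apply (\<pi> 1) x))"
      by (metis abs_of_nonneg norm_of_real zero_le_power2)
    also have "\<dots> \<le> norm x * norm (op_apply (\<pi> 1) x)" by (rule cinner_bound)
    finally show ?thesis
      by (cases "norm (op_apply (\<pi> 1) x) = 0") (auto simp: power2_eq_square mult_le_cancel_right)
  qed
  have unit: "norm (\<pi> b) \<le> 1" if b: "norm b < 1" for b
  proof -
    have "norm (star b * b) < 1" using b by (simp add: norm_star_mult power_less_one_iff)
    moreover have "star (star b * b) = star b * b" by (simp add: star_mult)
    ultimately obtain c where c: "star c = c" "c * c = 1 - star b * b"
      using cstar_sqrt_one_minus by blast
    have "norm (op_apply (\<pi> b) x) \<le> 1 * norm x" for x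
    proof -
      have "op_apply (\<pi> (star c * c)) x = op_apply (\<pi> (star 1 * 1)) x - op_apply (\<pi> (star b * b)) x"
        by (simp only: c diff op_apply_simps star_one mult_1)
      then have "cinner x (op_apply (\<pi> (star c * c)) x) + cinner x (op_apply (\<pi> (star b * b)) x)
          = cinner x (op_apply (\<pi> (star 1 * 1)) x)"
        by (simp flip: cinner_add_right)
      then have "(norm (op_apply (\<pi> c) x))\<^sup>2 + (norm (op_apply (\<pi> b) x))\<^sup>2 = (norm (op_apply (\<pi> 1) x))\<^sup>2"
        unfolding sq by (metis of_real_add of_real_eq_iff)
      then have "(norm (op_apply (\<pi> b) x))\<^sup>2 \<le> (norm (op_apply (\<pi> 1) x))\<^sup>2"
        by (metis le_add_same_cancel2 zero_le_power2)
      then have "norm (op_apply (\<pi> b) x) \<le> norm (op_apply (\<pi> 1) x)"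
        by (rule power2_le_imp_le) simp
      with p[of x] show ?thesis by simp
    qed
    then show ?thesis by (intro norm_op_bound) auto
  qed
  show ?thesis
  proof (rule field_le_epsilon)
    fix e :: real assume e: "0 < e"
    define r where "r = norm a + e"
    have r: "0 < r" using e by (simp add: r_def add_nonneg_pos)
    have "norm (inverse r *\<^sub>R a) < 1" using r e by (simp add: r_def field_simps)
    from unit[OF this] have "norm (complex_of_real (inverse r) *\<^sub>C \<pi> a) \<le> 1"
      by (simp only: scaleR_scaleC scale)
    then have "inverse r * norm (\<pi> a) \<le> 1" using r by (simp add: norm_scaleC norm_inverse)
    then have "norm (\<pi> a) \<le> r" using r by (simp add: field_simps)
    then show "norm (\<pi> a) \<le> norm a + e" by (simp only: r_def)
  qed
qed


subsection \<open>Tensor products of operators\<close>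

definition ell2_tensor :: "'i ell2 \<Rightarrow> 'j ell2 \<Rightarrow> ('i \<times> 'j) ell2" where
  "ell2_tensor x y = Abs_ell2 (\<lambda>(i, j). coords x i * coords y j)"

definition ell2_flip :: "('i \<times> 'j) ell2 \<Rightarrow> ('j \<times> 'i) ell2" where
  "ell2_flip F = Abs_ell2 (\<lambda>(j, i). coords F (i, j))"

definition ell2_slice :: "'j \<Rightarrow> ('i \<times> 'j) ell2 \<Rightarrow> 'i ell2" where
  "ell2_slice j F = Abs_ell2 (\<lambda>i. coords F (i, j))"

definition amplify :: "'i ell2_op \<Rightarrow> ('i \<times> 'j) ell2 \<Rightarrow> ('i \<times> 'j) ell2" where
  "amplify T F = Abs_ell2 (\<lambda>(i, j). coords (op_apply T (ell2_slice j F)) i)"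

text \<open>\<open>S \<otimes> T = (S \<otimes> 1)(1 \<otimes> T)\<close> on \<open>\<ell>\<^sup>2(I \<times> J) = \<ell>\<^sup>2(I) \<otimes> \<ell>\<^sup>2(J)\<close>; it is characterised by
  \<open>op_tensor_apply\<close> below.\<close>

definition op_tensor :: "'i ell2_op \<Rightarrow> 'j ell2_op \<Rightarrow> ('i \<times> 'j) ell2_op" where
  "op_tensor S T = mk_op (amplify S) * mk_op (\<lambda>F. ell2_flip (amplify T (ell2_flip F)))"

lemma coords_ell2_flip [simp]: "coords (ell2_flip F) (j, i) = coords F (i, j)"
  and norm_ell2_flip [simp]: "norm (ell2_flip F) = norm F"
proof -
  have "((\<lambda>p. (cmod (coords F p))\<^sup>2) \<circ> prod.swap has_sum (norm F)\<^sup>2) UNIV"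
    using norm_ell2_has_sum[of F] by (subst has_sum_reindex[symmetric]) (auto simp: product_swap)
  then have hs: "((\<lambda>p. (cmod ((\<lambda>(j, i). coords F (i, j)) p))\<^sup>2) has_sum (norm F)\<^sup>2) UNIV"
    by (simp add: o_def case_prod_beta prod.swap_def)
  then have c: "coords (ell2_flip F) = (\<lambda>(j, i). coords F (i, j))"
    unfolding ell2_flip_def by (intro coords_Abs_ell2) (rule has_sum_imp_summable)
  then show "coords (ell2_flip F) (j, i) = coords F (i, j)" by simp
  have "(norm (ell2_flip F))\<^sup>2 = (norm F)\<^sup>2"
    using has_sum_unique[OF norm_ell2_has_sum[of "ell2_flip F", unfolded c] hs] .
  then show "norm (ell2_flip F) = norm F" by simp
qed

lemma coords_ell2_slice [simp]: "coords (ell2_slice j F) i = coords F (i, j)"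
proof -
  have "(\<lambda>p. (cmod (coords F p))\<^sup>2) summable_on range (\<lambda>i. (i, j))"
    by (rule summable_on_subset[OF coords_summable]) simp
  then have "(\<lambda>i. (cmod (coords F (i, j)))\<^sup>2) summable_on UNIV"
    by (subst (asm) summable_on_reindex) (auto simp: inj_on_def o_def)
  then show ?thesis by (simp add: ell2_slice_def coords_Abs_ell2)
qed

lemma ell2_slice_has_sum: "((\<lambda>j. (norm (ell2_slice j F))\<^sup>2) has_sum (norm F)\<^sup>2) UNIV"
proof (rule has_sum_SigmaD)
  show "((\<lambda>p. (cmod (coords (ell2_flip F) p))\<^sup>2) has_sum (norm F)\<^sup>2) (UNIV \<times> UNIV)"
    using norm_ell2_has_sum[of "ell2_flip F"] by simp
  show "((\<lambda>i. (cmod (coords (ell2_flip F) (j, i)))\<^sup>2) has_sum (norm (ell2_slice j F))\<^sup>2) UNIV" for j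
    using norm_ell2_has_sum[of "ell2_slice j F"] by simp
qed

lemma coords_amplify [simp]: "coords (amplify T F) (i, j) = coords (op_apply T (ell2_slice j F)) i"
  and norm_amplify: "norm (amplify T F) \<le> norm F * norm T"
proof -
  define f where "f p = (case p of (j, i) \<Rightarrow> coords (op_apply T (ell2_slice j F)) i)" for p
  have b: "(norm (op_apply T (ell2_slice j F)))\<^sup>2 \<le> (norm T)\<^sup>2 * (norm (ell2_slice j F))\<^sup>2" for j
    using power_mono[OF norm_op_apply, of T _ 2] by (simp add: power_mult_distrib)
  have s: "((\<lambda>j. (norm T)\<^sup>2 * (norm (ell2_slice j F))\<^sup>2) has_sum (norm T)\<^sup>2 * (norm F)\<^sup>2) UNIV"
    by (intro has_sum_cmult_right ell2_slice_has_sum)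
  have fj: "((\<lambda>i. (cmod (f (j, i)))\<^sup>2) has_sum (norm (op_apply T (ell2_slice j F)))\<^sup>2) UNIV" for j
    using norm_ell2_has_sum[of "op_apply T (ell2_slice j F)"] by (simp add: f_def)
  have g: "(\<lambda>j. (norm (op_apply T (ell2_slice j F)))\<^sup>2) summable_on UNIV"
    by (rule summable_on_comparison_test[OF has_sum_imp_summable[OF s]]) (use b in auto)
  have "(\<lambda>p. (cmod (f p))\<^sup>2) summable_on UNIV \<times> UNIV"
    by (rule summable_on_SigmaI[OF _ g]) (use fj in auto)
  then have fs: "(\<lambda>p. (cmod (f p))\<^sup>2) summable_on UNIV" by simp
  then have cf: "coords (Abs_ell2 f) = f" by (rule coords_Abs_ell2)
  have eq: "(\<lambda>(i, j). coords (op_apply T (ell2_slice j F)) i) = coords (ell2_flip (Abs_ell2 f))"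
    by (auto simp: fun_eq_iff cf f_def)
  have am: "amplify T F = ell2_flip (Abs_ell2 f)"
    unfolding amplify_def eq by (rule coords_inverse)
  show "coords (amplify T F) (i, j) = coords (op_apply T (ell2_slice j F)) i"
    by (simp add: am cf f_def)
  have "((\<lambda>j. (norm (op_apply T (ell2_slice j F)))\<^sup>2) has_sum (norm (Abs_ell2 f))\<^sup>2) UNIV"
    by (rule has_sum_SigmaD[where f = "\<lambda>p. (cmod (f p))\<^sup>2"])
       (use fj norm_ell2_has_sum[of "Abs_ell2 f"] in \<open>auto simp: cf\<close>)
  then have "(norm (Abs_ell2 f))\<^sup>2 \<le> (norm T)\<^sup>2 * (norm F)\<^sup>2"
    by (rule has_sum_mono[OF _ s]) (rule b)
  then have "(norm (Abs_ell2 f))\<^sup>2 \<le> (norm F * norm T)\<^sup>2"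
    by (simp add: power_mult_distrib mult.commute)
  then show "norm (amplify T F) \<le> norm F * norm T"
    unfolding am norm_ell2_flip by (rule power2_le_imp_le) simp
qed

lemma coords_ell2_tensor [simp]: "coords (ell2_tensor x y) (i, j) = coords x i * coords y j"
proof -
  have "(\<lambda>p. (cmod (case p of (i, j) \<Rightarrow> coords x i * coords y j))\<^sup>2) summable_on UNIV \<times> UNIV"
  proof (rule summable_on_SigmaI)
    fix i
    show "((\<lambda>j. (cmod (case (i, j) of (i, j) \<Rightarrow> coords x i * coords y j))\<^sup>2)
        has_sum (cmod (coords x i))\<^sup>2 * (norm y)\<^sup>2) UNIV"
      by (simp add: norm_mult power_mult_distrib has_sum_cmult_right norm_ell2_has_sum)
    show "(\<lambda>i. (cmod (coords x i))\<^sup>2 * (norm y)\<^sup>2) summable_on UNIV"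
      by (intro summable_on_cmult_left coords_summable)
  qed simp
  then show ?thesis by (simp add: ell2_tensor_def coords_Abs_ell2)
qed

lemma op_apply_amplify: "op_apply (mk_op (amplify T)) = amplify T"
proof (rule op_apply_mk_op)
  fix F G :: "('a \<times> 'b) ell2" and c
  have "ell2_slice j (F + G) = ell2_slice j F + ell2_slice j G"
    "ell2_slice j (c *\<^sub>C F) = c *\<^sub>C ell2_slice j F" for j
    by (rule ell2_eqI; simp)+
  then show "amplify T (F + G) = amplify T F + amplify T G"
    "amplify T (c *\<^sub>C F) = c *\<^sub>C amplify T F"
    by (auto intro!: ell2_eqI simp: op_apply_add op_apply_scaleC)
qed (rule norm_amplify)

lemma op_apply_flip_amplify:
  fixes T :: "'j ell2_op" and F :: "('i \<times> 'j) ell2"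
  shows "op_apply (mk_op (\<lambda>F. ell2_flip (amplify T (ell2_flip F)))) F = ell2_flip (amplify T (ell2_flip F))"
proof -
  note lin = op_apply_add[of "mk_op (amplify T)", unfolded op_apply_amplify]
    op_apply_scaleC[of "mk_op (amplify T)", unfolded op_apply_amplify]
  have flip: "ell2_flip (F + G) = ell2_flip F + ell2_flip G"
    "ell2_flip (c *\<^sub>C F) = c *\<^sub>C ell2_flip F" for F G :: "('x \<times> 'y) ell2" and c
    by (auto intro!: ell2_eqI)
  show ?thesis
  proof (subst op_apply_mk_op[where b = "norm T"])
    fix F G :: "('i \<times> 'j) ell2" and c
    show "norm (ell2_flip (amplify T (ell2_flip F))) \<le> norm F * norm T"
      using norm_amplify[of T "ell2_flip F"] by simp
  qed (simp_all add: flip lin)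
qed

lemma op_tensor_apply: "op_apply (op_tensor S T) (ell2_tensor x y) = ell2_tensor (op_apply S x) (op_apply T y)"
proof -
  have flip: "ell2_flip (ell2_tensor x y) = ell2_tensor y x" for x :: "'x ell2" and y :: "'y ell2"
    by (auto intro!: ell2_eqI)
  have slice: "ell2_slice j (ell2_tensor x y) = coords y j *\<^sub>C x" for x :: "'x ell2" and y :: "'y ell2" and j
    by (rule ell2_eqI) simp
  have amp: "amplify T (ell2_tensor x y) = ell2_tensor (op_apply T x) y"
    for x :: "'x ell2" and y :: "'y ell2" and T
    by (auto intro!: ell2_eqI simp: slice op_apply_scaleC)
  show ?thesis
    by (simp add: op_tensor_def op_apply_amplify op_apply_flip_amplify flip amp)
qed

lemma ell2_tensor_basis: "ell2_tensor (ell2_basis i) (ell2_basis j) = ell2_basis (i, j)"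
  by (auto intro!: ell2_eqI)

lemma op_tensor_basis:
  "op_apply (op_tensor S T) (ell2_basis (i, j)) =
    ell2_tensor (op_apply S (ell2_basis i)) (op_apply T (ell2_basis j))"
  by (simp add: op_tensor_apply flip: ell2_tensor_basis)

lemma norm_op_tensor_le:
  fixes S :: "'i ell2_op" and T :: "'j ell2_op"
  shows "norm (op_tensor S T) \<le> norm S * norm T"
proof -
  have "norm (mk_op (amplify S) :: ('i \<times> 'j) ell2_op) \<le> norm S"
    by (rule norm_op_bound) (use norm_amplify in \<open>auto simp: op_apply_amplify mult.commute\<close>)
  moreover have "norm (mk_op (\<lambda>F :: ('i \<times> 'j) ell2. ell2_flip (amplify T (ell2_flip F)))) \<le> norm T"
  proof (rule norm_op_bound)
    fix F :: "('i \<times> 'j) ell2"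
    show "norm (op_apply (mk_op (\<lambda>F. ell2_flip (amplify T (ell2_flip F)))) F) \<le> norm T * norm F"
      using norm_amplify[of T "ell2_flip F"] by (simp add: op_apply_flip_amplify mult.commute)
  qed simp
  ultimately show ?thesis
    unfolding op_tensor_def by (intro order_trans[OF norm_mult_ineq] mult_mono) auto
qed

lemma op_tensor_simps:
  shows op_tensor_add_left: "op_tensor (S + S') T = op_tensor S T + op_tensor S' T"
    and op_tensor_add_right: "op_tensor S (T + T') = op_tensor S T + op_tensor S T'"
    and op_tensor_scaleC_left: "op_tensor (c *\<^sub>C S) T = c *\<^sub>C op_tensor S T"
    and op_tensor_scaleC_right: "op_tensor S (c *\<^sub>C T) = c *\<^sub>C op_tensor S T"
    and op_tensor_mult: "op_tensor S T * op_tensor S' T' = op_tensor (S * S') (T * T')"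
    and op_tensor_star: "star (op_tensor S T) = op_tensor (star S) (star T)"
proof -
  show "op_tensor (S + S') T = op_tensor S T + op_tensor S' T"
    "op_tensor S (T + T') = op_tensor S T + op_tensor S T'"
    "op_tensor (c *\<^sub>C S) T = c *\<^sub>C op_tensor S T" "op_tensor S (c *\<^sub>C T) = c *\<^sub>C op_tensor S T"
    by (intro op_eq_basisI; auto intro!: ell2_eqI simp: op_tensor_basis algebra_simps)+
  show "op_tensor S T * op_tensor S' T' = op_tensor (S * S') (T * T')"
    by (intro op_eq_basisI) (auto simp: op_tensor_basis op_tensor_apply)
  have star: "coords (op_apply (star U) (ell2_basis i)) k = cnj (coords (op_apply U (ell2_basis k)) i)"
    for U :: "'x ell2_op" and i k
    by (metis cinner_basis_left cinner_basis_right cinner_star_right)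
  show "star (op_tensor S T) = op_tensor (star S) (star T)"
    by (intro op_eq_basisI) (auto intro!: ell2_eqI simp: op_tensor_basis star)
qed


subsection \<open>The minimal tensor product\<close>

text \<open>
  The minimal (spatial) norm of \<open>\<Sum>\<^sub>k a\<^sub>k \<otimes> b\<^sub>k\<close> is the supremum of
  \<open>\<parallel>\<Sum>\<^sub>k \<pi>(a\<^sub>k) \<otimes> \<sigma>(b\<^sub>k)\<parallel>\<close> over all representations \<open>\<pi>\<close> of \<open>A\<close> and \<open>\<sigma>\<close> of \<open>B\<close> on Hilbert
  spaces (lemma \<open>norm_min_tensor_sum\<close>). Restricting to the Hilbert spaces \<open>\<ell>\<^sup>2(A)\<close> and
  \<open>\<ell>\<^sup>2(B)\<close>, indexed by the sets \<open>A\<close> and \<open>B\<close> themselves, loses nothing: the supremum is attained at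
  any pair of faithful representations, and \<open>A\<close> has a faithful representation of Hilbert dimension
  at most \<open>card A\<close> (a direct sum of at most \<open>card A\<close> cyclic ones), which acts on a closed subspace of
  \<open>\<ell>\<^sup>2(A)\<close>. For this reason representations are allowed to be degenerate.

  \<open>A \<otimes> B\<close> is the completion of the algebraic tensor product in this norm, realised as the closed
  linear span of the families \<open>(\<pi>, \<sigma>) \<mapsto> \<pi>(a) \<otimes> \<sigma>(b)\<close> in the C*-algebra of all bounded families of
  operators indexed by pairs of representations; the discrete topology on \<open>'a rep\<close> makes
  \<open>bcontfun\<close> the type of all bounded families.
\<close>

typedef (overloaded) 'a rep = "{\<pi> :: 'a::cstar_algebra \<Rightarrow> 'a ell2_op. star_hom \<pi>}"
  morphisms rep_apply Abs_rep
  by (rule exI[of _ "\<lambda>_. 0"]) (simp add: star_hom_def)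

instantiation rep :: (cstar_algebra) discrete_topology
begin
definition open_rep :: "'a rep set \<Rightarrow> bool" where "open_rep S \<longleftrightarrow> True"
instance by standard (simp_all add: open_rep_def)
end

instance prod :: (discrete_topology, discrete_topology) discrete_topology
proof
  fix A :: "('a \<times> 'b) set"
  have "open (\<Union>p\<in>A. {fst p} \<times> {snd p})" by (intro open_UN ballI open_Times open_discrete)
  then show "open A" by simp
qed

definition spatial ::
  "'a::cstar_algebra \<Rightarrow> 'b::cstar_algebra \<Rightarrow> ('a rep \<times> 'b rep) \<Rightarrow>\<^sub>C ('a \<times> 'b) ell2_op" where
  "spatial a b = Bcontfun (\<lambda>(\<pi>, \<sigma>). op_tensor (rep_apply \<pi> a) (rep_apply \<sigma> b))"

typedef (overloaded) ('a, 'b) min_tensor  (infixr "\<otimes>" 25) =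
  "closure (cspan {spatial a b |(a::'a::cstar_algebra) (b::'b::cstar_algebra). True})"
  morphisms rep_min_tensor Abs_min_tensor
  by (rule exI[of _ 0], rule subsetD[OF closure_subset]) (simp add: cspan_def span_zero)

lemma star_hom_rep: "star_hom (rep_apply \<pi>)"
  using rep_apply[of \<pi>] by simp

lemma rep_apply_simps:
  "rep_apply \<pi> (a + b) = rep_apply \<pi> a + rep_apply \<pi> b"
  "rep_apply \<pi> (c *\<^sub>C a) = c *\<^sub>C rep_apply \<pi> a"
  "rep_apply \<pi> (a * b) = rep_apply \<pi> a * rep_apply \<pi> b"
  "rep_apply \<pi> (star a) = star (rep_apply \<pi> a)"
  using star_hom_rep[of \<pi>] by (simp_all add: star_hom_def)

lemma apply_spatial: "apply_bcontfun (spatial a b) p =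
    op_tensor (rep_apply (fst p) a) (rep_apply (snd p) b)"
proof -
  have "apply_bcontfun (spatial a b) = (\<lambda>(\<pi>, \<sigma>). op_tensor (rep_apply \<pi> a) (rep_apply \<sigma> b))"
    unfolding spatial_def
  proof (rule apply_Bcontfun[where b = "norm a * norm b"])
    show "continuous_on UNIV (\<lambda>(\<pi>, \<sigma>). op_tensor (rep_apply \<pi> a) (rep_apply \<sigma> b))"
      by simp
    show "norm (case p of (\<pi>, \<sigma>) \<Rightarrow> op_tensor (rep_apply \<pi> a) (rep_apply \<sigma> b)) \<le> norm a * norm b"
      for p :: "'a rep \<times> 'b rep"
      by (auto split: prod.split intro!: order_trans[OF norm_op_tensor_le] mult_mono
          star_hom_op_contractive star_hom_rep)
  qed
  then show ?thesis by (simp add: case_prod_beta)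
qed

lemma norm_spatial_le: "norm (spatial a b) \<le> norm a * norm b"
  by (rule norm_bound)
     (auto simp: apply_spatial intro!: order_trans[OF norm_op_tensor_le] mult_mono
       star_hom_op_contractive star_hom_rep)

lemma spatial_simps:
  "spatial (a + a') b = spatial a b + spatial a' b"
  "spatial a (b + b') = spatial a b + spatial a b'"
  "spatial (c *\<^sub>C a) b = c *\<^sub>C spatial a b"
  "spatial a (c *\<^sub>C b) = c *\<^sub>C spatial a b"
  "spatial a b * spatial a' b' = spatial (a * a') (b * b')"
  "star (spatial a b) = spatial (star a) (star b)"
  by (rule bcontfun_eqI; simp add: apply_spatial apply_cstar_bcontfun rep_apply_simps op_tensor_simps)+

lemma closure_of_subspace:
  fixes S :: "'a::real_normed_vector set"
  assumes S: "subspace S"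
  shows "subspace (closure S)"
proof (rule subspaceI)
  show "0 \<in> closure S" using subspace_0[OF S] closure_subset by blast
  fix x y and r :: real assume x: "x \<in> closure S"
  then obtain u where u: "\<And>n. u n \<in> S" "u \<longlonglongrightarrow> x"
    by (auto simp: closure_sequential)
  show "r *\<^sub>R x \<in> closure S"
    using tendsto_scaleR[OF tendsto_const[of r] u(2)] subspace_scale[OF S u(1)]
    unfolding closure_sequential by (intro exI[of _ "\<lambda>n. r *\<^sub>R u n"]) auto
  assume "y \<in> closure S"
  then obtain v where v: "\<And>n. v n \<in> S" "v \<longlonglongrightarrow> y"
    by (auto simp: closure_sequential)
  show "x + y \<in> closure S"
    using tendsto_add[OF u(2) v(2)] subspace_add[OF S u(1) v(1)]
    unfolding closure_sequential by (intro exI[of _ "\<lambda>n. u n + v n"]) auto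
qed

lemma cspan_eq_span:
  assumes "\<And>c x. x \<in> S \<Longrightarrow> c *\<^sub>C x \<in> S"
  shows "cspan S = span S"
proof -
  have "{c *\<^sub>C x |c x. x \<in> S} = S" using assms by (auto intro: exI[of _ 1] scaleC_one[symmetric])
  then show ?thesis by (simp add: cspan_def)
qed

definition spatial_tensors :: "(('a::cstar_algebra rep \<times> 'b::cstar_algebra rep) \<Rightarrow>\<^sub>C ('a \<times> 'b) ell2_op) set"
  where "spatial_tensors = {spatial a b |a b. True}"

definition spatial_algebra :: "(('a::cstar_algebra rep \<times> 'b::cstar_algebra rep) \<Rightarrow>\<^sub>C ('a \<times> 'b) ell2_op) set"
  where "spatial_algebra = closure (span spatial_tensors)"

lemma rep_min_tensor_in: "rep_min_tensor (x :: ('a::cstar_algebra, 'b::cstar_algebra) min_tensor) \<in> spatial_algebra"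
  and spatial_algebra_eq: "spatial_algebra =
    closure (cspan {spatial a b |(a::'a) (b::'b). True})"
proof -
  have "cspan {spatial a b |(a::'a) (b::'b). True} = span spatial_tensors"
    unfolding spatial_tensors_def
    by (rule cspan_eq_span) (auto, metis spatial_simps(3))
  then show eq: "spatial_algebra = closure (cspan {spatial a b |(a::'a) (b::'b). True})"
    by (simp add: spatial_algebra_def)
  show "rep_min_tensor x \<in> spatial_algebra" unfolding eq by (rule rep_min_tensor)
qed

lemma rep_Abs_min_tensor: "x \<in> spatial_algebra \<Longrightarrow> rep_min_tensor (Abs_min_tensor x) = x"
  by (simp add: Abs_min_tensor_inverse spatial_algebra_eq)

lemma spatial_in: "spatial a b \<in> spatial_algebra"
  unfolding spatial_algebra_def spatial_tensors_def
  by (rule subsetD[OF closure_subset], rule span_base) blast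

lemma subspace_spatial_algebra: "subspace spatial_algebra"
  unfolding spatial_algebra_def by (rule closure_of_subspace) (rule subspace_span)

lemma spatial_algebra_linear:
  assumes f: "bounded_linear f" and S: "f ` spatial_tensors \<subseteq> spatial_algebra"
    and x: "x \<in> spatial_algebra"
  shows "f x \<in> spatial_algebra"
proof -
  have "f ` span spatial_tensors = span (f ` spatial_tensors)"
    by (rule linear_span_image[symmetric]) (rule bounded_linear.linear[OF f])
  also have "\<dots> \<subseteq> spatial_algebra"
    by (rule span_minimal[OF S subspace_spatial_algebra])
  finally have "closure (f ` span spatial_tensors) \<subseteq> spatial_algebra"
    by (rule closure_minimal) (simp add: spatial_algebra_def)
  moreover have "f x \<in> closure (f ` span spatial_tensors)"
    using closure_bounded_linear_image_subset[OF f, of "span spatial_tensors"] x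
    by (auto simp: spatial_algebra_def)
  ultimately show ?thesis by blast
qed

lemma spatial_algebra_scaleC: "x \<in> spatial_algebra \<Longrightarrow> c *\<^sub>C x \<in> spatial_algebra"
  by (rule spatial_algebra_linear[OF bounded_linear_scaleC])
     (auto simp: spatial_tensors_def spatial_in simp flip: spatial_simps)

lemma spatial_algebra_star: "x \<in> spatial_algebra \<Longrightarrow> star x \<in> spatial_algebra"
  by (rule spatial_algebra_linear[OF bounded_linear_star])
     (auto simp: spatial_tensors_def spatial_in spatial_simps)

lemma spatial_algebra_mult:
  assumes "x \<in> spatial_algebra" "y \<in> spatial_algebra"
  shows "x * y \<in> spatial_algebra"
proof -
  have "x * spatial a b \<in> spatial_algebra" for a b
    by (rule spatial_algebra_linear[OF bounded_linear_mult_left _ assms(1)])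
       (auto simp: spatial_tensors_def spatial_in spatial_simps)
  then show ?thesis
    by (intro spatial_algebra_linear[OF bounded_linear_mult_right _ assms(2)])
       (auto simp: spatial_tensors_def)
qed

lemma spatial_algebra_one:
  assumes x: "x \<in> spatial_algebra"
  shows "spatial 1 1 * x = x" "x * spatial 1 1 = x"
proof -
  have eq: "f x = x" if f: "bounded_linear f" and S: "\<And>a b. f (spatial a b) = spatial a b" for f
  proof -
    have "f y = y" if "y \<in> span spatial_tensors" for y
      by (rule linear_eq_on[OF bounded_linear.linear[OF f] linear_id[unfolded id_def] that])
         (auto simp: spatial_tensors_def S)
    then have "closure (span spatial_tensors) \<subseteq> {y. f y = y}"
      by (intro closure_minimal closed_Collect_eq bounded_linear.continuous_on[OF f]
          continuous_on_id) auto
    with x show ?thesis by (auto simp: spatial_algebra_def)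
  qed
  show "spatial 1 1 * x = x" "x * spatial 1 1 = x"
    by (rule eq[OF bounded_linear_mult_right], simp add: spatial_simps)
       (rule eq[OF bounded_linear_mult_left], simp add: spatial_simps)
qed

instantiation min_tensor :: (cstar_algebra, cstar_algebra) real_vector
begin

definition zero_min_tensor :: "'a \<otimes> 'b" where "zero_min_tensor = Abs_min_tensor 0"
definition plus_min_tensor :: "'a \<otimes> 'b \<Rightarrow> 'a \<otimes> 'b \<Rightarrow> 'a \<otimes> 'b"
  where "plus_min_tensor x y = Abs_min_tensor (rep_min_tensor x + rep_min_tensor y)"
definition uminus_min_tensor :: "'a \<otimes> 'b \<Rightarrow> 'a \<otimes> 'b"
  where "uminus_min_tensor x = Abs_min_tensor (- rep_min_tensor x)"
definition minus_min_tensor :: "'a \<otimes> 'b \<Rightarrow> 'a \<otimes> 'b \<Rightarrow> 'a \<otimes> 'b"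
  where "minus_min_tensor x y = Abs_min_tensor (rep_min_tensor x - rep_min_tensor y)"
definition scaleR_min_tensor :: "real \<Rightarrow> 'a \<otimes> 'b \<Rightarrow> 'a \<otimes> 'b"
  where "scaleR_min_tensor r x = Abs_min_tensor (r *\<^sub>R rep_min_tensor x)"

lemma rep_min_tensor_vector:
  "rep_min_tensor (0 :: 'a \<otimes> 'b) = 0"
  "rep_min_tensor (x + y :: 'a \<otimes> 'b) = rep_min_tensor x + rep_min_tensor y"
  "rep_min_tensor (- x :: 'a \<otimes> 'b) = - rep_min_tensor x"
  "rep_min_tensor (x - y :: 'a \<otimes> 'b) = rep_min_tensor x - rep_min_tensor y"
  "rep_min_tensor (r *\<^sub>R x :: 'a \<otimes> 'b) = r *\<^sub>R rep_min_tensor x"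
  unfolding zero_min_tensor_def plus_min_tensor_def uminus_min_tensor_def minus_min_tensor_def
    scaleR_min_tensor_def
  by (rule rep_Abs_min_tensor; intro subspace_0 subspace_add subspace_neg subspace_diff
      subspace_scale subspace_spatial_algebra rep_min_tensor_in)+

instance
  by standard (simp_all add: rep_min_tensor_inject[symmetric] rep_min_tensor_vector
      scaleR_add_left scaleR_add_right)

end

instantiation min_tensor :: (cstar_algebra, cstar_algebra) real_normed_vector
begin

definition norm_min_tensor :: "'a \<otimes> 'b \<Rightarrow> real" where "norm_min_tensor x = norm (rep_min_tensor x)"
definition dist_min_tensor :: "'a \<otimes> 'b \<Rightarrow> 'a \<otimes> 'b \<Rightarrow> real" where "dist_min_tensor x y = norm (x - y)"
definition sgn_min_tensor :: "'a \<otimes> 'b \<Rightarrow> 'a \<otimes> 'b" where "sgn_min_tensor x = x /\<^sub>R norm x"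
definition uniformity_min_tensor :: "(('a \<otimes> 'b) \<times> ('a \<otimes> 'b)) filter"
  where "uniformity_min_tensor = (INF e\<in>{0<..}. principal {(x, y). dist x y < e})"
definition open_min_tensor :: "('a \<otimes> 'b) set \<Rightarrow> bool"
  where "open_min_tensor U \<longleftrightarrow> (\<forall>x\<in>U. \<forall>\<^sub>F (x', y) in uniformity. x' = x \<longrightarrow> y \<in> U)"

instance
  by standard
    (simp_all add: norm_min_tensor_def dist_min_tensor_def sgn_min_tensor_def
      uniformity_min_tensor_def open_min_tensor_def rep_min_tensor_vector norm_triangle_ineq
      rep_min_tensor_inject[symmetric])

end

instance min_tensor :: (cstar_algebra, cstar_algebra) banach
proof
  fix X :: "nat \<Rightarrow> 'a \<otimes> 'b"
  assume "Cauchy X"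
  then have "Cauchy (\<lambda>n. rep_min_tensor (X n))"
    by (simp add: Cauchy_def dist_norm norm_min_tensor_def rep_min_tensor_vector)
  then obtain L where L: "(\<lambda>n. rep_min_tensor (X n)) \<longlonglongrightarrow> L"
    by (metis Cauchy_convergent convergent_def)
  have "L \<in> spatial_algebra"
    by (rule closed_sequentially[OF _ _ L]) (auto simp: spatial_algebra_def[symmetric] rep_min_tensor_in,
        simp add: spatial_algebra_def)
  then have "X \<longlonglongrightarrow> Abs_min_tensor L"
    using L by (simp add: tendsto_iff dist_norm norm_min_tensor_def rep_min_tensor_vector
        rep_Abs_min_tensor)
  then show "convergent X" by (rule convergentI)
qed

instantiation min_tensor :: (cstar_algebra, cstar_algebra) cstar_algebra
begin

definition scaleC_min_tensor :: "complex \<Rightarrow> 'a \<otimes> 'b \<Rightarrow> 'a \<otimes> 'b"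
  where "scaleC_min_tensor c x = Abs_min_tensor (c *\<^sub>C rep_min_tensor x)"
definition times_min_tensor :: "'a \<otimes> 'b \<Rightarrow> 'a \<otimes> 'b \<Rightarrow> 'a \<otimes> 'b"
  where "times_min_tensor x y = Abs_min_tensor (rep_min_tensor x * rep_min_tensor y)"
definition one_min_tensor :: "'a \<otimes> 'b"
  where "one_min_tensor = Abs_min_tensor (spatial 1 1)"
definition star_min_tensor :: "'a \<otimes> 'b \<Rightarrow> 'a \<otimes> 'b"
  where "star_min_tensor x = Abs_min_tensor (star (rep_min_tensor x))"

lemma rep_min_tensor_cstar:
  "rep_min_tensor (c *\<^sub>C x :: 'a \<otimes> 'b) = c *\<^sub>C rep_min_tensor x"
  "rep_min_tensor (x * y :: 'a \<otimes> 'b) = rep_min_tensor x * rep_min_tensor y"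
  "rep_min_tensor (1 :: 'a \<otimes> 'b) = spatial 1 1"
  "rep_min_tensor (star x :: 'a \<otimes> 'b) = star (rep_min_tensor x)"
  by (simp_all add: scaleC_min_tensor_def times_min_tensor_def one_min_tensor_def
      star_min_tensor_def rep_Abs_min_tensor spatial_algebra_scaleC spatial_algebra_mult
      spatial_algebra_star spatial_in rep_min_tensor_in)

instance
proof
  fix c d :: complex and r :: real and x y z :: "'a \<otimes> 'b"
  note [simp] = rep_min_tensor_inject[symmetric] rep_min_tensor_vector rep_min_tensor_cstar
    norm_min_tensor_def
  show "c *\<^sub>C (x + y) = c *\<^sub>C x + c *\<^sub>C y" by (simp add: scaleC_add_right)
  show "(c + d) *\<^sub>C x = c *\<^sub>C x + d *\<^sub>C x" by (simp add: scaleC_add_left)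
  show "c *\<^sub>C (d *\<^sub>C x) = (c * d) *\<^sub>C x" by (simp add: scaleC_scaleC)
  show "r *\<^sub>R x = complex_of_real r *\<^sub>C x" by (simp add: scaleR_scaleC)
  show "norm (c *\<^sub>C x) = cmod c * norm x" by (simp add: norm_scaleC)
  show "x * y * z = x * (y * z)" by (simp add: mult.assoc)
  show "(x + y) * z = x * z + y * z" "x * (y + z) = x * y + x * z"
    by (simp_all add: distrib_left distrib_right)
  show "(r *\<^sub>R x) * y = r *\<^sub>R (x * y)" "x * (r *\<^sub>R y) = r *\<^sub>R (x * y)" by simp_all
  show "norm (x * y) \<le> norm x * norm y" by (simp add: norm_mult_ineq)
  show "1 * x = x" "x * 1 = x" by (simp_all add: spatial_algebra_one rep_min_tensor_in)
  show "(c *\<^sub>C x) * y = c *\<^sub>C (x * y)" "x * (c *\<^sub>C y) = c *\<^sub>C (x * y)"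
    by (simp_all add: scaleC_mult_left scaleC_mult_right)
  show "star (x + y) = star x + star y" by (simp add: star_add)
  show "star (c *\<^sub>C x) = cnj c *\<^sub>C star x" by (simp add: star_scaleC)
  show "star (x * y) = star y * star x" by (simp add: star_mult)
  show "star (star x) = x" by simp
  show "norm (star x * x) = (norm x)\<^sup>2" by (simp add: norm_star_mult)
qed

end

definition tens :: "'a::cstar_algebra \<Rightarrow> 'b::cstar_algebra \<Rightarrow> 'a \<otimes> 'b"  (infixr "\<otimes>" 75) where
  "a \<otimes> b = Abs_min_tensor (spatial a b)"

lemma rep_tens: "rep_min_tensor (a \<otimes> b) = spatial a b"
  by (simp add: tens_def rep_Abs_min_tensor spatial_in)

lemma tens_simps:
  "(a + a') \<otimes> b = a \<otimes> b + a' \<otimes> b" "a \<otimes> (b + b') = a \<otimes> b + a \<otimes> b'"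
  "(c *\<^sub>C a) \<otimes> b = c *\<^sub>C (a \<otimes> b)" "a \<otimes> (c *\<^sub>C b) = c *\<^sub>C (a \<otimes> b)"
  "(a \<otimes> b) * (a' \<otimes> b') = (a * a') \<otimes> (b * b')"
  "star (a \<otimes> b) = star a \<otimes> star b" "1 \<otimes> 1 = 1"
  by (simp_all add: rep_min_tensor_inject[symmetric] rep_min_tensor_vector rep_min_tensor_cstar
      rep_tens spatial_simps)

lemma norm_tens_le: "norm (a \<otimes> b) \<le> norm a * norm b"
  by (simp add: norm_min_tensor_def rep_tens norm_spatial_le)

lemma norm_min_tensor_sum:
  "norm (\<Sum>i\<in>I. a i \<otimes> b i) =
    (SUP (\<pi>, \<sigma>). norm (\<Sum>i\<in>I. op_tensor (rep_apply \<pi> (a i)) (rep_apply \<sigma> (b i))))"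
proof -
  have "rep_min_tensor (\<Sum>i\<in>I. a i \<otimes> b i) = (\<Sum>i\<in>I. spatial (a i) (b i))"
    by (induction I rule: infinite_finite_induct) (simp_all add: rep_min_tensor_vector rep_tens)
  moreover have "apply_bcontfun (\<Sum>i\<in>I. spatial (a i) (b i)) p =
      (\<Sum>i\<in>I. op_tensor (rep_apply (fst p) (a i)) (rep_apply (snd p) (b i)))" for p
    by (induction I rule: infinite_finite_induct) (simp_all add: apply_spatial)
  ultimately show ?thesis
    by (simp add: norm_min_tensor_def norm_bcontfun_def dist_bcontfun_def case_prod_beta dist_norm)
qed

lemma closure_cspan_tens: "closure (cspan {a \<otimes> b |a b. True}) = (UNIV :: ('a::cstar_algebra \<otimes> 'b::cstar_algebra) set)"
proof -
  have lin: "linear (rep_min_tensor :: 'a \<otimes> 'b \<Rightarrow> _)"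
    by (rule linearI) (simp_all add: rep_min_tensor_vector)
  have cs: "cspan {a \<otimes> b |(a::'a) (b::'b). True} = span {a \<otimes> b |(a::'a) (b::'b). True}"
    by (rule cspan_eq_span) (auto, metis tens_simps(3))
  have img: "rep_min_tensor ` span {a \<otimes> b |(a::'a) (b::'b). True} = span spatial_tensors"
  proof -
    have "rep_min_tensor ` {a \<otimes> b |(a::'a) (b::'b). True} = {rep_min_tensor (a \<otimes> b) |a b. True}"
      by blast
    then have "rep_min_tensor ` {a \<otimes> b |(a::'a) (b::'b). True} = spatial_tensors"
      by (simp only: rep_tens spatial_tensors_def)
    then show ?thesis by (metis linear_span_image[OF lin])
  qed
  have "x \<in> closure (span {a \<otimes> b |(a::'a) (b::'b). True})" for x :: "'a \<otimes> 'b"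
  proof (subst closure_approachable, intro allI impI)
    fix e :: real assume "0 < e"
    with rep_min_tensor_in[of x] obtain y where "y \<in> span spatial_tensors" "dist y (rep_min_tensor x) < e"
      unfolding spatial_algebra_def closure_approachable by blast
    then obtain z where "z \<in> span {a \<otimes> b |(a::'a) (b::'b). True}" "y = rep_min_tensor z"
      using img by blast
    with \<open>dist y _ < e\<close> show "\<exists>z\<in>span {a \<otimes> b |(a::'a) (b::'b). True}. dist z x < e"
      by (auto simp: dist_norm norm_min_tensor_def rep_min_tensor_vector)
  qed
  then show ?thesis unfolding cs by blast
qed

lemma tensor_extension_unique:
  fixes h k :: "'a::cstar_algebra \<otimes> 'b::cstar_algebra \<Rightarrow> 'c::real_normed_vector"
  assumes h: "bounded_linear h" and k: "bounded_linear k" and eq: "\<And>a b. h (a \<otimes> b) = k (a \<otimes> b)"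
  shows "h = k"
proof
  fix x
  have cs: "cspan {a \<otimes> b |(a::'a) (b::'b). True} = span {a \<otimes> b |(a::'a) (b::'b). True}"
    by (rule cspan_eq_span) (auto, metis tens_simps(3))
  have "h y = k y" if "y \<in> span {a \<otimes> b |(a::'a) (b::'b). True}" for y
    by (rule linear_eq_on[OF bounded_linear.linear[OF h] bounded_linear.linear[OF k] that])
       (auto simp: eq)
  then have "closure (span {a \<otimes> b |(a::'a) (b::'b). True}) \<subseteq> {y. h y = k y}"
    by (intro closure_minimal closed_Collect_eq bounded_linear.continuous_on[OF h]
        bounded_linear.continuous_on[OF k] continuous_on_id) auto
  then show "h x = k x" using closure_cspan_tens[where 'a = 'a and 'b = 'b] unfolding cs by blast
qed


subsection \<open>Compact quantum groups and ergodic actions\<close>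

text \<open>\<open>is_tensor_map f g h\<close> says that \<open>h\<close> is the map \<open>f \<otimes> g\<close>, and \<open>is_tensor_assoc h\<close> that \<open>h\<close> is the
  canonical identification of \<open>(A \<otimes> B) \<otimes> C\<close> with \<open>A \<otimes> (B \<otimes> C)\<close>. Such a map is unique
  (\<open>tensor_extension_unique\<close>), and for *-homomorphisms \<open>f\<close> and \<open>g\<close> it always exists, by the standard
  properties of the spatial norm; so the existential quantifiers over these maps below impose
  nothing.\<close>

definition is_tensor_map ::
  "('a::cstar_algebra \<Rightarrow> 'c::cstar_algebra) \<Rightarrow> ('b::cstar_algebra \<Rightarrow> 'd::cstar_algebra) \<Rightarrow>
    ('a \<otimes> 'b \<Rightarrow> 'c \<otimes> 'd) \<Rightarrow> bool" where
  "is_tensor_map f g h \<longleftrightarrow> bounded_linear h \<and> (\<forall>a b. h (a \<otimes> b) = f a \<otimes> g b)"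

definition is_tensor_assoc ::
  "(('a::cstar_algebra \<otimes> 'b::cstar_algebra) \<otimes> 'c::cstar_algebra \<Rightarrow> 'a \<otimes> ('b \<otimes> 'c)) \<Rightarrow> bool" where
  "is_tensor_assoc h \<longleftrightarrow> bounded_linear h \<and> (\<forall>a b c. h ((a \<otimes> b) \<otimes> c) = a \<otimes> (b \<otimes> c))"

text \<open>\<open>(\<alpha> \<otimes> id)\<alpha> = (id \<otimes> \<Delta>)\<alpha>\<close>; coassociativity of \<open>\<Delta>\<close> is the case \<open>\<alpha> = \<Delta>\<close>.\<close>

definition coaction_identity ::
  "('a::cstar_algebra \<Rightarrow> 'a \<otimes> 'a) \<Rightarrow> ('b::cstar_algebra \<Rightarrow> 'b \<otimes> 'a) \<Rightarrow> bool" where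
  "coaction_identity \<Delta> \<alpha> \<longleftrightarrow>
     (\<exists>\<alpha>_id id_\<Delta> assoc.
        is_tensor_map \<alpha> id \<alpha>_id \<and> is_tensor_map id \<Delta> id_\<Delta> \<and> is_tensor_assoc assoc \<and>
        (\<forall>b. assoc (\<alpha>_id (\<alpha> b)) = id_\<Delta> (\<alpha> b)))"

definition compact_quantum_group :: "('a::cstar_algebra \<Rightarrow> 'a \<otimes> 'a) \<Rightarrow> bool" where
  "compact_quantum_group \<Delta> \<longleftrightarrow>
     unital_star_hom \<Delta> \<and>
     coaction_identity \<Delta> \<Delta> \<and>
     closure (cspan {\<Delta> a * (1 \<otimes> b) |a b. True}) = UNIV \<and>
     closure (cspan {\<Delta> a * (b \<otimes> 1) |a b. True}) = UNIV"

definition quantum_group_action ::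
  "('a::cstar_algebra \<Rightarrow> 'a \<otimes> 'a) \<Rightarrow> ('b::cstar_algebra \<Rightarrow> 'b \<otimes> 'a) \<Rightarrow> bool" where
  "quantum_group_action \<Delta> \<alpha> \<longleftrightarrow>
     unital_star_hom \<alpha> \<and>
     coaction_identity \<Delta> \<alpha> \<and>
     closure (cspan {\<alpha> b * (1 \<otimes> a) |a b. True}) = UNIV"

definition ergodic :: "('b::cstar_algebra \<Rightarrow> 'b \<otimes> 'a::cstar_algebra) \<Rightarrow> bool" where
  "ergodic \<alpha> \<longleftrightarrow> {b. \<alpha> b = b \<otimes> 1} = {c *\<^sub>C 1 |c. True}"

end

theory Submission
  imports Defs
begin

text \<open>
  Averaging an ergodic action over the Haar state \<open>h\<close> gives an invariant state \<open>\<mu>\<close> of \<open>C(X)\<close>, which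
  is atomic since \<open>X\<close> is countable. Invariance together with ergodicity shows that the mass of a
  point is at most the mass of every clopen set of positive mass: if \<open>\<mu>(U) > 0\<close>, then the projection
  \<open>\<alpha>(1\<^sub>U)\<close> does not vanish at any point \<open>y\<close>, so some state \<open>\<phi>\<close> takes the value \<open>1\<close> on it there, and
  \<open>\<mu>(U) = \<mu>((id \<otimes> \<phi>)\<alpha>(1\<^sub>U)) \<ge> \<mu>({y})\<close>. Hence \<open>\<mu>\<close> is the uniform measure on a finite set \<open>F\<close>. The
  state \<open>\<mu>\<close> need not be faithful a priori, but strong invariance of \<open>h\<close> expresses
  \<open>(ev\<^sub>y \<otimes> h)(\<alpha>(b)(1 \<otimes> a))\<close> linearly by the corresponding values at the points of \<open>F\<close>, and density
  extends this to all of \<open>C(X) \<otimes> A\<close>. A continuous function is thus determined by its values on \<open>F\<close>,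
  so \<open>X = F\<close> is finite.

  As \<open>A\<close> is not known to be faithfully represented without the Gelfand--Naimark theorem, all
  arguments are carried out with functionals that are limits of vector functionals; these
  separate the points of the minimal tensor product by its definition.
\<close>

subsection \<open>Transport of representations to \<open>\<ell>\<^sup>2(C)\<close>\<close>

text \<open>Ergodicity enters as \<open>(id \<otimes> h)\<alpha>(b) = \<mu>(b) 1\<close>. This value
  is the same at every point, so a clopen set of positive mass has a nonzero
  \<open>\<alpha>(1\<^sub>U)\<close> everywhere. The slice
  \<open>(id \<otimes> \<phi>)\<alpha>(1\<^sub>U)\<close> is a nonnegative function with value 1 at
  y, whence the lower bound. Taken along clopen neighbourhoods shrinking to another atom, the bound
  makes all atoms equally heavy, and total mass 1 leaves finitely many. The remaining obstacle is
  that X may have points outside F, which \<mu> does not see, and that h may have a kernel. A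
  function n vanishing on F satisfies \<open>\<mu>(n star(n)) = 0\<close>; by constancy and
  Cauchy-Schwarz, \<open>(ev\<^sub>y \<otimes> h)(\<alpha>(n)(1 \<otimes> x)) = 0\<close> at every
  y. Hence only finitely many functions, dual to the points of F, enter the computation, and strong
  invariance can be phrased with the finite matrix of their images under \<alpha>, without an
  antipode.\<close>

lemma star_homD:
  assumes "star_hom f"
  shows "f (x + y) = f x + f y" "f (c *\<^sub>C x) = c *\<^sub>C f x" "f (x * y) = f x * f y"
    "f (star x) = star (f x)" "f (x - y) = f x - f y" "f 0 = 0" "f (- x) = - f x"
proof -
  show add: "f (x + y) = f x + f y" for x y using assms by (simp add: star_hom_def)
  show sc: "f (c *\<^sub>C x) = c *\<^sub>C f x" for c x using assms by (simp add: star_hom_def)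
  show "f (x * y) = f x * f y" "f (star x) = star (f x)" using assms by (simp_all add: star_hom_def)
  show z: "f 0 = 0" using add[of 0 0] by simp
  show "f (x - y) = f x - f y" using add[of "x - y" y] by (simp add: algebra_simps)
  show "f (- x) = - f x" using add[of x "- x"] z by (simp add: add_eq_0_iff2)
qed

lemma star_hom_compose: "star_hom f \<Longrightarrow> star_hom g \<Longrightarrow> star_hom (\<lambda>x. f (g x))"
  by (simp add: star_hom_def)

lemma star_hom_rep_exists:
  assumes "star_hom \<rho>"
  obtains \<pi> :: "'c::cstar_algebra rep" where "rep_apply \<pi> = \<rho>"
  using Abs_rep_inverse[of \<rho>] assms by auto

lemma infinite_cstar_UNIV:
  assumes "(1::'c::cstar_algebra) \<noteq> 0"
  shows "infinite (UNIV :: 'c set)"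
proof
  assume fin: "finite (UNIV :: 'c set)"
  have "inj (\<lambda>n::nat. of_nat n *\<^sub>R (1::'c))"
    using assms by (auto intro: injI)
  then show False
    using fin finite_imageD[of "\<lambda>n::nat. of_nat n *\<^sub>R (1::'c)" UNIV] infinite_UNIV_nat
      finite_subset[OF subset_UNIV fin] by blast
qed

definition ell2_supp :: "'i ell2 \<Rightarrow> 'i set" where
  "ell2_supp x = {i. coords x i \<noteq> 0}"

lemma countable_ell2_supp: "countable (ell2_supp x)"
proof -
  have "countable {i\<in>UNIV. (cmod (coords x i))\<^sup>2 \<noteq> 0}"
    by (rule summable_countable_real[OF coords_summable])
  then show ?thesis by (simp add: ell2_supp_def)
qed

lemma coords_op_apply_has_sum:
  "((\<lambda>k. coords x k * coords (op_apply T (ell2_basis k)) i) has_sum coords (op_apply T x) i) UNIV"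
proof -
  have "bounded_linear (\<lambda>x. cinner (ell2_basis i) (op_apply T x))"
    by (rule bounded_linear_compose[OF bounded_linear_cinner_right bounded_linear_op_apply])
  from has_sum_bounded_linear[OF this ell2_has_sum_basis[of x]] show ?thesis
    by (simp add: op_apply_scaleC)
qed

lemma op_apply_supp:
  assumes "ell2_supp x \<subseteq> J" "\<And>k. k \<in> J \<Longrightarrow> ell2_supp (op_apply T (ell2_basis k)) \<subseteq> J"
  shows "ell2_supp (op_apply T x) \<subseteq> J"
proof
  fix i assume i: "i \<in> ell2_supp (op_apply T x)"
  show "i \<in> J"
  proof (rule ccontr)
    assume "i \<notin> J"
    then have "coords x k * coords (op_apply T (ell2_basis k)) i = 0" for k
      using assms by (cases "k \<in> J") (auto simp: ell2_supp_def)
    then have "coords (op_apply T x) i = 0"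
      using coords_op_apply_has_sum[of x T i] by (auto dest: has_sum_unique[OF _ has_sum_0])
    with i show False by (simp add: ell2_supp_def)
  qed
qed

text \<open>Closing the countable support of a vector under the operators \<open>\<rho> c\<close> takes \<open>\<omega>\<close> steps,
  each of which adds at most \<open>card C\<close> indices.\<close>

lemma small_invariant_index_set:
  fixes \<rho> :: "'c \<Rightarrow> 'i ell2_op"
  assumes "infinite (UNIV :: 'c set)" "countable I"
  obtains J and f :: "'i \<Rightarrow> 'c" where "I \<subseteq> J" "inj_on f J"
    "\<And>k c. k \<in> J \<Longrightarrow> ell2_supp (op_apply (\<rho> c) (ell2_basis k)) \<subseteq> J"
proof -
  include cardinal_syntax
  let ?C = "UNIV :: 'c set"
  define step where "step K = K \<union> (\<Union>k\<in>K. \<Union>c. ell2_supp (op_apply (\<rho> c) (ell2_basis k)))" for K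
  define J where "J = (\<Union>n. (step ^^ n) I)"
  have nat_le: "|UNIV::nat set| \<le>o |?C|"
    using assms infinite_iff_card_of_nat by blast
  have cnt: "|K| \<le>o |?C|" if "countable K" for K :: "'k set"
  proof -
    have "|K| \<le>o |UNIV::nat set|"
      using that unfolding countable_def by (auto simp flip: card_of_ordLeq)
    then show ?thesis using nat_le ordLeq_transitive by blast
  qed
  have un: "|\<Union>k\<in>K. A k| \<le>o |?C|" if "|K| \<le>o |?C|" "\<And>k. |A k| \<le>o |?C|"
    for K :: "'k set" and A :: "'k \<Rightarrow> 'i set"
    using card_of_UNION_ordLeq_infinite[OF _ that(1)] assms that(2) by auto
  have "|\<Union>b\<in>{True, False}. if b then K else L| \<le>o |?C|"
    if "|K| \<le>o |?C|" "|L| \<le>o |?C|" for K L :: "'i set"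
  proof (rule un)
    show "|{True, False}| \<le>o |?C|" by (rule cnt) simp
  qed (use that in auto)
  then have two: "|K \<union> L| \<le>o |?C|" if "|K| \<le>o |?C|" "|L| \<le>o |?C|" for K L :: "'i set"
    using that by simp
  have "|(step ^^ n) I| \<le>o |?C|" for n
  proof (induction n)
    case 0
    then show ?case using cnt assms by simp
  next
    case (Suc n)
    have "|\<Union>c. ell2_supp (op_apply (\<rho> c) (ell2_basis k))| \<le>o |?C|" for k
      by (rule un) (auto simp: cnt countable_ell2_supp card_of_mono1)
    from two[OF Suc un[OF Suc this]] show ?case
      by (simp only: funpow.simps o_apply step_def[of "(step ^^ n) I"])
  qed
  then have "|J| \<le>o |?C|" unfolding J_def by (intro un nat_le)
  then obtain f :: "'i \<Rightarrow> 'c" where "inj_on f J" by (auto simp flip: card_of_ordLeq)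
  moreover have "I \<subseteq> J" unfolding J_def by (metis UN_upper UNIV_I funpow_0)
  moreover have "ell2_supp (op_apply (\<rho> c) (ell2_basis k)) \<subseteq> J" if k: "k \<in> J" for k c
  proof -
    obtain n where "k \<in> (step ^^ n) I" using k by (auto simp: J_def)
    then have "ell2_supp (op_apply (\<rho> c) (ell2_basis k)) \<subseteq> (step ^^ Suc n) I"
      by (auto simp: step_def)
    then show ?thesis unfolding J_def by blast
  qed
  ultimately show thesis using that by blast
qed

text \<open>For f injective on J this is a partial isometry onto \<open>\<ell>\<^sup>2(J)\<close>
  inside \<open>\<ell>\<^sup>2(I)\<close>, and \<open>ell2_push\<close> is its adjoint. Together
  they relabel operators on that subspace by the target index type.\<close>

definition ell2_pull :: "'i set \<Rightarrow> ('i \<Rightarrow> 'k) \<Rightarrow> 'k ell2 \<Rightarrow> 'i ell2" where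
  "ell2_pull J f y = Abs_ell2 (\<lambda>i. if i \<in> J then coords y (f i) else 0)"

definition ell2_push :: "'i set \<Rightarrow> ('i \<Rightarrow> 'k) \<Rightarrow> 'i ell2 \<Rightarrow> 'k ell2" where
  "ell2_push J f = ell2_pull (f ` J) (inv_into J f)"

lemma
  assumes inj: "inj_on f J"
  shows coords_ell2_pull: "coords (ell2_pull J f y) i = (if i \<in> J then coords y (f i) else 0)"
    and norm_ell2_pull: "norm (ell2_pull J f y) \<le> norm y"
proof -
  let ?g = "\<lambda>i. if i \<in> J then coords y (f i) else 0"
  have b: "(\<Sum>i\<in>F. (cmod (?g i))\<^sup>2) \<le> (norm y)\<^sup>2" if "finite F" for F
  proof -
    have "(\<Sum>i\<in>F. (cmod (?g i))\<^sup>2) = (\<Sum>i\<in>F \<inter> J. (cmod (coords y (f i)))\<^sup>2)"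
      using that by (intro sum.mono_neutral_cong_right) auto
    also have "\<dots> = (\<Sum>k\<in>f ` (F \<inter> J). (cmod (coords y k))\<^sup>2)"
      by (rule sum.reindex_cong[symmetric, where l = f]) (auto intro: inj_on_subset[OF inj])
    also have "\<dots> \<le> (norm y)\<^sup>2" using that by (intro sum_coords_le) auto
    finally show ?thesis .
  qed
  have c: "coords (ell2_pull J f y) = ?g"
    unfolding ell2_pull_def by (rule coords_Abs_ell2, rule square_summable_finite, rule b)
  then show "coords (ell2_pull J f y) i = ?g i" by simp
  show "norm (ell2_pull J f y) \<le> norm y"
    by (rule norm_ell2_le_finite) (use b in \<open>auto simp: c\<close>)
qed

lemma coords_ell2_push:
  assumes "inj_on f J"
  shows "coords (ell2_push J f x) k = (if k \<in> f ` J then coords x (inv_into J f k) else 0)"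
  unfolding ell2_push_def by (rule coords_ell2_pull) (simp add: inj_on_inv_into)

lemma norm_ell2_push: "norm (ell2_push J f x) \<le> norm x"
  unfolding ell2_push_def by (rule norm_ell2_pull) (simp add: inj_on_inv_into)

lemma cinner_ell2_push:
  assumes inj: "inj_on f J"
  shows "cinner (ell2_push J f x) y = cinner x (ell2_pull J f y)"
proof -
  have "cinner (ell2_push J f x) y = (\<Sum>\<^sub>\<infinity>k\<in>f ` J. cnj (coords x (inv_into J f k)) * coords y k)"
    unfolding cinner_def by (rule infsum_cong_neutral) (auto simp: coords_ell2_push[OF inj])
  also have "\<dots> = (\<Sum>\<^sub>\<infinity>i\<in>J. cnj (coords x i) * coords y (f i))"
    by (subst infsum_reindex[OF inj]) (auto intro!: infsum_cong simp: inj)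
  also have "\<dots> = cinner x (ell2_pull J f y)"
    unfolding cinner_def by (rule infsum_cong_neutral) (auto simp: coords_ell2_pull[OF inj])
  finally show ?thesis .
qed

lemma ell2_pull_push:
  assumes inj: "inj_on f J" and "ell2_supp x \<subseteq> J"
  shows "ell2_pull J f (ell2_push J f x) = x"
proof (rule ell2_eqI)
  fix i
  show "coords (ell2_pull J f (ell2_push J f x)) i = coords x i"
    using assms(2) by (auto simp: coords_ell2_push[OF inj] coords_ell2_pull[OF inj] inj ell2_supp_def)
qed

lemma ell2_supp_pull: "inj_on f J \<Longrightarrow> ell2_supp (ell2_pull J f y) \<subseteq> J"
  by (auto simp: ell2_supp_def coords_ell2_pull split: if_splits)

text \<open>\<open>rep\<close> only admits representations on the space indexed by the algebra
  itself. The vector lies in an invariant subspace \<open>\<ell>\<^sup>2(J)\<close> with J no larger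
  than the algebra, so compressing \<rho> to it and relabelling J by f loses nothing for this
  functional.\<close>

lemma vector_functional_standard_form:
  fixes \<rho> :: "'c::cstar_algebra \<Rightarrow> 'i ell2_op"
  assumes hom: "star_hom \<rho>"
  shows "\<exists>(\<pi> :: 'c rep) \<eta>. \<forall>c. cinner \<xi> (op_apply (\<rho> c) \<xi>) = cinner \<eta> (op_apply (rep_apply \<pi> c) \<eta>)"
\<comment> \<open>The zero algebra is finite, so the cardinality argument does not cover it; there
  every value is 0 and the zero vector serves.\<close>
proof (cases "(1::'c) = 0")
  case True
  then have "c = 0" for c :: 'c by (metis mult_1 mult_zero_left)
  moreover have "\<rho> 0 = 0" "rep_apply \<pi> 0 = 0" for \<pi> :: "'c rep"
    using star_homD(6)[OF hom] star_homD(6)[OF star_hom_rep] by auto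
  ultimately have "cinner \<xi> (op_apply (\<rho> c) \<xi>) = cinner (0::'c ell2) (op_apply (rep_apply \<pi> c) 0)"
    for c and \<pi> :: "'c rep"
    by (metis cinner_scaleC_right mult_zero_left op_apply_simps(1) scaleC_zero_left)
  then show ?thesis by blast
next
  case False
  obtain J and f :: "'i \<Rightarrow> 'c" where J: "ell2_supp \<xi> \<subseteq> J" and inj: "inj_on f J"
    and inv: "\<And>k c. k \<in> J \<Longrightarrow> ell2_supp (op_apply (\<rho> c) (ell2_basis k)) \<subseteq> J"
    using small_invariant_index_set[OF infinite_cstar_UNIV[OF False] countable_ell2_supp] by metis
  note [simp] = coords_ell2_push[OF inj] coords_ell2_pull[OF inj]
  let ?V = "ell2_pull J f" and ?W = "ell2_push J f"
  define \<pi> where "\<pi> c = mk_op (\<lambda>y. ?W (op_apply (\<rho> c) (?V y)))" for c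
  have Vlin: "?V (x + y) = ?V x + ?V y" "?V (c *\<^sub>C x) = c *\<^sub>C ?V x" for x y c
    by (rule ell2_eqI; simp)+
  have Wlin: "?W (x + y) = ?W x + ?W y" "?W (c *\<^sub>C x) = c *\<^sub>C ?W x" for x y c
    by (rule ell2_eqI; simp)+
  have ap: "op_apply (\<pi> c) y = ?W (op_apply (\<rho> c) (?V y))" for c y
  proof -
    have "norm (?W (op_apply (\<rho> c) (?V y))) \<le> norm y * norm (\<rho> c)" for y
      using norm_ell2_push[of J f "op_apply (\<rho> c) (?V y)"] norm_op_apply[of "\<rho> c" "?V y"]
        mult_left_mono[OF norm_ell2_pull[OF inj, of y], of "norm (\<rho> c)"]
      by (simp add: mult.commute)
    then show ?thesis
      unfolding \<pi>_def by (subst op_apply_mk_op[where b = "norm (\<rho> c)"])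
        (simp_all add: Vlin Wlin op_apply_add op_apply_scaleC)
  qed
  \<comment> \<open>Invariance of J under every \<open>\<rho> c\<close> makes pushing and pulling
    back the identity here; multiplicativity of \<pi> rests on this.\<close>
  have VW: "?V (?W (op_apply (\<rho> c) (?V y))) = op_apply (\<rho> c) (?V y)" for c y
    by (rule ell2_pull_push[OF inj op_apply_supp]) (use inv ell2_supp_pull[OF inj] in auto)
  have "star_hom \<pi>"
    unfolding star_hom_def
  proof (intro conjI allI)
    fix x y c
    show "\<pi> (x + y) = \<pi> x + \<pi> y" by (rule op_eqI) (simp add: ap star_homD[OF hom] Wlin)
    show "\<pi> (c *\<^sub>C x) = c *\<^sub>C \<pi> x" by (rule op_eqI) (simp add: ap star_homD[OF hom] Wlin)
    show "\<pi> (x * y) = \<pi> x * \<pi> y" by (rule op_eqI) (simp add: ap star_homD[OF hom] VW)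
    show "\<pi> (star x) = star (\<pi> x)"
    proof (rule op_eq_cinnerI)
      fix u v
      have "cinner u (op_apply (\<pi> (star x)) v) = cnj (cinner (op_apply (\<rho> (star x)) (?V v)) (?V u))"
        unfolding ap by (subst cinner_commute) (simp add: cinner_ell2_push[OF inj])
      also have "\<dots> = cnj (cinner (?V v) (op_apply (\<rho> x) (?V u)))"
        by (simp add: star_homD[OF hom] cinner_star_left)
      also have "\<dots> = cinner (op_apply (\<pi> x) u) v"
        unfolding ap cinner_ell2_push[OF inj] by (metis cinner_commute)
      finally show "cinner u (op_apply (\<pi> (star x)) v) = cinner u (op_apply (star (\<pi> x)) v)"
        by (simp add: cinner_star_right)
    qed
  qed
  then obtain \<pi>' :: "'c rep" where \<pi>': "rep_apply \<pi>' = \<pi>" by (rule star_hom_rep_exists)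
  have V\<xi>: "?V (?W \<xi>) = \<xi>" by (rule ell2_pull_push[OF inj J])
  have "cinner (?W \<xi>) (op_apply (\<pi> c) (?W \<xi>)) = cinner \<xi> (op_apply (\<rho> c) \<xi>)" for c
    using VW[of c "?W \<xi>"] by (simp add: ap cinner_ell2_push[OF inj] V\<xi>)
  then show ?thesis using \<pi>' by metis
qed

subsection \<open>Positive functionals\<close>

text \<open>By the GNS construction these are all the positive functionals, but only their
  approximability by vector functionals is ever needed: it makes tensor products of positive
  functionals exist on the minimal tensor product.\<close>

definition vector_functionals :: "('c::cstar_algebra \<Rightarrow> complex) set" where
  "vector_functionals = {\<lambda>c. cinner \<xi> (op_apply (rep_apply \<pi> c) \<xi>) |\<pi> \<xi>. True}"

text \<open>The closure is taken for pointwise convergence, so that bounded parts are compact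
  without an appeal to the GNS construction.\<close>

definition pos_fun :: "('c::cstar_algebra \<Rightarrow> complex) set" where
  "pos_fun = closure vector_functionals"

definition states :: "('c::cstar_algebra \<Rightarrow> complex) set" where
  "states = {\<phi> \<in> pos_fun. \<phi> 1 = 1}"

lemma vector_functional_in:
  "star_hom \<rho> \<Longrightarrow> (\<lambda>c. cinner \<xi> (op_apply (\<rho> c) \<xi>)) \<in> vector_functionals"
  using vector_functional_standard_form[of \<rho> \<xi>] unfolding vector_functionals_def
  by (auto simp: fun_eq_iff)

lemma vector_functional_pos_fun:
  "star_hom \<rho> \<Longrightarrow> (\<lambda>c. cinner \<xi> (op_apply (\<rho> c) \<xi>)) \<in> pos_fun"
  unfolding pos_fun_def using vector_functional_in closure_subset by blast

lemma closed_pos_fun: "closed pos_fun"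
  by (simp add: pos_fun_def)

text \<open>Every law of positive functionals compares values at fixed elements, hence defines a
  closed set for pointwise convergence. It is enough to check it on vector functionals.\<close>

lemma pos_fun_induct [consumes 1, case_names vector closed]:
  assumes "\<phi> \<in> pos_fun"
    and "\<And>(\<pi> :: 'c::cstar_algebra rep) \<xi>. Q (\<lambda>c. cinner \<xi> (op_apply (rep_apply \<pi> c) \<xi>))"
    and "closed {\<phi>. Q \<phi>}"
  shows "Q \<phi>"
proof -
  have "closure vector_functionals \<subseteq> {\<phi>. Q \<phi>}"
    using assms(2,3) by (intro closure_minimal) (auto simp: vector_functionals_def)
  with assms(1) show ?thesis by (auto simp: pos_fun_def)
qed

lemma pos_fun_image:
  fixes G :: "('c::cstar_algebra \<Rightarrow> complex) \<Rightarrow> 'd::cstar_algebra \<Rightarrow> complex"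
  assumes "\<phi> \<in> pos_fun" "continuous_on UNIV G"
    and "\<And>(\<pi> :: 'c rep) \<xi>. G (\<lambda>c. cinner \<xi> (op_apply (rep_apply \<pi> c) \<xi>)) \<in> pos_fun"
  shows "G \<phi> \<in> pos_fun"
  using assms(1)
proof (induction rule: pos_fun_induct)
  case closed
  have "closed (G -` pos_fun)"
    by (rule closed_vimage[OF closed_pos_fun assms(2)])
  then show ?case by (simp add: vimage_def)
qed (rule assms(3))

declare continuous_on_product_coordinates [continuous_intros]

lemma cinner_ell2_tensor:
  "cinner (ell2_tensor x y) (ell2_tensor x' y') = cinner x x' * cinner y y'"
proof -
  let ?u = "ell2_tensor x y" and ?v = "ell2_tensor x' y'"
  have "((\<lambda>p. cnj (coords ?u p) * coords ?v p) has_sum (cinner x x' * cinner y y')) (UNIV \<times> UNIV)"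
  proof (rule has_sum_SigmaI)
    fix i
    have "((\<lambda>j. (cnj (coords x i) * coords x' i) * (cnj (coords y j) * coords y' j))
        has_sum (cnj (coords x i) * coords x' i) * cinner y y') UNIV"
      unfolding cinner_def by (intro has_sum_cmult_right has_sum_infsum cinner_summable)
    then show "((\<lambda>j. cnj (coords ?u (i, j)) * coords ?v (i, j))
        has_sum (cnj (coords x i) * coords x' i) * cinner y y') UNIV"
      by (simp add: mult_ac)
  next
    show "((\<lambda>i. cnj (coords x i) * coords x' i * cinner y y') has_sum cinner x x' * cinner y y') UNIV"
      unfolding cinner_def[of x] by (intro has_sum_cmult_left has_sum_infsum cinner_summable)
    show "(\<lambda>p. cnj (coords ?u p) * coords ?v p) summable_on UNIV \<times> UNIV"
      using cinner_summable[of ?u ?v] by simp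
  qed
  then show ?thesis unfolding cinner_def[of ?u] by (simp add: infsumI)
qed

context
  fixes \<phi> :: "'c::cstar_algebra \<Rightarrow> complex"
  assumes \<phi>: "\<phi> \<in> pos_fun"
begin

lemma pos_fun_plus: "\<phi> (x + y) = \<phi> x + \<phi> y"
  using \<phi> by (induction rule: pos_fun_induct)
    (auto simp: rep_apply_simps cinner_add_right intro!: closed_Collect_eq continuous_intros)

lemma pos_fun_scaleC: "\<phi> (a *\<^sub>C x) = a * \<phi> x"
  using \<phi> by (induction rule: pos_fun_induct)
    (auto simp: rep_apply_simps cinner_scaleC_right intro!: closed_Collect_eq continuous_intros)

lemma pos_fun_star: "\<phi> (star x) = cnj (\<phi> x)"
  using \<phi>
proof (induction rule: pos_fun_induct)
  case (vector \<pi> \<xi>)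
  then show ?case unfolding rep_apply_simps cinner_star_right by (rule cinner_commute)
qed (auto intro!: closed_Collect_eq continuous_intros)

lemma pos_fun_nonneg: "\<phi> (star x * x) = complex_of_real (Re (\<phi> (star x * x)))"
    "0 \<le> Re (\<phi> (star x * x))"
proof -
  have "\<phi> (star x * x) = complex_of_real (Re (\<phi> (star x * x))) \<and> 0 \<le> Re (\<phi> (star x * x))"
    using \<phi>
  proof (induction rule: pos_fun_induct)
    case (vector \<pi> \<xi>)
    then show ?case by (simp add: rep_apply_simps cinner_star_right cinner_self del: of_real_power)
  next
    case closed
    then show ?case
      by (intro closed_Collect_conj closed_Collect_eq closed_Collect_le continuous_intros)
  qed
  then show "\<phi> (star x * x) = complex_of_real (Re (\<phi> (star x * x)))"
    "0 \<le> Re (\<phi> (star x * x))" by auto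
qed

lemma pos_fun_Cauchy_Schwarz:
  "(cmod (\<phi> (star x * y)))\<^sup>2 \<le> Re (\<phi> (star x * x)) * Re (\<phi> (star y * y))"
  using \<phi>
proof (induction rule: pos_fun_induct)
  case (vector \<pi> \<xi>)
  let ?u = "op_apply (rep_apply \<pi> x) \<xi>" and ?v = "op_apply (rep_apply \<pi> y) \<xi>"
  have "(cmod (cinner ?u ?v))\<^sup>2 \<le> (norm ?u * norm ?v)\<^sup>2"
    by (intro power_mono cinner_bound) simp
  then show ?case
    by (simp add: rep_apply_simps cinner_star_right cinner_self power_mult_distrib del: of_real_power)
next
  case closed
  then show ?case by (intro closed_Collect_le continuous_intros)
qed

lemma pos_fun_one: "\<phi> 1 = complex_of_real (Re (\<phi> 1))" "0 \<le> Re (\<phi> 1)"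
  using pos_fun_nonneg[of 1] by simp_all

lemma pos_fun_norm: "cmod (\<phi> x) \<le> Re (\<phi> 1) * norm x"
  using \<phi>
proof (induction rule: pos_fun_induct)
  case (vector \<pi> \<xi>)
  \<comment> \<open>\<pi> may be degenerate. Projecting \<xi> by \<open>rep_apply \<pi> 1\<close>
    changes no value of the functional and makes the squared norm of the vector equal to the value
    at 1.\<close>
  define \<eta> where "\<eta> = op_apply (rep_apply \<pi> 1) \<xi>"
  have eq: "cinner \<xi> (op_apply (rep_apply \<pi> c) \<xi>) = cinner \<eta> (op_apply (rep_apply \<pi> c) \<eta>)" for c
  proof -
    have "rep_apply \<pi> c = star (rep_apply \<pi> 1) * rep_apply \<pi> c * rep_apply \<pi> 1"
      by (simp flip: rep_apply_simps)
    then show ?thesis unfolding \<eta>_def by (metis cinner_star_right op_apply_times)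
  qed
  have "op_apply (rep_apply \<pi> 1) \<eta> = \<eta>"
    unfolding \<eta>_def by (simp flip: op_apply_times rep_apply_simps)
  then have one: "Re (cinner \<xi> (op_apply (rep_apply \<pi> 1) \<xi>)) = (norm \<eta>)\<^sup>2"
    by (simp add: eq cinner_self del: of_real_power)
  have "cmod (cinner \<eta> (op_apply (rep_apply \<pi> x) \<eta>)) \<le> norm \<eta> * norm (op_apply (rep_apply \<pi> x) \<eta>)"
    by (rule cinner_bound)
  also have "\<dots> \<le> norm \<eta> * (norm x * norm \<eta>)"
    by (intro mult_left_mono order_trans[OF norm_op_apply] mult_right_mono
        star_hom_op_contractive star_hom_rep) auto
  finally show ?case unfolding one unfolding eq[of x] by (simp add: power2_eq_square mult_ac)
next
  case closed
  then show ?case by (intro closed_Collect_le continuous_intros)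
qed

lemma pos_fun_scale: "0 \<le> r \<Longrightarrow> (\<lambda>c. complex_of_real r * \<phi> c) \<in> pos_fun"
proof (rule pos_fun_image[OF \<phi>])
  fix \<pi> :: "'c rep" and \<xi> assume r: "0 \<le> r"
  let ?s = "complex_of_real (sqrt r)"
  have rs: "complex_of_real r = cnj ?s * ?s"
    using r by (simp flip: of_real_mult)
  have "(\<lambda>c. complex_of_real r * cinner \<xi> (op_apply (rep_apply \<pi> c) \<xi>)) =
      (\<lambda>c. cinner (?s *\<^sub>C \<xi>) (op_apply (rep_apply \<pi> c) (?s *\<^sub>C \<xi>)))"
    unfolding op_apply_scaleC cinner_scaleC_left cinner_scaleC_right rs by (simp only: mult_ac)
  then show "(\<lambda>c. complex_of_real r * cinner \<xi> (op_apply (rep_apply \<pi> c) \<xi>)) \<in> pos_fun"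
    by (simp only: vector_functional_pos_fun[OF star_hom_rep])
qed (auto intro!: continuous_on_coordinatewise_then_product continuous_intros)

lemma pos_fun_conj: "(\<lambda>c. \<phi> (star d * c * d)) \<in> pos_fun"
proof (rule pos_fun_image[OF \<phi>])
  fix \<pi> :: "'c rep" and \<xi>
  have "(\<lambda>c. cinner \<xi> (op_apply (rep_apply \<pi> (star d * c * d)) \<xi>)) =
      (\<lambda>c. cinner (op_apply (rep_apply \<pi> d) \<xi>) (op_apply (rep_apply \<pi> c) (op_apply (rep_apply \<pi> d) \<xi>)))"
    by (simp add: rep_apply_simps cinner_star_right)
  then show "(\<lambda>c. cinner \<xi> (op_apply (rep_apply \<pi> (star d * c * d)) \<xi>)) \<in> pos_fun"
    by (simp only: vector_functional_pos_fun[OF star_hom_rep])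
qed (auto intro!: continuous_on_coordinatewise_then_product continuous_intros)

lemma pos_fun_pullback:
  assumes "star_hom \<theta>"
  shows "(\<lambda>a. \<phi> (\<theta> a)) \<in> pos_fun"
proof (rule pos_fun_image[OF \<phi>])
  fix \<pi> :: "'c rep" and \<xi>
  show "(\<lambda>c. cinner \<xi> (op_apply (rep_apply \<pi> (\<theta> c)) \<xi>)) \<in> pos_fun"
    by (rule vector_functional_pos_fun[OF star_hom_compose[OF star_hom_rep assms]])
qed (auto intro!: continuous_on_coordinatewise_then_product continuous_intros)

end

text \<open>The two diagonal rank-one projections on a two-dimensional space; tensoring with them
  puts two representations side by side as a direct sum.\<close>

definition bool_proj :: "bool \<Rightarrow> bool ell2_op" where
  "bool_proj b = mk_op (\<lambda>x. coords x b *\<^sub>C ell2_basis b)"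

lemma op_apply_bool_proj: "op_apply (bool_proj b) x = coords x b *\<^sub>C ell2_basis b"
proof -
  have "norm (ell2_basis b) = 1" for b :: bool
    using cinner_self[of "ell2_basis b"] norm_ge_zero[of "ell2_basis b"]
    by (auto simp: power2_eq_1_iff simp flip: of_real_power simp del: norm_ge_zero)
  then have "norm (coords x b *\<^sub>C ell2_basis b) \<le> norm x * 1" for x
    by (simp add: norm_scaleC cmod_coords_le)
  then show ?thesis unfolding bool_proj_def
    by (subst op_apply_mk_op[where b = 1]) (simp_all add: scaleC_add_left scaleC_scaleC)
qed

lemma bool_proj_simps:
  "bool_proj b * bool_proj b = bool_proj b" "b \<noteq> b' \<Longrightarrow> bool_proj b * bool_proj b' = 0"
  "star (bool_proj b) = bool_proj b"
proof -
  show "bool_proj b * bool_proj b = bool_proj b" "b \<noteq> b' \<Longrightarrow> bool_proj b * bool_proj b' = 0"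
    by (rule op_eqI; simp add: op_apply_bool_proj scaleC_scaleC)+
  show "star (bool_proj b) = bool_proj b"
    by (rule op_eq_cinnerI)
      (simp add: cinner_star_right op_apply_bool_proj cinner_scaleC_left cinner_scaleC_right)
qed

lemma op_tensor_zero_right: "op_tensor S 0 = 0"
  using op_tensor_scaleC_right[of S 0 0] by simp

text \<open>The direct sum of the two representations acts on the space indexed by
  \<open>'c \<times> bool\<close>, where the sum is the vector functional of \<zeta>;
  \<open>vector_functional_pos_fun\<close> brings it back to the index type
  \<open>'c\<close>.\<close>

lemma vector_functional_add:
  fixes \<pi> \<sigma> :: "'c::cstar_algebra rep"
  shows "(\<lambda>c. cinner \<xi> (op_apply (rep_apply \<pi> c) \<xi>) + cinner \<eta> (op_apply (rep_apply \<sigma> c) \<eta>)) \<in> pos_fun"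
proof -
  let ?e = "\<lambda>b::bool. ell2_basis b"
  define \<rho> where "\<rho> c = op_tensor (rep_apply \<pi> c) (bool_proj True) + op_tensor (rep_apply \<sigma> c) (bool_proj False)"
    for c
  define \<zeta> where "\<zeta> = ell2_tensor \<xi> (?e True) + ell2_tensor \<eta> (?e False)"
  have "star_hom \<rho>"
    unfolding star_hom_def \<rho>_def
    by (auto simp: rep_apply_simps op_tensor_simps bool_proj_simps distrib_left distrib_right
        op_tensor_zero_right scaleC_add_right star_add)
  moreover have "cinner \<zeta> (op_apply (\<rho> c) \<zeta>) =
      cinner \<xi> (op_apply (rep_apply \<pi> c) \<xi>) + cinner \<eta> (op_apply (rep_apply \<sigma> c) \<eta>)" for c
  proof -
    have z: "ell2_tensor x 0 = 0" for x :: "'c ell2" by (auto intro!: ell2_eqI)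
    show ?thesis
      by (simp add: \<zeta>_def \<rho>_def op_apply_add op_tensor_apply op_apply_bool_proj z
          cinner_add_left cinner_add_right cinner_ell2_tensor)
  qed
  ultimately show ?thesis using vector_functional_pos_fun[of \<rho> \<zeta>] by simp
qed

lemma pos_fun_add:
  fixes \<phi> \<psi> :: "'c::cstar_algebra \<Rightarrow> complex"
  assumes "\<phi> \<in> pos_fun" "\<psi> \<in> pos_fun"
  shows "(\<lambda>c. \<phi> c + \<psi> c) \<in> pos_fun"
proof (rule pos_fun_image[OF assms(1)])
  fix \<pi> :: "'c rep" and \<xi>
  show "(\<lambda>c. cinner \<xi> (op_apply (rep_apply \<pi> c) \<xi>) + \<psi> c) \<in> pos_fun"
    by (rule pos_fun_image[OF assms(2)]) (auto intro!: continuous_intros vector_functional_add)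
qed (auto intro!: continuous_on_coordinatewise_then_product continuous_intros)

lemma statesD: "\<phi> \<in> states \<Longrightarrow> \<phi> \<in> pos_fun" "\<phi> \<in> states \<Longrightarrow> \<phi> 1 = 1"
  by (auto simp: states_def)

lemma states_norm: "\<phi> \<in> states \<Longrightarrow> cmod (\<phi> x) \<le> norm x"
  using pos_fun_norm[of \<phi> x] by (simp add: states_def)

section \<open>Compactness of the state space\<close>

lemma compact_box:
  fixes r :: "'c \<Rightarrow> real"
  shows "compact {\<phi> :: 'c \<Rightarrow> complex. \<forall>c. cmod (\<phi> c) \<le> r c}"
proof -
  have "compactin (product_topology (\<lambda>_. euclidean) UNIV) (PiE UNIV (\<lambda>c. cball (0::complex) (r c)))"
    unfolding compactin_PiE by (auto simp: compactin_euclidean_iff)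
  moreover have "PiE UNIV (\<lambda>c. cball (0::complex) (r c)) = {\<phi>. \<forall>c. cmod (\<phi> c) \<le> r c}"
    by (auto simp: PiE_UNIV_domain)
  ultimately show ?thesis by (simp add: euclidean_product_topology compactin_euclidean_iff)
qed

text \<open>Banach-Alaoglu: \<open>\<phi> 1\<close> bounds the norm of a positive functional, so the
  set is a closed part of a product of discs.\<close>

lemma compact_pos_fun_bounded: "compact {\<phi> \<in> pos_fun. Re (\<phi> (1::'c::cstar_algebra)) \<le> r}"
proof -
  have "closed {\<phi> :: 'c \<Rightarrow> complex. Re (\<phi> 1) \<le> r}"
    by (intro closed_Collect_le continuous_intros)
  then have "compact ({\<phi> :: 'c \<Rightarrow> complex. \<forall>c. cmod (\<phi> c) \<le> r * norm c} \<inter> (pos_fun \<inter> {\<phi>. Re (\<phi> 1) \<le> r}))"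
    by (intro compact_Int_closed compact_box closed_Int closed_pos_fun)
  moreover have "{\<phi> :: 'c \<Rightarrow> complex. \<forall>c. cmod (\<phi> c) \<le> r * norm c} \<inter> (pos_fun \<inter> {\<phi>. Re (\<phi> 1) \<le> r})
      = {\<phi> \<in> pos_fun. Re (\<phi> 1) \<le> r}"
  proof -
    have "cmod (\<phi> c) \<le> r * norm c" if "\<phi> \<in> pos_fun" "Re (\<phi> 1) \<le> r" for \<phi> and c :: 'c
      using pos_fun_norm[OF that(1), of c] mult_right_mono[OF that(2), of "norm c"] by simp
    then show ?thesis by blast
  qed
  ultimately show ?thesis by simp
qed

lemma compact_states: "compact states"
proof -
  have "closed {\<phi> :: 'a::cstar_algebra \<Rightarrow> complex. \<phi> 1 = 1}"
    by (intro closed_Collect_eq continuous_intros)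
  then have "compact ({\<phi> \<in> pos_fun. Re (\<phi> (1::'a)) \<le> 1} \<inter> {\<phi>. \<phi> 1 = 1})"
    by (intro compact_Int_closed compact_pos_fun_bounded)
  moreover have "{\<phi> \<in> pos_fun. Re (\<phi> (1::'a)) \<le> 1} \<inter> {\<phi>. \<phi> 1 = 1} = states"
    by (auto simp: states_def)
  ultimately show ?thesis by simp
qed

text \<open>The function type is not an instance of \<^class>\<open>t2_space\<close>.\<close>

lemma compact_imp_closed_fun:
  fixes K :: "('a \<Rightarrow> 'b::t2_space) set"
  assumes "compact K"
  shows "closed K"
proof -
  have "Hausdorff_space (euclidean :: 'b topology)"
    unfolding Hausdorff_space_def disjnt_def using hausdorff by (metis open_openin)
  then have "Hausdorff_space (product_topology (\<lambda>_::'a. euclidean :: 'b topology) UNIV)"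
    by (simp add: Hausdorff_space_product_topology)
  then have "Hausdorff_space (euclidean :: ('a \<Rightarrow> 'b) topology)"
    by (simp only: euclidean_product_topology)
  then have "closedin euclidean K"
    using assms by (intro compactin_imp_closedin) (simp_all add: compactin_euclidean_iff)
  then show ?thesis by simp
qed

subsection \<open>The dual space and tensor products of functionals\<close>

text \<open>The span of the positive functionals plays the role of the dual space. Generating it
  inductively lets bilinear constructions be checked on positive functionals and then
  extended.\<close>

inductive_set dual :: "('c::cstar_algebra \<Rightarrow> complex) set" where
  pos: "\<phi> \<in> pos_fun \<Longrightarrow> \<phi> \<in> dual"
| add: "\<phi> \<in> dual \<Longrightarrow> \<psi> \<in> dual \<Longrightarrow> (\<lambda>c. \<phi> c + \<psi> c) \<in> dual"
| scale: "\<phi> \<in> dual \<Longrightarrow> (\<lambda>c. a * \<phi> c) \<in> dual"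

lemma dual_plus: "\<phi> \<in> dual \<Longrightarrow> \<phi> (x + y) = \<phi> x + \<phi> y"
  by (induction rule: dual.induct) (auto simp: pos_fun_plus algebra_simps)

lemma dual_scaleC: "\<phi> \<in> dual \<Longrightarrow> \<phi> (a *\<^sub>C x) = a * \<phi> x"
  by (induction rule: dual.induct) (auto simp: pos_fun_scaleC algebra_simps)

lemma dual_bounded_linear: "\<phi> \<in> dual \<Longrightarrow> bounded_linear \<phi>"
proof (induction rule: dual.induct)
  case (pos \<phi>)
  show ?case
  proof (rule bounded_linear_intro[where K = "Re (\<phi> 1)"])
    show "norm (\<phi> x) \<le> norm x * Re (\<phi> 1)" for x
      using pos_fun_norm[OF pos, of x] by (simp add: mult.commute)
  qed (simp_all add: pos_fun_plus[OF pos] pos_fun_scaleC[OF pos] scaleR_scaleC scaleC_complex_def)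
qed (auto intro: bounded_linear_add bounded_linear_const_mult)

lemma dual_diff: "\<phi> \<in> dual \<Longrightarrow> \<phi> (x - y) = \<phi> x - \<phi> y"
  by (rule linear_diff[OF bounded_linear.linear[OF dual_bounded_linear]])

lemma dual_zero_arg: "\<phi> \<in> dual \<Longrightarrow> \<phi> 0 = 0"
  by (rule linear_0[OF bounded_linear.linear[OF dual_bounded_linear]])

lemma dual_sum_arg: "\<phi> \<in> dual \<Longrightarrow> \<phi> (\<Sum>i\<in>I. x i) = (\<Sum>i\<in>I. \<phi> (x i))"
  by (rule linear_sum[OF bounded_linear.linear[OF dual_bounded_linear]])

lemma pos_fun_diff: "\<phi> \<in> pos_fun \<Longrightarrow> \<phi> (x - y) = \<phi> x - \<phi> y"
  by (rule dual_diff[OF dual.pos])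

lemma pos_fun_sum_arg: "\<phi> \<in> pos_fun \<Longrightarrow> \<phi> (\<Sum>i\<in>I. x i) = (\<Sum>i\<in>I. \<phi> (x i))"
  by (rule dual_sum_arg[OF dual.pos])

lemma zero_pos_fun: "(\<lambda>_ :: 'a::cstar_algebra. 0) \<in> pos_fun"
proof -
  have "(\<lambda>c. cinner 0 (op_apply (rep_apply undefined c) (0 :: 'a ell2))) \<in> pos_fun"
    by (rule vector_functional_pos_fun[OF star_hom_rep])
  moreover have "cinner 0 (0 :: 'a ell2) = 0" by (simp add: cinner_self)
  ultimately show ?thesis by simp
qed

lemma dual_sum: "(\<And>i. i \<in> I \<Longrightarrow> \<phi> i \<in> dual) \<Longrightarrow> (\<lambda>c. \<Sum>i\<in>I. \<phi> i c) \<in> dual"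
proof (induction I rule: infinite_finite_induct)
  case (insert i I)
  then show ?case by (simp add: dual.add)
qed (simp_all add: dual.pos zero_pos_fun)

lemma dual_pullback: "\<phi> \<in> dual \<Longrightarrow> star_hom \<theta> \<Longrightarrow> (\<lambda>a. \<phi> (\<theta> a)) \<in> dual"
  by (induction rule: dual.induct) (auto intro: dual.intros pos_fun_pullback)

lemma dual_lincomb4:
  assumes "\<phi>1 \<in> dual" "\<phi>2 \<in> dual" "\<phi>3 \<in> dual" "\<phi>4 \<in> dual"
    and "\<And>c. \<phi> c = a1 * \<phi>1 c + a2 * \<phi>2 c + a3 * \<phi>3 c + a4 * \<phi>4 c"
  shows "\<phi> \<in> dual"
proof -
  have "(\<lambda>c. a1 * \<phi>1 c + a2 * \<phi>2 c + a3 * \<phi>3 c + a4 * \<phi>4 c) \<in> dual"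
    by (intro dual.add dual.scale assms)
  moreover have "\<phi> = (\<lambda>c. a1 * \<phi>1 c + a2 * \<phi>2 c + a3 * \<phi>3 c + a4 * \<phi>4 c)"
    using assms(5) by auto
  ultimately show ?thesis by simp
qed

text \<open>Polarisation: with \<open>d z = b + z *\<^sub>C star a\<close>, averaging
  \<open>z * \<phi> (star (d z) * c * d z)\<close> over the four powers z of \<i> keeps only the
  coefficient of \<open>cnj z\<close>, which is \<open>\<phi> (a * c * b)\<close>. The weights are
  z/4.\<close>

lemma dual_mult: "\<phi> \<in> dual \<Longrightarrow> (\<lambda>c. \<phi> (a * c * b)) \<in> dual"
proof (induction rule: dual.induct)
  case (pos \<phi>)
  define d where "d z = b + z *\<^sub>C star a" for z
  have q: "\<phi> (star (d z) * c * d z) =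
      \<phi> (star b * c * b) + z * \<phi> (star b * c * star a) + cnj z * \<phi> (a * c * b)
        + cnj z * z * \<phi> (a * c * star a)" for z c
    by (simp add: d_def star_add star_scaleC distrib_left distrib_right scaleC_mult_left
        scaleC_mult_right scaleC_scaleC pos_fun_plus[OF pos] pos_fun_scaleC[OF pos] algebra_simps)
  show ?case
    by (rule dual_lincomb4[where ?a1.0 = "1/4" and ?a2.0 = "\<i>/4" and ?a3.0 = "-1/4" and ?a4.0 = "-\<i>/4",
          OF dual.pos[OF pos_fun_conj[OF pos, of "d 1"]] dual.pos[OF pos_fun_conj[OF pos, of "d \<i>"]]
          dual.pos[OF pos_fun_conj[OF pos, of "d (- 1)"]] dual.pos[OF pos_fun_conj[OF pos, of "d (- \<i>)"]]])
      (simp only: q, simp add: algebra_simps)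
qed (auto intro: dual.intros)

lemma dual_mult_left: "\<phi> \<in> dual \<Longrightarrow> (\<lambda>c. \<phi> (a * c)) \<in> dual"
  using dual_mult[of \<phi> a 1] by simp

lemma dual_mult_right: "\<phi> \<in> dual \<Longrightarrow> (\<lambda>c. \<phi> (c * b)) \<in> dual"
  using dual_mult[of \<phi> 1 b] by simp

text \<open>The polarisation of \<open>dual_mult\<close> again, now in the vector
  \<open>z *\<^sub>C \<xi> + \<eta>\<close>.\<close>

lemma coefficient_dual:
  fixes \<pi> :: "'c::cstar_algebra rep"
  shows "(\<lambda>c. cinner \<xi> (op_apply (rep_apply \<pi> c) \<eta>)) \<in> dual"
proof -
  define v where "v z = z *\<^sub>C \<xi> + \<eta>" for z
  have q: "cinner (v z) (op_apply (rep_apply \<pi> c) (v z)) =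
      cnj z * z * cinner \<xi> (op_apply (rep_apply \<pi> c) \<xi>) + cnj z * cinner \<xi> (op_apply (rep_apply \<pi> c) \<eta>)
      + z * cinner \<eta> (op_apply (rep_apply \<pi> c) \<xi>) + cinner \<eta> (op_apply (rep_apply \<pi> c) \<eta>)" for z c
    by (simp add: v_def op_apply_add op_apply_scaleC cinner_add_left cinner_add_right
        cinner_scaleC_left cinner_scaleC_right algebra_simps)
  have p: "(\<lambda>c. cinner (v z) (op_apply (rep_apply \<pi> c) (v z))) \<in> dual" for z
    by (intro dual.pos vector_functional_pos_fun star_hom_rep)
  show ?thesis
    by (rule dual_lincomb4[where ?a1.0 = "1/4" and ?a2.0 = "\<i>/4" and ?a3.0 = "-1/4" and ?a4.0 = "-\<i>/4",
          OF p[of 1] p[of \<i>] p[of "- 1"] p[of "- \<i>"]])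
      (simp only: q, simp add: algebra_simps)
qed

text \<open>The representation \<open>\<pi> \<otimes> \<sigma>\<close> of the minimal tensor
  product. Elements are realised as families over pairs of representations, so this is evaluation at
  one index.\<close>

definition pair_rep :: "'c::cstar_algebra rep \<Rightarrow> 'd::cstar_algebra rep \<Rightarrow> 'c \<otimes> 'd \<Rightarrow> ('c \<times> 'd) ell2_op" where
  "pair_rep \<pi> \<sigma> t = apply_bcontfun (rep_min_tensor t) (\<pi>, \<sigma>)"

lemma star_hom_pair_rep: "star_hom (pair_rep \<pi> \<sigma>)"
  by (simp add: star_hom_def pair_rep_def rep_min_tensor_vector rep_min_tensor_cstar
      apply_cstar_bcontfun)

lemma pair_rep_tens: "pair_rep \<pi> \<sigma> (c \<otimes> d) = op_tensor (rep_apply \<pi> c) (rep_apply \<sigma> d)"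
  by (simp add: pair_rep_def rep_tens apply_spatial)

text \<open>The set of admissible \<open>\<phi>\<close> is closed because it is a continuous image of a compact set of
  functionals on \<open>'e\<close>.\<close>

lemma product_functional_limit:
  fixes T :: "'x \<Rightarrow> 'e::cstar_algebra" and u :: "'x \<Rightarrow> 'c::cstar_algebra" and k :: "'x \<Rightarrow> complex"
  assumes \<phi>: "\<phi> \<in> pos_fun"
    and s: "\<And>c. u (s c) = c" "\<And>c. k (s c) = k0" "k0 \<noteq> 0" "T (s 1) = 1"
    and ex: "\<And>\<phi>. \<phi> \<in> vector_functionals \<Longrightarrow> \<exists>L\<in>pos_fun. \<forall>x. L (T x) = \<phi> (u x) * k x"
  shows "\<exists>L\<in>pos_fun. \<forall>x. L (T x) = \<phi> (u x) * k x"
proof -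
  \<comment> \<open>Vector functionals close to \<phi> may be taken with value at 1 below
    \<open>Re (\<phi> 1) + 1\<close>; r then bounds the mass of their product functionals and keeps
    K compact.\<close>
  define r where "r = (Re (\<phi> 1) + 1) * cmod k0"
  \<comment> \<open>The second condition says that L is the product of k with its own slice, whose
    value at c is \<open>L (T (s c)) / k0\<close>. It only compares values of L, so it is
    closed.\<close>
  define K where "K = {L \<in> pos_fun. Re (L 1) \<le> r} \<inter> {L. \<forall>x. L (T x) = L (T (s (u x))) / k0 * k x}"
  define Z where "Z = (\<lambda>L c. L (T (s c)) / k0) ` K"
  have "closed {L :: 'e \<Rightarrow> complex. \<forall>x. L (T x) = L (T (s (u x))) / k0 * k x}"
    by (intro closed_Collect_all closed_Collect_eq continuous_intros) (use s(3) in auto)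
  then have "compact K"
    unfolding K_def by (intro compact_Int_closed compact_pos_fun_bounded)
  moreover have "continuous_on UNIV (\<lambda>(L :: 'e \<Rightarrow> complex) c. L (T (s c)) / k0)"
    by (intro continuous_on_coordinatewise_then_product continuous_intros) (use s(3) in auto)
  ultimately have "closed Z"
    unfolding Z_def by (intro compact_imp_closed_fun compact_continuous_image)
      (auto intro: continuous_on_subset)
  have V: "{\<phi>'. Re (\<phi>' 1) < Re (\<phi> 1) + 1} \<inter> vector_functionals \<subseteq> Z"
  proof clarify
    fix \<phi>' :: "'c \<Rightarrow> complex"
    assume \<phi>': "\<phi>' \<in> vector_functionals" "Re (\<phi>' 1) < Re (\<phi> 1) + 1"
    then have p: "\<phi>' \<in> pos_fun" using closure_subset by (auto simp: pos_fun_def)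
    obtain L where L: "L \<in> pos_fun" "\<And>x. L (T x) = \<phi>' (u x) * k x"
      using ex[OF \<phi>'(1)] by blast
    have "L 1 = \<phi>' 1 * k0" using L(2)[of "s 1"] s by simp
    then have "Re (L 1) \<le> cmod (\<phi>' 1) * cmod k0" by (metis complex_Re_le_cmod norm_mult)
    also have "cmod (\<phi>' 1) = Re (\<phi>' 1)"
      using pos_fun_one[OF p] by (metis abs_of_nonneg norm_of_real)
    also have "Re (\<phi>' 1) * cmod k0 \<le> r" unfolding r_def using \<phi>'(2) by (intro mult_right_mono) auto
    finally have "L \<in> K" using L s(3) by (simp add: K_def s)
    moreover have "\<phi>' = (\<lambda>c. L (T (s c)) / k0)" using L s by auto
    ultimately show "\<phi>' \<in> Z" by (auto simp: Z_def)
  qed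
  have "open {\<phi>' :: 'c \<Rightarrow> complex. Re (\<phi>' 1) < Re (\<phi> 1) + 1}"
    by (intro open_Collect_less continuous_intros)
  then have "\<phi> \<in> closure ({\<phi>'. Re (\<phi>' 1) < Re (\<phi> 1) + 1} \<inter> vector_functionals)"
    using open_Int_closure_subset[of _ vector_functionals] \<phi> by (fastforce simp: pos_fun_def)
  then have "\<phi> \<in> Z" using closure_minimal[OF V \<open>closed Z\<close>] by auto
  then obtain L where "L \<in> K" and \<phi>_eq: "\<phi> = (\<lambda>c. L (T (s c)) / k0)" by (auto simp: Z_def)
  then have "L \<in> pos_fun" and L: "\<forall>x. L (T x) = L (T (s (u x))) / k0 * k x"
    unfolding K_def by blast+
  moreover have "L (T x) = \<phi> (u x) * k x" for x
    unfolding \<phi>_eq by (rule spec[OF L])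
  ultimately show ?thesis by blast
qed

lemma pos_fun_eq_0: "\<phi> \<in> pos_fun \<Longrightarrow> \<phi> 1 = 0 \<Longrightarrow> \<phi> x = 0"
  using pos_fun_norm[of \<phi> x] by simp

lemma product_vector_functionals:
  assumes "\<phi> \<in> vector_functionals" "\<psi> \<in> vector_functionals"
  shows "\<exists>L\<in>pos_fun. \<forall>x. L (case x of (c, d) \<Rightarrow> c \<otimes> d) = \<phi> (fst x) * \<psi> (snd x)"
proof -
  obtain \<pi> \<xi> \<sigma> \<eta> where eq: "\<phi> = (\<lambda>c. cinner \<xi> (op_apply (rep_apply \<pi> c) \<xi>))"
      "\<psi> = (\<lambda>c. cinner \<eta> (op_apply (rep_apply \<sigma> c) \<eta>))"
    using assms by (auto simp: vector_functionals_def)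
  let ?\<zeta> = "ell2_tensor \<xi> \<eta>"
  show ?thesis
    by (rule bexI[OF _ vector_functional_pos_fun[OF star_hom_pair_rep[of \<pi> \<sigma>], of ?\<zeta>]])
      (auto simp: eq pair_rep_tens op_tensor_apply cinner_ell2_tensor)
qed

text \<open>Vector functionals multiply through tensor vectors. Limits are then taken in one leg at
  a time: in \<phi> against a fixed vector functional, then in \<psi> against a fixed \<phi>. The
  leg held fixed must not vanish at 1; if it does, it is zero and so is the product.\<close>

lemma product_pos_fun:
  assumes \<phi>: "\<phi> \<in> pos_fun" and \<psi>: "\<psi> \<in> pos_fun"
  shows "\<exists>L\<in>pos_fun. \<forall>c d. L (c \<otimes> d) = \<phi> c * \<psi> d"
proof -
  let ?T = "\<lambda>x. case x of (c, d) \<Rightarrow> c \<otimes> d"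
  have vec: "\<exists>L\<in>pos_fun. \<forall>x. L (?T x) = \<phi> (fst x) * \<psi> (snd x)"
    if \<psi>: "\<psi> \<in> vector_functionals" for \<psi>
  proof (cases "\<psi> 1 = 0")
    case True
    have "\<psi> \<in> pos_fun" using \<psi> closure_subset by (auto simp: pos_fun_def)
    with True have "\<psi> d = 0" for d by (auto intro: pos_fun_eq_0)
    then show ?thesis by (intro bexI[OF _ zero_pos_fun]) simp
  next
    case False
    show ?thesis
    proof (rule product_functional_limit[OF \<phi>, where s = "\<lambda>c. (c, 1)" and ?k0.0 = "\<psi> 1"])
      show "\<exists>L\<in>pos_fun. \<forall>x. L (?T x) = \<phi>' (fst x) * \<psi> (snd x)" if "\<phi>' \<in> vector_functionals" for \<phi>'
        by (rule product_vector_functionals[OF that \<psi>])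
    qed (use False in \<open>auto simp: tens_simps\<close>)
  qed
  have "\<exists>L\<in>pos_fun. \<forall>x. L (?T x) = \<psi> (snd x) * \<phi> (fst x)"
  proof (cases "\<phi> 1 = 0")
    case True
    then have "\<phi> c = 0" for c using \<phi> by (auto intro: pos_fun_eq_0)
    then show ?thesis by (intro bexI[OF _ zero_pos_fun]) simp
  next
    case False
    show ?thesis
    proof (rule product_functional_limit[OF \<psi>, where s = "\<lambda>d. (1, d)" and ?k0.0 = "\<phi> 1"])
      show "\<exists>L\<in>pos_fun. \<forall>x. L (?T x) = \<psi>' (snd x) * \<phi> (fst x)" if "\<psi>' \<in> vector_functionals" for \<psi>'
        using vec[OF that] by (simp only: mult.commute)
    qed (use False in \<open>auto simp: tens_simps\<close>)
  qed
  then show ?thesis by (metis case_prod_conv fst_conv snd_conv mult.commute)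
qed

text \<open>A bounded linear functional is determined by its values on elementary tensors, so a
  definite description suffices; it denotes the product whenever both factors lie in
  \<open>dual\<close>.\<close>

definition ten :: "('c::cstar_algebra \<Rightarrow> complex) \<Rightarrow> ('d::cstar_algebra \<Rightarrow> complex) \<Rightarrow> 'c \<otimes> 'd \<Rightarrow> complex" where
  "ten \<phi> \<psi> = (THE L. bounded_linear L \<and> (\<forall>c d. L (c \<otimes> d) = \<phi> c * \<psi> d))"

lemma product_dual:
  assumes "\<phi> \<in> dual" "\<psi> \<in> dual"
  shows "\<exists>L\<in>dual. \<forall>c d. L (c \<otimes> d) = \<phi> c * \<psi> d"
  using assms(1)
proof (induction rule: dual.induct)
  case (pos \<phi>)
  show ?case using assms(2)
  proof (induction rule: dual.induct)
    case (pos \<psi>)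
    then show ?case using product_pos_fun[OF \<open>\<phi> \<in> pos_fun\<close> pos] dual.pos by blast
  next
    case (add \<psi> \<psi>')
    then obtain L L' where "L \<in> dual" "L' \<in> dual" "\<forall>c d. L (c \<otimes> d) = \<phi> c * \<psi> d"
      "\<forall>c d. L' (c \<otimes> d) = \<phi> c * \<psi>' d" by blast
    then show ?case by (intro bexI[OF _ dual.add[of L L']]) (auto simp: distrib_left)
  next
    case (scale \<psi> a)
    then obtain L where "L \<in> dual" "\<forall>c d. L (c \<otimes> d) = \<phi> c * \<psi> d" by blast
    then show ?case by (intro bexI[OF _ dual.scale[of L a]]) auto
  qed
next
  case (add \<phi> \<phi>')
  then obtain L L' where "L \<in> dual" "L' \<in> dual" "\<forall>c d. L (c \<otimes> d) = \<phi> c * \<psi> d"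
    "\<forall>c d. L' (c \<otimes> d) = \<phi>' c * \<psi> d" by blast
  then show ?case by (intro bexI[OF _ dual.add[of L L']]) (auto simp: distrib_right)
next
  case (scale \<phi> a)
  then obtain L where "L \<in> dual" "\<forall>c d. L (c \<otimes> d) = \<phi> c * \<psi> d" by blast
  then show ?case by (intro bexI[OF _ dual.scale[of L a]]) auto
qed

lemma ten_eqI:
  assumes "bounded_linear L" "\<And>c d. L (c \<otimes> d) = \<phi> c * \<psi> d"
  shows "ten \<phi> \<psi> = L"
  unfolding ten_def
proof (rule the_equality)
  fix L' assume L': "bounded_linear L' \<and> (\<forall>c d. L' (c \<otimes> d) = \<phi> c * \<psi> d)"
  show "L' = L" by (rule tensor_extension_unique) (use L' assms in auto)
qed (use assms in auto)

lemma ten_dual: "\<phi> \<in> dual \<Longrightarrow> \<psi> \<in> dual \<Longrightarrow> ten \<phi> \<psi> \<in> dual"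
  and ten_tens [simp]: "\<phi> \<in> dual \<Longrightarrow> \<psi> \<in> dual \<Longrightarrow> ten \<phi> \<psi> (c \<otimes> d) = \<phi> c * \<psi> d"
  using product_dual[of \<phi> \<psi>] ten_eqI[OF dual_bounded_linear] by metis+

lemma ten_pos_fun: "\<phi> \<in> pos_fun \<Longrightarrow> \<psi> \<in> pos_fun \<Longrightarrow> ten \<phi> \<psi> \<in> pos_fun"
  using product_pos_fun[of \<phi> \<psi>] ten_eqI[OF dual_bounded_linear[OF dual.pos]] by metis

lemma ten_states: "\<phi> \<in> states \<Longrightarrow> \<psi> \<in> states \<Longrightarrow> ten \<phi> \<psi> \<in> states"
  using ten_pos_fun[of \<phi> \<psi>] ten_tens[of \<phi> \<psi> 1 1]
  by (simp add: states_def dual.pos tens_simps)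

lemma bounded_linear_ten: "\<phi> \<in> dual \<Longrightarrow> \<psi> \<in> dual \<Longrightarrow> bounded_linear (ten \<phi> \<psi>)"
  by (rule dual_bounded_linear[OF ten_dual])

lemma ten_add_left: "\<phi> \<in> dual \<Longrightarrow> \<phi>' \<in> dual \<Longrightarrow> \<psi> \<in> dual \<Longrightarrow>
    ten (\<lambda>c. \<phi> c + \<phi>' c) \<psi> = (\<lambda>t. ten \<phi> \<psi> t + ten \<phi>' \<psi> t)"
  by (rule ten_eqI) (auto intro!: bounded_linear_add bounded_linear_ten simp: distrib_right)

lemma ten_add_right: "\<phi> \<in> dual \<Longrightarrow> \<psi> \<in> dual \<Longrightarrow> \<psi>' \<in> dual \<Longrightarrow>
    ten \<phi> (\<lambda>c. \<psi> c + \<psi>' c) = (\<lambda>t. ten \<phi> \<psi> t + ten \<phi> \<psi>' t)"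
  by (rule ten_eqI) (auto intro!: bounded_linear_add bounded_linear_ten simp: distrib_left)

lemma ten_scale_left: "\<phi> \<in> dual \<Longrightarrow> \<psi> \<in> dual \<Longrightarrow> ten (\<lambda>c. a * \<phi> c) \<psi> = (\<lambda>t. a * ten \<phi> \<psi> t)"
  by (rule ten_eqI) (auto intro!: bounded_linear_const_mult bounded_linear_ten)

lemma ten_scale_right: "\<phi> \<in> dual \<Longrightarrow> \<psi> \<in> dual \<Longrightarrow> ten \<phi> (\<lambda>c. a * \<psi> c) = (\<lambda>t. a * ten \<phi> \<psi> t)"
  by (rule ten_eqI) (auto intro!: bounded_linear_const_mult bounded_linear_ten)

lemma ten_sum_left: "(\<And>i. i \<in> I \<Longrightarrow> \<phi> i \<in> dual) \<Longrightarrow> \<psi> \<in> dual \<Longrightarrow>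
    ten (\<lambda>c. \<Sum>i\<in>I. \<phi> i c) \<psi> = (\<lambda>t. \<Sum>i\<in>I. ten (\<phi> i) \<psi> t)"
  by (rule ten_eqI) (auto intro!: bounded_linear_sum bounded_linear_ten simp: sum_distrib_right)

lemma ten_sum_right: "\<phi> \<in> dual \<Longrightarrow> (\<And>i. i \<in> I \<Longrightarrow> \<psi> i \<in> dual) \<Longrightarrow>
    ten \<phi> (\<lambda>c. \<Sum>i\<in>I. \<psi> i c) = (\<lambda>t. \<Sum>i\<in>I. ten \<phi> (\<psi> i) t)"
  by (rule ten_eqI) (auto intro!: bounded_linear_sum bounded_linear_ten simp: sum_distrib_left)

lemma ten_mult_right:
  assumes "\<phi> \<in> dual" "\<psi> \<in> dual"
  shows "ten \<phi> \<psi> (t * (c \<otimes> d)) = ten (\<lambda>x. \<phi> (x * c)) (\<lambda>y. \<psi> (y * d)) t"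
proof -
  have "ten (\<lambda>x. \<phi> (x * c)) (\<lambda>y. \<psi> (y * d)) = (\<lambda>t. ten \<phi> \<psi> (t * (c \<otimes> d)))"
    by (rule ten_eqI) (auto intro!: dual_bounded_linear dual_mult_right ten_dual assms simp: tens_simps assms)
  then show ?thesis by simp
qed

lemma ten_mult_left:
  assumes "\<phi> \<in> dual" "\<psi> \<in> dual"
  shows "ten \<phi> \<psi> ((c \<otimes> d) * t) = ten (\<lambda>x. \<phi> (c * x)) (\<lambda>y. \<psi> (d * y)) t"
proof -
  have "ten (\<lambda>x. \<phi> (c * x)) (\<lambda>y. \<psi> (d * y)) = (\<lambda>t. ten \<phi> \<psi> ((c \<otimes> d) * t))"
    by (rule ten_eqI) (auto intro!: dual_bounded_linear dual_mult_left ten_dual assms simp: tens_simps assms)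
  then show ?thesis by simp
qed

text \<open>An element of the minimal tensor product is determined by its images under all
  \<open>\<pi> \<otimes> \<sigma>\<close>, and each matrix entry of such an image is a product of
  two coefficient functionals, which are combinations of positive ones.\<close>

lemma tensor_separation:
  fixes t :: "'c::cstar_algebra \<otimes> 'd::cstar_algebra"
  assumes zero: "\<And>\<phi> \<psi>. \<phi> \<in> pos_fun \<Longrightarrow> \<psi> \<in> pos_fun \<Longrightarrow> ten \<phi> \<psi> t = 0"
  shows "t = 0"
proof -
  have dual: "ten \<phi> \<psi> t = 0" if "\<phi> \<in> dual" "\<psi> \<in> dual" for \<phi> \<psi>
    using that(1)
  proof (induction rule: dual.induct)
    case (pos \<phi>)
    show ?case using that(2)
      by (induction rule: dual.induct) (simp_all add: pos zero ten_add_right ten_scale_right dual.pos)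
  qed (simp_all add: that ten_add_left ten_scale_left)
  have "pair_rep \<pi> \<sigma> t = 0" for \<pi> \<sigma>
  proof (rule op_eq_basisI, rule ell2_eqI)
    fix p q :: "'c \<times> 'd"
    obtain i j k l where pq: "p = (i, j)" "q = (k, l)" by (meson surj_pair)
    define \<phi> where "\<phi> c = cinner (ell2_basis k) (op_apply (rep_apply \<pi> c) (ell2_basis i))" for c
    define \<psi> where "\<psi> d = cinner (ell2_basis l) (op_apply (rep_apply \<sigma> d) (ell2_basis j))" for d
    have "\<phi> \<in> dual" "\<psi> \<in> dual" unfolding \<phi>_def \<psi>_def by (rule coefficient_dual)+
    moreover have "ten \<phi> \<psi> = (\<lambda>t. cinner (ell2_basis q) (op_apply (pair_rep \<pi> \<sigma> t) (ell2_basis p)))"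
    proof (rule ten_eqI)
      have rep: "bounded_linear (pair_rep \<pi> \<sigma>)"
      proof (rule bounded_linear_intro[where K = 1])
        fix x y :: "'c \<otimes> 'd" and r :: real
        show "pair_rep \<pi> \<sigma> (x + y) = pair_rep \<pi> \<sigma> x + pair_rep \<pi> \<sigma> y"
          "pair_rep \<pi> \<sigma> (r *\<^sub>R x) = r *\<^sub>R pair_rep \<pi> \<sigma> x"
          by (simp_all add: pair_rep_def rep_min_tensor_vector)
        show "norm (pair_rep \<pi> \<sigma> x) \<le> norm x * 1"
          by (simp add: pair_rep_def norm_min_tensor_def norm_bounded)
      qed
      have app: "bounded_linear (\<lambda>T. op_apply T x)" for x :: "('c \<times> 'd) ell2"
        by (rule bounded_linear_intro[where K = "norm x"]) (simp_all add: norm_op_apply)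
      show "bounded_linear (\<lambda>t. cinner (ell2_basis q) (op_apply (pair_rep \<pi> \<sigma> t) (ell2_basis p)))"
        by (rule bounded_linear_compose[OF bounded_linear_cinner_right bounded_linear_compose[OF app rep]])
    next
      fix c d
      show "cinner (ell2_basis q) (op_apply (pair_rep \<pi> \<sigma> (c \<otimes> d)) (ell2_basis p)) = \<phi> c * \<psi> d"
        by (simp add: pq pair_rep_tens op_tensor_basis \<phi>_def \<psi>_def)
    qed
    ultimately show "coords (op_apply (pair_rep \<pi> \<sigma> t) (ell2_basis p)) q = coords (op_apply 0 (ell2_basis p)) q"
      using dual[of \<phi> \<psi>] by simp
  qed
  then have "rep_min_tensor t = 0" by (intro bcontfun_eqI) (auto simp: pair_rep_def)
  then show ?thesis using rep_min_tensor_inject[of t 0] by (simp add: rep_min_tensor_vector)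
qed

lemma bounded_linear_tens_left: "bounded_linear (\<lambda>s. s \<otimes> e)"
  by (rule bounded_linear_intro[where K = "norm e"])
    (simp_all add: tens_simps scaleR_scaleC norm_tens_le)

lemma bounded_linear_tens_right: "bounded_linear (\<lambda>e. s \<otimes> e)"
  by (rule bounded_linear_intro[where K = "norm s"])
    (simp_all add: tens_simps scaleR_scaleC norm_tens_le mult.commute[of "norm _" "norm s"])

lemma ten_map:
  assumes h: "is_tensor_map f g h" and "\<phi> \<in> dual" "\<psi> \<in> dual"
  shows "ten \<phi> \<psi> (h t) = ten (\<lambda>a. \<phi> (f a)) (\<lambda>b. \<psi> (g b)) t"
proof -
  have "bounded_linear h" using h by (simp add: is_tensor_map_def)
  then have "ten (\<lambda>a. \<phi> (f a)) (\<lambda>b. \<psi> (g b)) = (\<lambda>t. ten \<phi> \<psi> (h t))"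
    using assms by (intro ten_eqI bounded_linear_compose[OF bounded_linear_ten])
      (auto simp: is_tensor_map_def)
  then show ?thesis by simp
qed

lemma tensor3_extension_unique:
  fixes h k :: "('a::cstar_algebra \<otimes> 'b::cstar_algebra) \<otimes> 'c::cstar_algebra \<Rightarrow> 'd::real_normed_vector"
  assumes h: "bounded_linear h" and k: "bounded_linear k"
    and eq: "\<And>a b c. h ((a \<otimes> b) \<otimes> c) = k ((a \<otimes> b) \<otimes> c)"
  shows "h = k"
proof (rule tensor_extension_unique[OF h k])
  fix s c
  have "(\<lambda>s. h (s \<otimes> c)) = (\<lambda>s. k (s \<otimes> c))"
    by (rule tensor_extension_unique)
      (auto intro!: bounded_linear_compose[OF h] bounded_linear_compose[OF k] bounded_linear_tens_left eq)
  then show "h (s \<otimes> c) = k (s \<otimes> c)" by (rule fun_cong)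
qed

lemma ten_assoc:
  assumes h: "is_tensor_assoc h" and "\<phi> \<in> dual" "\<psi> \<in> dual" "\<tau> \<in> dual"
  shows "ten \<phi> (ten \<psi> \<tau>) (h t) = ten (ten \<phi> \<psi>) \<tau> t"
proof -
  have "bounded_linear h" using h by (simp add: is_tensor_assoc_def)
  then have "(\<lambda>t. ten \<phi> (ten \<psi> \<tau>) (h t)) = ten (ten \<phi> \<psi>) \<tau>"
    using assms by (intro tensor3_extension_unique bounded_linear_ten
        bounded_linear_compose[OF bounded_linear_ten] ten_dual) (auto simp: is_tensor_assoc_def ten_dual)
  then show ?thesis by (rule fun_cong)
qed

text \<open>Pairing the coaction identity with product functionals makes it an identity of
  convolutions, from which the tensor maps and the associator have disappeared.\<close>

lemma coaction_convolution:
  assumes "coaction_identity \<Delta> \<alpha>" and \<alpha>: "star_hom \<alpha>" and \<Delta>: "star_hom \<Delta>"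
    and "f \<in> dual" "\<phi> \<in> dual" "\<psi> \<in> dual"
  shows "ten (\<lambda>b. ten f \<phi> (\<alpha> b)) \<psi> (\<alpha> b) = ten f (\<lambda>a. ten \<phi> \<psi> (\<Delta> a)) (\<alpha> b)"
proof -
  obtain \<alpha>_id id_\<Delta> assoc where m: "is_tensor_map \<alpha> id \<alpha>_id" "is_tensor_map id \<Delta> id_\<Delta>"
      "is_tensor_assoc assoc" and eq: "assoc (\<alpha>_id (\<alpha> b)) = id_\<Delta> (\<alpha> b)"
    using assms(1) unfolding coaction_identity_def by blast
  have "ten (\<lambda>b. ten f \<phi> (\<alpha> b)) \<psi> (\<alpha> b) = ten (ten f \<phi>) \<psi> (\<alpha>_id (\<alpha> b))"
    by (simp add: ten_map[OF m(1)] assms ten_dual)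
  also have "\<dots> = ten f (ten \<phi> \<psi>) (id_\<Delta> (\<alpha> b))"
    unfolding eq[symmetric] by (rule ten_assoc[OF m(3), symmetric]) (fact assms)+
  also have "\<dots> = ten f (\<lambda>a. ten \<phi> \<psi> (\<Delta> a)) (\<alpha> b)"
    by (simp add: ten_map[OF m(2)] assms ten_dual)
  finally show ?thesis .
qed

lemma eq_on_dense_cspan:
  assumes dense: "closure (cspan S) = UNIV" and h: "bounded_linear h" and k: "bounded_linear k"
    and eq: "\<And>c x. x \<in> S \<Longrightarrow> h (c *\<^sub>C x) = k (c *\<^sub>C x)"
  shows "h = k"
proof
  fix x
  have "h y = k y" if "y \<in> cspan S" for y
    by (rule linear_eq_on[OF bounded_linear.linear[OF h] bounded_linear.linear[OF k] that[unfolded cspan_def]])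
      (auto simp: eq)
  then have "closure (cspan S) \<subseteq> {y. h y = k y}"
    by (intro closure_minimal closed_Collect_eq bounded_linear.continuous_on[OF h]
        bounded_linear.continuous_on[OF k] continuous_on_id) auto
  then show "h x = k x" using dense by auto
qed

subsection \<open>The Haar state\<close>

text \<open>Existence follows Maes and Van Daele. Their proof slices \<open>\<Delta> a\<close> by a state to get an
  element of the algebra; here elements of the algebraic tensor product close to \<open>\<Delta> a\<close> are
  sliced instead, and all the estimates are made uniform in the approximation.\<close>

lemma states_average:
  fixes n :: nat
  assumes "\<And>k. \<phi> k \<in> states" "0 < n"
  shows "(\<lambda>a. \<Sum>k<n. complex_of_real (1 / n) * \<phi> k a) \<in> states"
proof -
  have "(\<lambda>a. \<Sum>k<m. complex_of_real (1 / n) * \<phi> k a) \<in> pos_fun" for m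
  proof (induction m)
    case (Suc m)
    show ?case
      using pos_fun_add[OF Suc pos_fun_scale[OF statesD(1)[OF assms(1)], of "1 / n"]] by simp
  qed (simp add: zero_pos_fun)
  then show ?thesis using assms by (simp add: states_def)
qed

lemma states_midpoint:
  assumes "\<rho> \<in> states" "\<rho>' \<in> states"
  shows "(\<lambda>a. complex_of_real (1/2) * \<rho> a + complex_of_real (1/2) * \<rho>' a) \<in> states"
proof -
  have "(\<lambda>a. complex_of_real (1/2) * \<rho> a + complex_of_real (1/2) * \<rho>' a) \<in> pos_fun"
    by (intro pos_fun_add pos_fun_scale statesD assms) auto
  then show ?thesis using assms by (simp add: states_def)
qed

lemma states_pullback:
  "\<phi> \<in> states \<Longrightarrow> star_hom \<theta> \<Longrightarrow> \<theta> 1 = 1 \<Longrightarrow> (\<lambda>a. \<phi> (\<theta> a)) \<in> states"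
  by (simp add: states_def pos_fun_pullback)

lemma states_dual: "\<phi> \<in> states \<Longrightarrow> \<phi> \<in> dual"
  by (simp add: states_def dual.pos)

text \<open>A positive functional is a multiple of a state, so a linear identity known on states
  extends to \<open>dual\<close>; this turns invariance under states into invariance under all
  functionals.\<close>

lemma dual_eqI_states:
  assumes "\<phi> \<in> dual"
    and add: "\<And>\<phi> \<psi>. \<phi> \<in> dual \<Longrightarrow> \<psi> \<in> dual \<Longrightarrow> F (\<lambda>a. \<phi> a + \<psi> a) = F \<phi> + F \<psi>"
    and scale: "\<And>\<phi> c. \<phi> \<in> dual \<Longrightarrow> F (\<lambda>a. c * \<phi> a) = c * F \<phi>"
    and states: "\<And>\<phi>. \<phi> \<in> states \<Longrightarrow> F \<phi> = z"
  shows "F \<phi> = \<phi> 1 * (z :: complex)"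
  using assms(1)
proof (induction rule: dual.induct)
  case (pos \<phi>)
  show ?case
  proof (cases "\<phi> 1 = 0")
    case True
    then have "\<phi> = (\<lambda>c. 0 * \<phi> c)" using pos_fun_eq_0[OF pos] by auto
    then show ?thesis using scale[OF dual.pos[OF pos], of 0] True by simp
  next
    case False
    define r where "r = Re (\<phi> 1)"
    have r: "\<phi> 1 = complex_of_real r" "0 < r"
      using pos_fun_one[OF pos] False by (auto simp: r_def) (metis less_eq_real_def of_real_0)
    define \<omega> where "\<omega> = (\<lambda>a. complex_of_real (1 / r) * \<phi> a)"
    have "\<omega> \<in> pos_fun" unfolding \<omega>_def by (rule pos_fun_scale[OF pos]) (use r in simp)
    then have \<omega>: "\<omega> \<in> states" using r by (simp add: states_def \<omega>_def)
    have "\<phi> = (\<lambda>a. \<phi> 1 * \<omega> a)" using r by (simp add: \<omega>_def)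
    then have "F \<phi> = \<phi> 1 * F \<omega>" using scale[OF states_dual[OF \<omega>], of "\<phi> 1"] by simp
    then show ?thesis using states[OF \<omega>] by simp
  qed
qed (simp_all add: add scale distrib_right)

text \<open>The instances of interest are \<open>P \<phi> = \<omega> \<otimes> \<phi>\<close> and \<open>P \<phi> = \<phi> \<otimes> \<omega>\<close>; the set \<open>E\<close> collects the
  functionals of this form.\<close>

context
  fixes \<Delta> j :: "'a::cstar_algebra \<Rightarrow> 'e::cstar_algebra"
    and P :: "('a \<Rightarrow> complex) \<Rightarrow> 'e \<Rightarrow> complex" and E :: "('e \<Rightarrow> complex) set"
  assumes \<Delta>: "star_hom \<Delta>" "\<Delta> 1 = 1" and j: "star_hom j" "j 1 = 1" and E: "closed E"
    and P: "\<And>\<phi>. \<phi> \<in> states \<Longrightarrow> P \<phi> \<in> states \<inter> E" "\<And>\<phi> b. \<phi> \<in> states \<Longrightarrow> P \<phi> (j b) = \<phi> b"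
    and PE: "\<And>L. L \<in> states \<Longrightarrow> L \<in> E \<Longrightarrow> P (\<lambda>b. L (j b)) = L"
begin

text \<open>Continuity of P is bypassed: the set is the image, under restriction along j, of a
  compact set of states on \<open>'e\<close> cut out by pointwise conditions.\<close>

lemma closed_almost_invariant_states:
  "closed {\<phi> \<in> states. \<forall>a. cmod (P \<phi> (\<Delta> a) - \<phi> a) \<le> r a}"
proof -
  let ?K = "states \<inter> (E \<inter> {L. \<forall>a. cmod (L (\<Delta> a) - L (j a)) \<le> r a})"
  have "closed {L :: 'e \<Rightarrow> complex. \<forall>a. cmod (L (\<Delta> a) - L (j a)) \<le> r a}"
    by (intro closed_Collect_all closed_Collect_le continuous_intros)
  then have "compact ?K" by (intro compact_Int_closed compact_states closed_Int E)
  then have "compact ((\<lambda>L b. L (j b)) ` ?K)"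
    by (intro compact_continuous_image)
      (auto intro!: continuous_on_coordinatewise_then_product continuous_on_subset[OF continuous_on_product_coordinates])
  moreover have "(\<lambda>L b. L (j b)) ` ?K = {\<phi> \<in> states. \<forall>a. cmod (P \<phi> (\<Delta> a) - \<phi> a) \<le> r a}"
  proof (intro equalityI subsetI)
    fix \<phi> assume "\<phi> \<in> (\<lambda>L b. L (j b)) ` ?K"
    then obtain L where "L \<in> ?K" "\<phi> = (\<lambda>b. L (j b))" by blast
    then show "\<phi> \<in> {\<phi> \<in> states. \<forall>a. cmod (P \<phi> (\<Delta> a) - \<phi> a) \<le> r a}"
      using PE[of L] by (simp add: states_pullback j)
  next
    fix \<phi> assume \<phi>: "\<phi> \<in> {\<phi> \<in> states. \<forall>a. cmod (P \<phi> (\<Delta> a) - \<phi> a) \<le> r a}"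
    then have "P \<phi> \<in> ?K" using P by auto
    moreover have "\<phi> = (\<lambda>b. P \<phi> (j b))" using \<phi> P(2) by auto
    ultimately show "\<phi> \<in> (\<lambda>L b. L (j b)) ` ?K" by blast
  qed
  ultimately show ?thesis by (simp add: compact_imp_closed_fun)
qed

text \<open>The Markov-Kakutani argument for the map sending \<phi> to the composite of
  \<open>P \<phi>\<close> with \<Delta>. The mean of n + 1 iterates moves by at most
  \<open>2 * norm a / (n + 1)\<close> because the sum telescopes, and compactness yields a point
  common to the nested closed sets \<open>C n\<close>.\<close>

lemma invariant_state_exists:
  assumes avg: "\<And>n \<phi>. (\<And>k. \<phi> k \<in> states) \<Longrightarrow>
      P (\<lambda>a. \<Sum>k<n. complex_of_real (1 / real n) * \<phi> k a) = (\<lambda>t. \<Sum>k<n. complex_of_real (1 / real n) * P (\<phi> k) t)"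
    and ne: "\<phi>0 \<in> (states :: ('a \<Rightarrow> complex) set)"
  shows "\<exists>\<phi>\<in>states. \<forall>a. P \<phi> (\<Delta> a) = \<phi> a"
proof -
  define \<Phi> where "\<Phi> \<phi> a = P \<phi> (\<Delta> a)" for \<phi> a
  have \<Phi>: "\<Phi> \<phi> \<in> states" if "\<phi> \<in> states" for \<phi>
    using P(1)[OF that] states_pullback[of "P \<phi>" \<Delta>] \<Delta> by (simp add: \<Phi>_def[abs_def])
  have it: "(\<Phi> ^^ k) \<phi>0 \<in> states" for k by (induction k) (auto simp: ne \<Phi>)
  define C where "C n = {\<phi> \<in> states. \<forall>a. cmod (P \<phi> (\<Delta> a) - \<phi> a) \<le> 2 * norm a / real (Suc n)}" for n
  define s where "s n a = (\<Sum>k<Suc n. complex_of_real (1 / real (Suc n)) * (\<Phi> ^^ k) \<phi>0 a)" for n a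
  have "s n \<in> C n" for n
  proof -
    have "cmod (P (s n) (\<Delta> a) - s n a) \<le> 2 * norm a / real (Suc n)" for a
    proof -
      let ?c = "complex_of_real (1 / real (Suc n))"
      have "P (s n) (\<Delta> a) = (\<Sum>k<Suc n. ?c * (\<Phi> ^^ Suc k) \<phi>0 a)"
        using avg[of "\<lambda>k. (\<Phi> ^^ k) \<phi>0" "Suc n", OF it] by (simp add: s_def[abs_def] \<Phi>_def)
      then have "P (s n) (\<Delta> a) - s n a = ?c * (\<Sum>k<Suc n. (\<Phi> ^^ Suc k) \<phi>0 a - (\<Phi> ^^ k) \<phi>0 a)"
        unfolding s_def by (simp only: sum_subtractf sum_distrib_left right_diff_distrib)
      also have "\<dots> = ?c * ((\<Phi> ^^ Suc n) \<phi>0 a - \<phi>0 a)"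
        using sum_lessThan_telescope[of "\<lambda>k. (\<Phi> ^^ k) \<phi>0 a" "Suc n"] by (simp only: funpow_0)
      finally have "cmod (P (s n) (\<Delta> a) - s n a) = cmod ((\<Phi> ^^ Suc n) \<phi>0 a - \<phi>0 a) / real (Suc n)"
        by (simp only: norm_mult norm_of_real) simp
      also have "\<dots> \<le> 2 * norm a / real (Suc n)"
        using norm_triangle_ineq4[of "(\<Phi> ^^ Suc n) \<phi>0 a" "\<phi>0 a"] states_norm[OF it[of "Suc n"], of a]
          states_norm[OF ne, of a] by (intro divide_right_mono) auto
      finally show ?thesis .
    qed
    moreover have "s n \<in> states"
      unfolding s_def by (rule states_average[OF it]) simp
    ultimately show ?thesis by (simp add: C_def)
  qed
  note sC = this
  have anti: "C n \<subseteq> C m" if "m \<le> n" for m n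
  proof -
    have "2 * norm a / real (Suc n) \<le> 2 * norm a / real (Suc m)" for a :: 'a
      using that by (intro divide_left_mono) auto
    then show ?thesis unfolding C_def by (blast intro: order_trans)
  qed
  have fip: "states \<inter> (\<Inter>n\<in>N. C n) \<noteq> {}" if N: "finite N" for N
  proof -
    have "s (Max (insert 0 N)) \<in> C n" if "n \<in> N" for n
      using anti[of n "Max (insert 0 N)"] sC that N by (auto intro: Max_ge)
    moreover have "s (Max (insert 0 N)) \<in> states" using sC unfolding C_def by blast
    ultimately show ?thesis by blast
  qed
  have "closed (C n)" for n
    unfolding C_def by (rule closed_almost_invariant_states)
  then have "states \<inter> (\<Inter>n. C n) \<noteq> {}"
    using fip by (rule compact_imp_fip_image[OF compact_states])
  then obtain \<phi> where \<phi>: "\<phi> \<in> states" "\<And>n. \<phi> \<in> C n" by blast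
  have "P \<phi> (\<Delta> a) = \<phi> a" for a
  proof -
    have "(\<lambda>n. 2 * norm a / real (Suc n)) \<longlonglongrightarrow> 0"
      using LIMSEQ_Suc[OF lim_const_over_n[of "2 * norm a"]] by simp
    then have "cmod (P \<phi> (\<Delta> a) - \<phi> a) \<le> 0"
      using \<phi>(2) by (intro tendsto_lowerbound[OF _ _ sequentially_bot]) (auto simp: C_def)
    then show ?thesis by simp
  qed
  with \<phi> show ?thesis by blast
qed

end

section \<open>From invariance under a midpoint to invariance under its halves\<close>

lemma pos_fun_Cauchy_Schwarz_right:
  "\<phi> \<in> pos_fun \<Longrightarrow> (cmod (\<phi> (x * y)))\<^sup>2 \<le> Re (\<phi> (x * star x)) * Re (\<phi> (star y * y))"
  using pos_fun_Cauchy_Schwarz[of \<phi> "star x" y] by simp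

text \<open>Only a seminorm of the right factor enters. Approximate slices have a controlled second
  moment but no controlled norm, so the later estimates are phrased in this seminorm.\<close>

lemma states_mult_bound:
  assumes \<phi>: "\<phi> \<in> states"
  shows "cmod (\<phi> (x * y)) \<le> norm x * sqrt (Re (\<phi> (star y * y)))"
proof -
  have "Re (\<phi> (x * star x)) \<le> norm (x * star x)"
    using states_norm[OF \<phi>, of "x * star x"] complex_Re_le_cmod order_trans by blast
  also have "\<dots> \<le> (norm x)\<^sup>2" using norm_mult_ineq[of x "star x"] by (simp add: power2_eq_square)
  finally have "(cmod (\<phi> (x * y)))\<^sup>2 \<le> (norm x)\<^sup>2 * Re (\<phi> (star y * y))"
    using pos_fun_Cauchy_Schwarz_right[OF statesD(1)[OF \<phi>], of x y] pos_fun_nonneg(2)[OF statesD(1)[OF \<phi>], of y]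
    by (meson mult_right_mono order_trans)
  also have "\<dots> = (norm x * sqrt (Re (\<phi> (star y * y))))\<^sup>2"
    using pos_fun_nonneg(2)[OF statesD(1)[OF \<phi>], of y] by (simp add: power_mult_distrib)
  finally show ?thesis
    by (rule power2_le_imp_le) (use pos_fun_nonneg(2)[OF statesD(1)[OF \<phi>], of y] in auto)
qed

text \<open>\<open>b\<close> stands for an approximate slice of \<open>\<Delta> a\<close>, and \<open>i c\<close> for \<open>c \<otimes> 1\<close> or \<open>1 \<otimes> c\<close>. The
  element \<open>X = \<Delta> b - i b\<close> has a small second moment for \<open>M\<close>, hence for \<open>M'\<close>.\<close>

lemma Van_Daele_estimate:
  fixes \<Delta> i :: "'a::cstar_algebra \<Rightarrow> 'e::cstar_algebra"
  assumes \<Delta>: "star_hom \<Delta>" and i: "star_hom i"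
    and M: "M \<in> pos_fun" and M': "M' \<in> pos_fun" and k: "k \<in> pos_fun"
    and M\<Delta>: "\<And>x. M (\<Delta> x) = k x" and Mi: "\<And>x. M (i x) = k x" and M'i: "\<And>x. M' (i x) = k x"
    and dom: "\<And>z. Re (M' (z * star z)) \<le> 2 * Re (M (z * star z))"
    and R: "0 \<le> R"
    and approx: "\<And>e. 0 < e \<Longrightarrow> \<exists>b. Re (k (b * star b)) \<le> (R + e)\<^sup>2 \<and>
      (\<forall>c. cmod (M (\<Delta> b * i c) - N c) \<le> e * sqrt (Re (k (star c * c))) \<and>
           cmod (M' (\<Delta> b * i c) - N' c) \<le> e * sqrt (Re (k (star c * c))) \<and>
           cmod (k (b * c) - N c) \<le> e * sqrt (Re (k (star c * c))))"
  shows "N' c = N c"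
proof -
  define K where "K = sqrt (Re (k (star c * c)))"
  have K: "0 \<le> K" "K\<^sup>2 = Re (k (star c * c))"
    using pos_fun_nonneg(2)[OF k, of c] by (auto simp: K_def)
  have est: "cmod (N' c - N c) \<le> 2 * e * K + sqrt (8 * e * (R + 1)) * K" if e: "0 < e" "e \<le> 1" for e
  proof -
    obtain b where b: "Re (k (b * star b)) \<le> (R + e)\<^sup>2"
      and bM: "\<And>c. cmod (M (\<Delta> b * i c) - N c) \<le> e * sqrt (Re (k (star c * c)))"
      and bM': "\<And>c. cmod (M' (\<Delta> b * i c) - N' c) \<le> e * sqrt (Re (k (star c * c)))"
      and bk: "\<And>c. cmod (k (b * c) - N c) \<le> e * sqrt (Re (k (star c * c)))"
      using approx[OF e(1)] by blast
    define X where "X = \<Delta> b - i b"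
    \<comment> \<open>Both G and \<open>k (b * star b)\<close> approximate
      \<open>N (star b)\<close>, so \<open>Re (M (X * star X)) = 2 * (q - Re G)\<close> is of order
      e.\<close>
    define G where "G = M (\<Delta> b * i (star b))"
    define q where "q = Re (k (b * star b))"
    have "sqrt q \<le> R + 1"
      using b e R by (intro real_le_lsqrt order_trans[OF b[folded q_def]] power_mono) auto
    have "cmod (G - k (b * star b)) \<le> cmod (G - N (star b)) + cmod (k (b * star b) - N (star b))"
      using norm_triangle_ineq4[of "G - N (star b)" "k (b * star b) - N (star b)"] by simp
    also have "\<dots> \<le> e * sqrt q + e * sqrt q"
      using bM[of "star b"] bk[of "star b"] by (intro add_mono) (auto simp: G_def q_def)
    also have "\<dots> \<le> 2 * e * (R + 1)" using \<open>sqrt q \<le> R + 1\<close> e by simp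
    finally have G: "\<bar>Re G - q\<bar> \<le> 2 * e * (R + 1)"
      using abs_Re_le_cmod[of "G - k (b * star b)"] by (simp add: q_def)
    have "X * star X = \<Delta> (b * star b) - \<Delta> b * i (star b) - star (\<Delta> b * i (star b)) + i (b * star b)"
      by (simp add: X_def star_diff star_mult star_homD[OF \<Delta>] star_homD[OF i] algebra_simps)
    then have "M (X * star X) = k (b * star b) - G - cnj G + k (b * star b)"
      by (simp only: G_def pos_fun_plus[OF M] pos_fun_diff[OF M] pos_fun_star[OF M] M\<Delta> Mi)
    then have "Re (M (X * star X)) = 2 * (q - Re G)" by (simp add: q_def)
    with G have Q: "Re (M' (X * star X)) \<le> 8 * e * (R + 1)"
      using dom[of X] by (simp add: abs_le_iff)
    \<comment> \<open>Cauchy-Schwarz makes \<open>M' (X * i c)\<close> small, while it equals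
      \<open>M' (\<Delta> b * i c) - k (b * c)\<close>, which approximates
      \<open>N' c - N c\<close>.\<close>
    have "(cmod (M' (X * i c)))\<^sup>2 \<le> Re (M' (X * star X)) * Re (M' (star (i c) * i c))"
      by (rule pos_fun_Cauchy_Schwarz_right[OF M'])
    also have "star (i c) * i c = i (star c * c)" by (simp add: star_homD[OF i])
    also have "Re (M' (X * star X)) * Re (M' (i (star c * c))) \<le> 8 * e * (R + 1) * K\<^sup>2"
      unfolding M'i K(2)[symmetric] using Q by (intro mult_right_mono) auto
    also have "\<dots> = (sqrt (8 * e * (R + 1)) * K)\<^sup>2" using e R by (simp add: power_mult_distrib)
    finally have X: "cmod (M' (X * i c)) \<le> sqrt (8 * e * (R + 1)) * K"
      by (rule power2_le_imp_le) (use e R K in auto)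
    have "M' (X * i c) = M' (\<Delta> b * i c) - k (b * c)"
      by (simp add: X_def left_diff_distrib pos_fun_diff[OF M'] M'i flip: star_homD(3)[OF i])
    then have "N' c - N c = M' (X * i c) - (M' (\<Delta> b * i c) - N' c) + (k (b * c) - N c)" by simp
    then have "cmod (N' c - N c) \<le> cmod (M' (X * i c)) + cmod (M' (\<Delta> b * i c) - N' c) + cmod (k (b * c) - N c)"
      using order_trans[OF norm_triangle_ineq add_right_mono[OF norm_triangle_ineq4]] by (simp only:)
    with X bM'[of c] bk[of c] show ?thesis by (simp add: K_def)
  qed
  have "((\<lambda>e. 2 * e * K + sqrt (8 * e * (R + 1)) * K) \<longlongrightarrow> 0) (at_right 0)"
    by (auto intro!: tendsto_eq_intros)
  moreover have "\<forall>\<^sub>F e in at_right 0. cmod (N' c - N c) \<le> 2 * e * K + sqrt (8 * e * (R + 1)) * K"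
    unfolding eventually_at_right_field using est by (intro exI[of _ 1]) auto
  ultimately have "cmod (N' c - N c) \<le> 0"
    by (rule tendsto_lowerbound) simp
  then show ?thesis by simp
qed

text \<open>For a finite sum of elementary tensors the slice
  \<open>\<Sum>\<^sub>i h(b\<^sub>i) a\<^sub>i\<close> is a genuine element, and it serves all f at
  once.\<close>

lemma span_slice_right:
  assumes "t \<in> span {a \<otimes> b |a b. True}" and h: "h \<in> dual"
  shows "\<exists>x. \<forall>f\<in>dual. ten f h t = f x"
  using assms(1)
proof (induction rule: span_induct_alt)
  case base
  show ?case using h by (intro exI[of _ 0]) (simp add: dual_zero_arg ten_dual)
next
  case (step r s t)
  then obtain a b x where s: "s = a \<otimes> b" and x: "\<forall>f\<in>dual. ten f h t = f x" by blast
  have "ten f h (r *\<^sub>R s + t) = f (complex_of_real r *\<^sub>C h b *\<^sub>C a + x)" if f: "f \<in> dual" for f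
    using x f h by (simp add: s scaleR_scaleC dual_plus[OF ten_dual[OF f h]]
        dual_scaleC[OF ten_dual[OF f h]] dual_plus[OF f] dual_scaleC[OF f])
  then show ?case by blast
qed

lemma span_slice_left:
  assumes "t \<in> span {a \<otimes> b |a b. True}" and h: "h \<in> dual"
  shows "\<exists>x. \<forall>f\<in>dual. ten h f t = f x"
  using assms(1)
proof (induction rule: span_induct_alt)
  case base
  show ?case using h by (intro exI[of _ 0]) (simp add: dual_zero_arg ten_dual)
next
  case (step r s t)
  then obtain a b x where s: "s = a \<otimes> b" and x: "\<forall>f\<in>dual. ten h f t = f x" by blast
  have "ten h f (r *\<^sub>R s + t) = f (complex_of_real r *\<^sub>C h a *\<^sub>C b + x)" if f: "f \<in> dual" for f
    using x f h by (simp add: s scaleR_scaleC dual_plus[OF ten_dual[OF h f]]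
        dual_scaleC[OF ten_dual[OF h f]] dual_plus[OF f] dual_scaleC[OF f])
  then show ?case by blast
qed

lemma span_tens_approx:
  fixes t :: "'c::cstar_algebra \<otimes> 'd::cstar_algebra"
  assumes "0 < e"
  obtains t0 where "t0 \<in> span {a \<otimes> b |a b. True}" "norm (t0 - t) < e"
proof -
  have cs: "cspan {a \<otimes> b |(a::'c) (b::'d). True} = span {a \<otimes> b |(a::'c) (b::'d). True}"
    by (rule cspan_eq_span) (auto, metis tens_simps(3))
  have "t \<in> closure (span {a \<otimes> b |(a::'c) (b::'d). True})"
    using closure_cspan_tens[where 'a = 'c and 'b = 'd] unfolding cs by blast
  then obtain t0 where "t0 \<in> span {a \<otimes> b |(a::'c) (b::'d). True}" "dist t0 t < e"
    unfolding closure_approachable using assms by blast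
  then show thesis by (intro that) (simp_all add: dist_norm)
qed

lemma star_hom_tens_left: "star_hom (\<lambda>a. a \<otimes> 1)"
  and star_hom_tens_right: "star_hom (\<lambda>a. 1 \<otimes> a)"
  by (simp_all add: star_hom_def tens_simps)

text \<open>The other half of the midpoint is nonnegative. This is the origin of the factor 2 in the
  hypothesis \<open>dom\<close> of \<open>Van_Daele_estimate\<close>.\<close>

lemma midpoint_dominates:
  assumes "\<rho> \<in> pos_fun" "\<rho>' \<in> pos_fun"
    and "\<And>z. \<omega> z = complex_of_real (1/2) * \<rho> z + complex_of_real (1/2) * \<rho>' z"
  shows "Re (\<rho> (z * star z)) \<le> 2 * Re (\<omega> (z * star z))"
  using pos_fun_nonneg(2)[OF assms(2), of "star z"] by (simp add: assms(3))

definition conv :: "('a::cstar_algebra \<Rightarrow> 'a \<otimes> 'a) \<Rightarrow> ('a \<Rightarrow> complex) \<Rightarrow> ('a \<Rightarrow> complex) \<Rightarrow> 'a \<Rightarrow> complex" where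
  "conv \<Delta> \<phi> \<psi> = (\<lambda>a. ten \<phi> \<psi> (\<Delta> a))"

context
  fixes \<Delta> :: "'a::cstar_algebra \<Rightarrow> 'a \<otimes> 'a"
  assumes cqg: "compact_quantum_group \<Delta>"
begin

lemma star_hom_comult: "star_hom \<Delta>" and comult_one: "\<Delta> 1 = 1"
  using cqg by (auto simp: compact_quantum_group_def unital_star_hom_def)

lemma conv_dual: "\<phi> \<in> dual \<Longrightarrow> \<psi> \<in> dual \<Longrightarrow> conv \<Delta> \<phi> \<psi> \<in> dual"
  unfolding conv_def by (rule dual_pullback[OF ten_dual star_hom_comult])

lemma conv_assoc:
  "\<phi> \<in> dual \<Longrightarrow> \<psi> \<in> dual \<Longrightarrow> \<tau> \<in> dual \<Longrightarrow> conv \<Delta> (conv \<Delta> \<phi> \<psi>) \<tau> = conv \<Delta> \<phi> (conv \<Delta> \<psi> \<tau>)"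
  unfolding conv_def
  by (rule ext, rule coaction_convolution) (use cqg star_hom_comult in \<open>auto simp: compact_quantum_group_def\<close>)

lemma
  assumes \<omega>: "\<omega> \<in> states"
  shows left_invariant_exists: "\<exists>h\<in>states. conv \<Delta> \<omega> h = h"
    and closed_left_invariant: "closed {h \<in> states. conv \<Delta> \<omega> h = h}"
proof -
  let ?E = "{L :: 'a \<otimes> 'a \<Rightarrow> complex. \<forall>a b. L (a \<otimes> b) = \<omega> a * L (1 \<otimes> b)}"
  have E: "closed ?E" by (intro closed_Collect_all closed_Collect_eq continuous_intros)
  note [simp] = states_dual statesD(2) \<omega>
  have P: "ten \<omega> \<phi> \<in> states \<inter> ?E" "ten \<omega> \<phi> (1 \<otimes> b) = \<phi> b" if "\<phi> \<in> states" for \<phi> b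
    using that by (simp_all add: ten_states)
  have PE: "ten \<omega> (\<lambda>b. L (1 \<otimes> b)) = L" if "L \<in> states" "L \<in> ?E" for L
    by (rule ten_eqI[OF dual_bounded_linear[OF states_dual]]) (use that in blast)+
  note * = star_hom_comult comult_one star_hom_tens_right tens_simps(7) E P PE
  have "\<exists>h\<in>states. \<forall>a. ten \<omega> h (\<Delta> a) = h a"
  proof (rule invariant_state_exists[OF *])
    fix n :: nat and \<phi> :: "nat \<Rightarrow> 'a \<Rightarrow> complex" assume "\<And>k. \<phi> k \<in> states"
    then have "ten \<omega> (\<lambda>a. \<Sum>k<n. c * \<phi> k a) = (\<lambda>t. \<Sum>k<n. c * ten \<omega> (\<phi> k) t)" for c
      by (subst ten_sum_right) (auto intro!: dual.scale simp: ten_scale_right)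
    then show "ten \<omega> (\<lambda>a. \<Sum>k<n. complex_of_real (1 / real n) * \<phi> k a) =
        (\<lambda>t. \<Sum>k<n. complex_of_real (1 / real n) * ten \<omega> (\<phi> k) t)" .
  qed (assumption | rule \<omega>)+
  then show "\<exists>h\<in>states. conv \<Delta> \<omega> h = h" by (simp add: conv_def fun_eq_iff)
  show "closed {h \<in> states. conv \<Delta> \<omega> h = h}"
  proof -
    have "closed {h \<in> states. \<forall>a. cmod (ten \<omega> h (\<Delta> a) - h a) \<le> 0}"
      by (rule closed_almost_invariant_states[OF *])
    then show ?thesis by (simp add: conv_def fun_eq_iff)
  qed
qed

lemma
  assumes \<omega>: "\<omega> \<in> states"
  shows right_invariant_exists: "\<exists>h\<in>states. conv \<Delta> h \<omega> = h"
    and closed_right_invariant: "closed {h \<in> states. conv \<Delta> h \<omega> = h}"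
proof -
  let ?E = "{L :: 'a \<otimes> 'a \<Rightarrow> complex. \<forall>a b. L (a \<otimes> b) = L (a \<otimes> 1) * \<omega> b}"
  have E: "closed ?E" by (intro closed_Collect_all closed_Collect_eq continuous_intros)
  note [simp] = states_dual statesD(2) \<omega>
  have P: "ten \<phi> \<omega> \<in> states \<inter> ?E" "ten \<phi> \<omega> (b \<otimes> 1) = \<phi> b" if "\<phi> \<in> states" for \<phi> b
    using that by (simp_all add: ten_states)
  have PE: "ten (\<lambda>b. L (b \<otimes> 1)) \<omega> = L" if "L \<in> states" "L \<in> ?E" for L
    by (rule ten_eqI[OF dual_bounded_linear[OF states_dual]]) (use that in blast)+
  note * = star_hom_comult comult_one star_hom_tens_left tens_simps(7) E P PE
  have "\<exists>h\<in>states. \<forall>a. ten h \<omega> (\<Delta> a) = h a"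
  proof (rule invariant_state_exists[where P = "\<lambda>h. ten h \<omega>", OF *])
    fix n :: nat and \<phi> :: "nat \<Rightarrow> 'a \<Rightarrow> complex" assume "\<And>k. \<phi> k \<in> states"
    then have "ten (\<lambda>a. \<Sum>k<n. c * \<phi> k a) \<omega> = (\<lambda>t. \<Sum>k<n. c * ten (\<phi> k) \<omega> t)" for c
      by (subst ten_sum_left) (auto intro!: dual.scale simp: ten_scale_left)
    then show "ten (\<lambda>a. \<Sum>k<n. complex_of_real (1 / real n) * \<phi> k a) \<omega> =
        (\<lambda>t. \<Sum>k<n. complex_of_real (1 / real n) * ten (\<phi> k) \<omega> t)" .
  qed (assumption | rule \<omega>)+
  then show "\<exists>h\<in>states. conv \<Delta> h \<omega> = h" by (simp add: conv_def fun_eq_iff)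
  show "closed {h \<in> states. conv \<Delta> h \<omega> = h}"
  proof -
    have "closed {h \<in> states. \<forall>a. cmod (ten h \<omega> (\<Delta> a) - h a) \<le> 0}"
      by (rule closed_almost_invariant_states[where P = "\<lambda>h. ten h \<omega>", OF *])
    then show ?thesis by (simp add: conv_def fun_eq_iff)
  qed
qed

text \<open>The maps come with the coassociativity identity. Any common bound K will do, because the
  estimates apply them to differences that tend to 0.\<close>

lemma comult_tensor_maps:
  obtains \<Delta>_id id_\<Delta> K where "is_tensor_map \<Delta> (id :: 'a \<Rightarrow> 'a) \<Delta>_id" "is_tensor_map (id :: 'a \<Rightarrow> 'a) \<Delta> id_\<Delta>" "0 < K"
    "\<And>t. norm (\<Delta>_id t) \<le> K * norm t" "\<And>t. norm (id_\<Delta> t) \<le> K * norm t"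
proof -
  have "coaction_identity \<Delta> \<Delta>" using cqg by (simp add: compact_quantum_group_def)
  then obtain \<Delta>_id id_\<Delta> where m: "is_tensor_map \<Delta> (id :: 'a \<Rightarrow> 'a) \<Delta>_id" "is_tensor_map (id :: 'a \<Rightarrow> 'a) \<Delta> id_\<Delta>"
    unfolding coaction_identity_def by blast
  then obtain K1 K2 where K: "0 < K1" "\<And>t. norm (\<Delta>_id t) \<le> norm t * K1" "\<And>t. norm (id_\<Delta> t) \<le> norm t * K2"
    unfolding is_tensor_map_def by (metis bounded_linear.pos_bounded)
  have "norm (\<Delta>_id t) \<le> max K1 K2 * norm t" "norm (id_\<Delta> t) \<le> max K1 K2 * norm t" for t
    using K(2,3)[of t] mult_left_mono[OF max.cobounded1[of K1 K2], of "norm t"]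
      mult_left_mono[OF max.cobounded2[of K2 K1], of "norm t"] by (simp_all add: mult.commute)
  with m K(1) show thesis by (intro that[of \<Delta>_id id_\<Delta> "max K1 K2"]) auto
qed

text \<open>With \<open>b = (id \<otimes> h)\<Delta>(a)\<close>, invariance of h under \<omega>
  makes \<open>\<Delta>(b) - b \<otimes> 1\<close> null for \<open>k \<otimes> \<omega>\<close>,
  hence for \<open>k \<otimes> \<rho>\<close>, since \<omega> dominates half of \<rho>. The choice
  of k gives \<open>(k \<otimes> \<omega>)\<Delta> = k\<close>, which makes the second moments
  computable. The element b is only approximated, by slicing a finite tensor sum close to
  \<open>\<Delta> a\<close>.\<close>

lemma Van_Daele_left:
  assumes \<rho>: "\<rho> \<in> states" and \<rho>': "\<rho>' \<in> states" and k: "k \<in> states" and h: "h \<in> states"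
    and \<omega>_def: "\<omega> = (\<lambda>a. complex_of_real (1/2) * \<rho> a + complex_of_real (1/2) * \<rho>' a)"
    and k\<omega>: "conv \<Delta> k \<omega> = k" and \<omega>h: "conv \<Delta> \<omega> h = h"
  shows "conv \<Delta> \<rho> h = h"
proof -
  have \<omega>: "\<omega> \<in> states" unfolding \<omega>_def by (rule states_midpoint[OF \<rho> \<rho>'])
  note [simp] = states_dual[OF \<rho>] states_dual[OF \<rho>'] states_dual[OF k] states_dual[OF h] states_dual[OF \<omega>]
    statesD(1)[OF k] statesD(2)[OF \<rho>] statesD(2)[OF \<omega>]
  obtain \<Delta>_id id_\<Delta> K where m: "is_tensor_map \<Delta> (id :: 'a \<Rightarrow> 'a) \<Delta>_id" and K: "0 < K" "\<And>t. norm (\<Delta>_id t) \<le> K * norm t"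
    using comult_tensor_maps by metis
  define kc where "kc c = (\<lambda>x. k (x * c))" for c
  have kc [simp]: "kc c \<in> dual" for c unfolding kc_def by (rule dual_mult_right) simp
  have ten_kc: "ten (kc c) \<sigma> t = ten k \<sigma> (t * (c \<otimes> 1))" if "\<sigma> \<in> dual" for c t and \<sigma> :: "'a \<Rightarrow> complex"
    by (simp add: ten_mult_right that kc_def)
  have bound1: "cmod (ten (kc c) h t) \<le> norm t * sqrt (Re (k (star c * c)))" for c t
    using states_mult_bound[OF ten_states[OF k h], of t "c \<otimes> 1"] statesD(2)[OF h]
    by (simp add: ten_kc tens_simps)
  \<comment> \<open>\<open>kc c\<close> is not positive. Moving c back into the argument, to the
    right of \<open>\<Delta>_id t\<close>, makes the bound for the state
    \<open>(k \<otimes> \<sigma>) \<otimes> h\<close> applicable.\<close>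
  have bound2: "cmod (ten (conv \<Delta> (kc c) \<sigma>) h t) \<le> K * norm t * sqrt (Re (k (star c * c)))"
    if \<sigma>: "\<sigma> \<in> states" for c \<sigma> t
  proof -
    note [simp] = states_dual[OF \<sigma>] statesD(2)[OF \<sigma>] statesD(2)[OF h]
    have "ten (conv \<Delta> (kc c) \<sigma>) h t = ten (ten (kc c) \<sigma>) h (\<Delta>_id t)"
      by (simp add: ten_map[OF m] ten_dual conv_def)
    also have "\<dots> = ten (\<lambda>s. ten k \<sigma> (s * (c \<otimes> 1))) (\<lambda>y. h (y * 1)) (\<Delta>_id t)"
      by (simp only: ext[OF ten_kc[OF states_dual[OF \<sigma>], of c]] mult_1_right)
    also have "\<dots> = ten (ten k \<sigma>) h (\<Delta>_id t * ((c \<otimes> 1) \<otimes> 1))"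
      by (rule ten_mult_right[symmetric]) (simp_all add: ten_dual)
    also have "cmod \<dots> \<le> norm (\<Delta>_id t) * sqrt (Re (k (star c * c)))"
      using states_mult_bound[OF ten_states[OF ten_states[OF k \<sigma>] h], of "\<Delta>_id t" "(c \<otimes> 1) \<otimes> 1"]
      by (simp add: tens_simps ten_dual)
    also have "\<dots> \<le> K * norm t * sqrt (Re (k (star c * c)))"
      using pos_fun_nonneg(2)[OF statesD(1)[OF k], of c] by (intro mult_right_mono K) auto
    finally show ?thesis .
  qed
  have "ten k (conv \<Delta> \<rho> h) (\<Delta> a * (c \<otimes> 1)) = ten k h (\<Delta> a * (c \<otimes> 1))" for a c
  proof (rule Van_Daele_estimate[where M = "ten k \<omega>" and M' = "ten k \<rho>" and k = k and \<Delta> = \<Delta>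
        and i = "\<lambda>c. c \<otimes> 1" and R = "norm (\<Delta> a)"
        and N = "\<lambda>c. ten k h (\<Delta> a * (c \<otimes> 1))" and N' = "\<lambda>c. ten k (conv \<Delta> \<rho> h) (\<Delta> a * (c \<otimes> 1))"])
    show "ten k \<omega> \<in> pos_fun" "ten k \<rho> \<in> pos_fun"
      by (intro ten_pos_fun statesD(1) k \<omega> \<rho>)+
    show "ten k \<omega> (\<Delta> x) = k x" for x using fun_cong[OF k\<omega>, of x] by (simp add: conv_def)
    show "Re (ten k \<rho> (z * star z)) \<le> 2 * Re (ten k \<omega> (z * star z))" for z
      by (rule midpoint_dominates[of _ "ten k \<rho>'"])
        (simp_all add: ten_pos_fun statesD(1) k \<rho> \<rho>' \<omega>_def ten_add_right ten_scale_right dual.scale del: of_real_divide)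
    fix e :: real assume e: "0 < e"
    \<comment> \<open>The approximation error enters once directly and once after
      \<open>\<Delta> \<otimes> id\<close>; this d makes both d and \<open>K * d\<close> at most
      e.\<close>
    define d where "d = e / (1 + K)"
    have d: "0 < d" "d \<le> e" "K * d \<le> e" using e K(1) by (auto simp: d_def field_simps)
    obtain t where t: "t \<in> span {a \<otimes> b |a b. True}" "norm (t - \<Delta> a) < d"
      by (rule span_tens_approx[OF d(1)])
    obtain b where b: "\<And>f. f \<in> dual \<Longrightarrow> ten f h t = f b"
      using span_slice_right[OF t(1) states_dual[OF h]] by blast
    have conv_kc: "ten k \<sigma> (\<Delta> x * (c \<otimes> 1)) = conv \<Delta> (kc c) \<sigma> x" if "\<sigma> \<in> dual" for \<sigma> x c
      by (simp add: conv_def ten_kc that)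
    have near: "cmod (ten k \<sigma> (\<Delta> b * (c \<otimes> 1)) - ten k (conv \<Delta> \<sigma> h) (\<Delta> a * (c \<otimes> 1)))
        \<le> e * sqrt (Re (k (star c * c)))" if \<sigma>: "\<sigma> \<in> states" for \<sigma> c
    proof -
      note [simp] = states_dual[OF \<sigma>]
      have "ten k (conv \<Delta> \<sigma> h) (\<Delta> a * (c \<otimes> 1)) = conv \<Delta> (conv \<Delta> (kc c) \<sigma>) h a"
        by (simp add: conv_kc conv_dual conv_assoc)
      then have "ten k \<sigma> (\<Delta> b * (c \<otimes> 1)) - ten k (conv \<Delta> \<sigma> h) (\<Delta> a * (c \<otimes> 1)) =
          ten (conv \<Delta> (kc c) \<sigma>) h (t - \<Delta> a)"
        by (simp add: conv_kc b[symmetric] conv_dual dual_diff ten_dual) (simp add: conv_def)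
      also have "cmod \<dots> \<le> K * norm (t - \<Delta> a) * sqrt (Re (k (star c * c)))"
        by (rule bound2[OF \<sigma>])
      also have "\<dots> \<le> e * sqrt (Re (k (star c * c)))"
        using pos_fun_nonneg(2)[OF statesD(1)[OF k], of c] d K(1) t(2)
        by (intro mult_right_mono order_trans[OF mult_left_mono d(3)]) auto
      finally show ?thesis .
    qed
    have near': "cmod (k (b * c) - ten k h (\<Delta> a * (c \<otimes> 1))) \<le> e * sqrt (Re (k (star c * c)))" for c
    proof -
      have "k (b * c) - ten k h (\<Delta> a * (c \<otimes> 1)) = ten (kc c) h (t - \<Delta> a)"
        using b[of "kc c"] by (simp add: ten_kc dual_diff ten_dual left_diff_distrib) (simp add: kc_def ten_kc[symmetric])
      also have "cmod \<dots> \<le> norm (t - \<Delta> a) * sqrt (Re (k (star c * c)))" by (rule bound1)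
      also have "\<dots> \<le> e * sqrt (Re (k (star c * c)))"
        using pos_fun_nonneg(2)[OF statesD(1)[OF k], of c] d t(2) by (intro mult_right_mono) auto
      finally show ?thesis .
    qed
    have "Re (k (b * star b)) \<le> (norm (\<Delta> a) + e)\<^sup>2"
    proof -
      define q where "q = Re (k (b * star b))"
      have q: "0 \<le> q" using pos_fun_nonneg(2)[OF statesD(1)[OF k], of "star b"] by (simp add: q_def)
      \<comment> \<open>The second moment is itself a value of the sliced functional, so
        \<open>q \<le> norm t * sqrt q\<close>; dividing by \<open>sqrt q\<close> bounds it without
        any norm bound for b.\<close>
      have "q \<le> cmod (ten (kc (star b)) h t)"
        using b[OF kc, of "star b"] complex_Re_le_cmod[of "k (b * star b)"] by (simp add: q_def) (simp add: kc_def)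
      also have "\<dots> \<le> norm t * sqrt q" using bound1[of "star b" t] by (simp add: q_def)
      finally have "sqrt q * sqrt q \<le> norm t * sqrt q" using q by simp
      then have "sqrt q \<le> norm t" using q by (cases "q = 0") (simp_all add: mult_le_cancel_right del: real_sqrt_mult_self)
      also have "norm t \<le> norm (\<Delta> a) + e" using t(2) d(2) norm_triangle_sub[of t "\<Delta> a"] by simp
      finally have "(sqrt q)\<^sup>2 \<le> (norm (\<Delta> a) + e)\<^sup>2" using q by (intro power_mono) auto
      then show ?thesis using q by (simp add: q_def)
    qed
    then show "\<exists>b. Re (k (b * star b)) \<le> (norm (\<Delta> a) + e)\<^sup>2 \<and>
      (\<forall>c. cmod (ten k \<omega> (\<Delta> b * (c \<otimes> 1)) - ten k h (\<Delta> a * (c \<otimes> 1))) \<le> e * sqrt (Re (k (star c * c))) \<and>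
           cmod (ten k \<rho> (\<Delta> b * (c \<otimes> 1)) - ten k (conv \<Delta> \<rho> h) (\<Delta> a * (c \<otimes> 1))) \<le> e * sqrt (Re (k (star c * c))) \<and>
           cmod (k (b * c) - ten k h (\<Delta> a * (c \<otimes> 1))) \<le> e * sqrt (Re (k (star c * c))))"
      using near[OF \<omega>] near[OF \<rho>] near' unfolding \<omega>h by blast
  qed (simp_all add: star_hom_comult star_hom_tens_left star_hom_tens_right)
  \<comment> \<open>Density of the span of \<open>\<Delta>(A)(A \<otimes> 1)\<close> removes a and
    c; since \<open>k 1 = 1\<close>, the second legs can then be compared at
    \<open>1 \<otimes> d\<close>.\<close>
  then have "ten k (conv \<Delta> \<rho> h) = ten k h"
    by (intro eq_on_dense_cspan[where S = "{\<Delta> a * (b \<otimes> 1) |a b. True}"] bounded_linear_ten)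
      (use cqg in \<open>auto simp: compact_quantum_group_def conv_dual dual_scaleC ten_dual\<close>)
  then have "ten k (conv \<Delta> \<rho> h) (1 \<otimes> d) = ten k h (1 \<otimes> d)" for d by simp
  then show ?thesis using statesD(2)[OF k] by (simp add: conv_dual fun_eq_iff)
qed

text \<open>The mirror image of \<open>Van_Daele_left\<close>: h slices the first leg,
  \<open>id \<otimes> \<Delta>\<close> replaces \<open>\<Delta> \<otimes> id\<close>, and the
  density of \<open>\<Delta>(A)(1 \<otimes> A)\<close> is used.\<close>

lemma Van_Daele_right:
  assumes \<rho>: "\<rho> \<in> states" and \<rho>': "\<rho>' \<in> states" and k: "k \<in> states" and h: "h \<in> states"
    and \<omega>_def: "\<omega> = (\<lambda>a. complex_of_real (1/2) * \<rho> a + complex_of_real (1/2) * \<rho>' a)"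
    and \<omega>k: "conv \<Delta> \<omega> k = k" and h\<omega>: "conv \<Delta> h \<omega> = h"
  shows "conv \<Delta> h \<rho> = h"
proof -
  have \<omega>: "\<omega> \<in> states" unfolding \<omega>_def by (rule states_midpoint[OF \<rho> \<rho>'])
  note [simp] = states_dual[OF \<rho>] states_dual[OF \<rho>'] states_dual[OF k] states_dual[OF h] states_dual[OF \<omega>]
    statesD(1)[OF k] statesD(2)[OF \<rho>] statesD(2)[OF \<omega>]
  obtain \<Delta>_id id_\<Delta> K where m: "is_tensor_map (id :: 'a \<Rightarrow> 'a) \<Delta> id_\<Delta>" and K: "0 < K" "\<And>t. norm (id_\<Delta> t) \<le> K * norm t"
    using comult_tensor_maps by metis
  define kc where "kc c = (\<lambda>x. k (x * c))" for c
  have kc [simp]: "kc c \<in> dual" for c unfolding kc_def by (rule dual_mult_right) simp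
  have ten_kc: "ten \<sigma> (kc c) t = ten \<sigma> k (t * (1 \<otimes> c))" if "\<sigma> \<in> dual" for c t and \<sigma> :: "'a \<Rightarrow> complex"
    by (simp add: ten_mult_right that kc_def)
  have bound1: "cmod (ten h (kc c) t) \<le> norm t * sqrt (Re (k (star c * c)))" for c t
    using states_mult_bound[OF ten_states[OF h k], of t "1 \<otimes> c"] statesD(2)[OF h]
    by (simp add: ten_kc tens_simps)
  have bound2: "cmod (ten h (conv \<Delta> \<sigma> (kc c)) t) \<le> K * norm t * sqrt (Re (k (star c * c)))"
    if \<sigma>: "\<sigma> \<in> states" for c \<sigma> t
  proof -
    note [simp] = states_dual[OF \<sigma>] statesD(2)[OF \<sigma>] statesD(2)[OF h]
    have "ten h (conv \<Delta> \<sigma> (kc c)) t = ten h (ten \<sigma> (kc c)) (id_\<Delta> t)"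
      by (simp add: ten_map[OF m] ten_dual conv_def)
    also have "\<dots> = ten (\<lambda>y. h (y * 1)) (\<lambda>s. ten \<sigma> k (s * (1 \<otimes> c))) (id_\<Delta> t)"
      by (simp only: ext[OF ten_kc[OF states_dual[OF \<sigma>], of c]] mult_1_right)
    also have "\<dots> = ten h (ten \<sigma> k) (id_\<Delta> t * (1 \<otimes> (1 \<otimes> c)))"
      by (rule ten_mult_right[symmetric]) (simp_all add: ten_dual)
    also have "cmod \<dots> \<le> norm (id_\<Delta> t) * sqrt (Re (k (star c * c)))"
      using states_mult_bound[OF ten_states[OF h ten_states[OF \<sigma> k]], of "id_\<Delta> t" "1 \<otimes> (1 \<otimes> c)"]
      by (simp add: tens_simps ten_dual)
    also have "\<dots> \<le> K * norm t * sqrt (Re (k (star c * c)))"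
      using pos_fun_nonneg(2)[OF statesD(1)[OF k], of c] by (intro mult_right_mono K) auto
    finally show ?thesis .
  qed
  have "ten (conv \<Delta> h \<rho>) k (\<Delta> a * (1 \<otimes> c)) = ten h k (\<Delta> a * (1 \<otimes> c))" for a c
  proof (rule Van_Daele_estimate[where M = "ten \<omega> k" and M' = "ten \<rho> k" and k = k and \<Delta> = \<Delta>
        and i = "\<lambda>c. 1 \<otimes> c" and R = "norm (\<Delta> a)"
        and N = "\<lambda>c. ten h k (\<Delta> a * (1 \<otimes> c))" and N' = "\<lambda>c. ten (conv \<Delta> h \<rho>) k (\<Delta> a * (1 \<otimes> c))"])
    show "ten \<omega> k \<in> pos_fun" "ten \<rho> k \<in> pos_fun"
      by (intro ten_pos_fun statesD(1) k \<omega> \<rho>)+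
    show "ten \<omega> k (\<Delta> x) = k x" for x using fun_cong[OF \<omega>k, of x] by (simp add: conv_def)
    show "Re (ten \<rho> k (z * star z)) \<le> 2 * Re (ten \<omega> k (z * star z))" for z
      by (rule midpoint_dominates[of _ "ten \<rho>' k"])
        (simp_all add: ten_pos_fun statesD(1) k \<rho> \<rho>' \<omega>_def ten_add_left ten_scale_left dual.scale del: of_real_divide)
    fix e :: real assume e: "0 < e"
    define d where "d = e / (1 + K)"
    have d: "0 < d" "d \<le> e" "K * d \<le> e" using e K(1) by (auto simp: d_def field_simps)
    obtain t where t: "t \<in> span {a \<otimes> b |a b. True}" "norm (t - \<Delta> a) < d"
      by (rule span_tens_approx[OF d(1)])
    obtain b where b: "\<And>f. f \<in> dual \<Longrightarrow> ten h f t = f b"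
      using span_slice_left[OF t(1) states_dual[OF h]] by blast
    have conv_kc: "ten \<sigma> k (\<Delta> x * (1 \<otimes> c)) = conv \<Delta> \<sigma> (kc c) x" if "\<sigma> \<in> dual" for \<sigma> x c
      by (simp add: conv_def ten_kc that)
    have near: "cmod (ten \<sigma> k (\<Delta> b * (1 \<otimes> c)) - ten (conv \<Delta> h \<sigma>) k (\<Delta> a * (1 \<otimes> c)))
        \<le> e * sqrt (Re (k (star c * c)))" if \<sigma>: "\<sigma> \<in> states" for \<sigma> c
    proof -
      note [simp] = states_dual[OF \<sigma>]
      have "ten (conv \<Delta> h \<sigma>) k (\<Delta> a * (1 \<otimes> c)) = conv \<Delta> h (conv \<Delta> \<sigma> (kc c)) a"
        by (simp add: conv_kc conv_dual flip: conv_assoc)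
      then have "ten \<sigma> k (\<Delta> b * (1 \<otimes> c)) - ten (conv \<Delta> h \<sigma>) k (\<Delta> a * (1 \<otimes> c)) =
          ten h (conv \<Delta> \<sigma> (kc c)) (t - \<Delta> a)"
        by (simp add: conv_kc b[symmetric] conv_dual dual_diff ten_dual) (simp add: conv_def)
      also have "cmod \<dots> \<le> K * norm (t - \<Delta> a) * sqrt (Re (k (star c * c)))"
        by (rule bound2[OF \<sigma>])
      also have "\<dots> \<le> e * sqrt (Re (k (star c * c)))"
        using pos_fun_nonneg(2)[OF statesD(1)[OF k], of c] d K(1) t(2)
        by (intro mult_right_mono order_trans[OF mult_left_mono d(3)]) auto
      finally show ?thesis .
    qed
    have near': "cmod (k (b * c) - ten h k (\<Delta> a * (1 \<otimes> c))) \<le> e * sqrt (Re (k (star c * c)))" for c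
    proof -
      have "k (b * c) - ten h k (\<Delta> a * (1 \<otimes> c)) = ten h (kc c) (t - \<Delta> a)"
        using b[of "kc c"] by (simp add: ten_kc dual_diff ten_dual left_diff_distrib) (simp add: kc_def ten_kc[symmetric])
      also have "cmod \<dots> \<le> norm (t - \<Delta> a) * sqrt (Re (k (star c * c)))" by (rule bound1)
      also have "\<dots> \<le> e * sqrt (Re (k (star c * c)))"
        using pos_fun_nonneg(2)[OF statesD(1)[OF k], of c] d t(2) by (intro mult_right_mono) auto
      finally show ?thesis .
    qed
    have "Re (k (b * star b)) \<le> (norm (\<Delta> a) + e)\<^sup>2"
    proof -
      define q where "q = Re (k (b * star b))"
      have q: "0 \<le> q" using pos_fun_nonneg(2)[OF statesD(1)[OF k], of "star b"] by (simp add: q_def)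
      have "q \<le> cmod (ten h (kc (star b)) t)"
        using b[OF kc, of "star b"] complex_Re_le_cmod[of "k (b * star b)"] by (simp add: q_def) (simp add: kc_def)
      also have "\<dots> \<le> norm t * sqrt q" using bound1[of "star b" t] by (simp add: q_def)
      finally have "sqrt q * sqrt q \<le> norm t * sqrt q" using q by simp
      then have "sqrt q \<le> norm t" using q by (cases "q = 0") (simp_all add: mult_le_cancel_right del: real_sqrt_mult_self)
      also have "norm t \<le> norm (\<Delta> a) + e" using t(2) d(2) norm_triangle_sub[of t "\<Delta> a"] by simp
      finally have "(sqrt q)\<^sup>2 \<le> (norm (\<Delta> a) + e)\<^sup>2" using q by (intro power_mono) auto
      then show ?thesis using q by (simp add: q_def)
    qed
    then show "\<exists>b. Re (k (b * star b)) \<le> (norm (\<Delta> a) + e)\<^sup>2 \<and>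
      (\<forall>c. cmod (ten \<omega> k (\<Delta> b * (1 \<otimes> c)) - ten h k (\<Delta> a * (1 \<otimes> c))) \<le> e * sqrt (Re (k (star c * c))) \<and>
           cmod (ten \<rho> k (\<Delta> b * (1 \<otimes> c)) - ten (conv \<Delta> h \<rho>) k (\<Delta> a * (1 \<otimes> c))) \<le> e * sqrt (Re (k (star c * c))) \<and>
           cmod (k (b * c) - ten h k (\<Delta> a * (1 \<otimes> c))) \<le> e * sqrt (Re (k (star c * c))))"
      using near[OF \<omega>] near[OF \<rho>] near' unfolding h\<omega> by blast
  qed (simp_all add: star_hom_comult star_hom_tens_left star_hom_tens_right)
  then have "ten (conv \<Delta> h \<rho>) k = ten h k"
    by (intro eq_on_dense_cspan[where S = "{\<Delta> a * (1 \<otimes> b) |a b. True}"] bounded_linear_ten)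
      (use cqg in \<open>auto simp: compact_quantum_group_def conv_dual dual_scaleC ten_dual\<close>)
  then have "ten (conv \<Delta> h \<rho>) k (d \<otimes> 1) = ten h k (d \<otimes> 1)" for d by simp
  then show ?thesis using statesD(2)[OF k] by (simp add: conv_dual fun_eq_iff)
qed


text \<open>Invariance under an iterated midpoint of finitely many states implies invariance under
  each of them, so the compact sets of invariant states have the finite intersection property.\<close>

lemma left_invariant_all:
  assumes ne: "\<phi>0 \<in> (states :: ('a \<Rightarrow> complex) set)"
  obtains h where "h \<in> states" "\<And>\<omega>. \<omega> \<in> states \<Longrightarrow> conv \<Delta> \<omega> h = h"
proof -
  define L where "L \<omega> = {h \<in> states. conv \<Delta> \<omega> h = h}" for \<omega>
  have "\<exists>\<omega>\<in>states. L \<omega> \<subseteq> (\<Inter>\<rho>\<in>\<Omega>. L \<rho>)" if "finite \<Omega>" "\<Omega> \<subseteq> states" for \<Omega>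
    using that
  proof (induction rule: finite_induct)
    case (insert \<rho> \<Omega>)
    then obtain \<rho>' where \<rho>': "\<rho>' \<in> states" "L \<rho>' \<subseteq> (\<Inter>\<rho>\<in>\<Omega>. L \<rho>)" by blast
    have \<rho>: "\<rho> \<in> states" using insert by blast
    define \<omega> where "\<omega> = (\<lambda>a. complex_of_real (1/2) * \<rho> a + complex_of_real (1/2) * \<rho>' a)"
    have \<omega>: "\<omega> \<in> states" unfolding \<omega>_def by (rule states_midpoint[OF \<rho> \<rho>'(1)])
    obtain k where k: "k \<in> states" "conv \<Delta> k \<omega> = k" using right_invariant_exists[OF \<omega>] by blast
    have "conv \<Delta> \<rho> h = h" "conv \<Delta> \<rho>' h = h" if "h \<in> L \<omega>" for h
      using Van_Daele_left[OF \<rho> \<rho>'(1) k(1) _ \<omega>_def k(2), of h]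
        Van_Daele_left[OF \<rho>'(1) \<rho> k(1) _ \<omega>_def[unfolded add.commute[of "_ * \<rho> _"]] k(2), of h] that
      by (auto simp: L_def)
    then have "L \<omega> \<subseteq> L \<rho> \<inter> L \<rho>'" by (auto simp: L_def)
    then show ?case using \<rho>'(2) \<omega> by (intro bexI[of _ \<omega>]) auto
  qed (use ne in auto)
  moreover have "L \<omega> \<noteq> {}" "L \<omega> \<subseteq> states" if "\<omega> \<in> states" for \<omega>
    using left_invariant_exists[OF that] by (auto simp: L_def)
  ultimately have fip: "states \<inter> (\<Inter>\<omega>\<in>\<Omega>. L \<omega>) \<noteq> {}" if "finite \<Omega>" "\<Omega> \<subseteq> states" for \<Omega>
    using that by (metis Int_greatest subset_empty)
  have "closed (L \<omega>)" if "\<omega> \<in> states" for \<omega>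
    unfolding L_def by (rule closed_left_invariant[OF that])
  then have "states \<inter> (\<Inter>\<omega>\<in>states. L \<omega>) \<noteq> {}"
    using fip by (rule compact_imp_fip_image[OF compact_states])
  then show thesis using that by (auto simp: L_def)
qed

lemma right_invariant_all:
  assumes ne: "\<phi>0 \<in> (states :: ('a \<Rightarrow> complex) set)"
  obtains h where "h \<in> states" "\<And>\<omega>. \<omega> \<in> states \<Longrightarrow> conv \<Delta> h \<omega> = h"
proof -
  define L where "L \<omega> = {h \<in> states. conv \<Delta> h \<omega> = h}" for \<omega>
  have "\<exists>\<omega>\<in>states. L \<omega> \<subseteq> (\<Inter>\<rho>\<in>\<Omega>. L \<rho>)" if "finite \<Omega>" "\<Omega> \<subseteq> states" for \<Omega>
    using that
  proof (induction rule: finite_induct)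
    case (insert \<rho> \<Omega>)
    then obtain \<rho>' where \<rho>': "\<rho>' \<in> states" "L \<rho>' \<subseteq> (\<Inter>\<rho>\<in>\<Omega>. L \<rho>)" by blast
    have \<rho>: "\<rho> \<in> states" using insert by blast
    define \<omega> where "\<omega> = (\<lambda>a. complex_of_real (1/2) * \<rho> a + complex_of_real (1/2) * \<rho>' a)"
    have \<omega>: "\<omega> \<in> states" unfolding \<omega>_def by (rule states_midpoint[OF \<rho> \<rho>'(1)])
    obtain k where k: "k \<in> states" "conv \<Delta> \<omega> k = k" using left_invariant_exists[OF \<omega>] by blast
    have "conv \<Delta> h \<rho> = h" "conv \<Delta> h \<rho>' = h" if "h \<in> L \<omega>" for h
      using Van_Daele_right[OF \<rho> \<rho>'(1) k(1) _ \<omega>_def k(2), of h]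
        Van_Daele_right[OF \<rho>'(1) \<rho> k(1) _ \<omega>_def[unfolded add.commute[of "_ * \<rho> _"]] k(2), of h] that
      by (auto simp: L_def)
    then have "L \<omega> \<subseteq> L \<rho> \<inter> L \<rho>'" by (auto simp: L_def)
    then show ?case using \<rho>'(2) \<omega> by (intro bexI[of _ \<omega>]) auto
  qed (use ne in auto)
  moreover have "L \<omega> \<noteq> {}" "L \<omega> \<subseteq> states" if "\<omega> \<in> states" for \<omega>
    using right_invariant_exists[OF that] by (auto simp: L_def)
  ultimately have fip: "states \<inter> (\<Inter>\<omega>\<in>\<Omega>. L \<omega>) \<noteq> {}" if "finite \<Omega>" "\<Omega> \<subseteq> states" for \<Omega>
    using that by (metis Int_greatest subset_empty)
  have "closed (L \<omega>)" if "\<omega> \<in> states" for \<omega>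
    unfolding L_def by (rule closed_right_invariant[OF that])
  then have "states \<inter> (\<Inter>\<omega>\<in>states. L \<omega>) \<noteq> {}"
    using fip by (rule compact_imp_fip_image[OF compact_states])
  then show thesis using that by (auto simp: L_def)
qed

text \<open>A left-invariant h and a right-invariant h' coincide, because the convolution of h' with
  h equals both.\<close>

lemma Haar_state_exists:
  assumes ne: "\<phi>0 \<in> (states :: ('a \<Rightarrow> complex) set)"
  obtains h where "h \<in> states" "\<And>\<phi>. \<phi> \<in> dual \<Longrightarrow> conv \<Delta> \<phi> h = (\<lambda>a. \<phi> 1 * h a)"
    "\<And>\<phi>. \<phi> \<in> dual \<Longrightarrow> conv \<Delta> h \<phi> = (\<lambda>a. \<phi> 1 * h a)"
proof -
  obtain h where h: "h \<in> states" "\<And>\<omega>. \<omega> \<in> states \<Longrightarrow> conv \<Delta> \<omega> h = h"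
    using left_invariant_all[OF ne] by blast
  obtain h' where h': "h' \<in> states" "\<And>\<omega>. \<omega> \<in> states \<Longrightarrow> conv \<Delta> h' \<omega> = h'"
    using right_invariant_all[OF ne] by blast
  have "h' = h" using h(2)[OF h'(1)] h'(2)[OF h(1)] by simp
  note [simp] = states_dual[OF h(1)]
  have "conv \<Delta> \<phi> h a = \<phi> 1 * h a" if "\<phi> \<in> dual" for \<phi> a
    using that by (rule dual_eqI_states) (simp_all add: conv_def ten_add_left ten_scale_left h(2)[unfolded conv_def fun_eq_iff])
  moreover have "conv \<Delta> h \<phi> a = \<phi> 1 * h a" if "\<phi> \<in> dual" for \<phi> a
    using that by (rule dual_eqI_states)
      (simp_all add: conv_def ten_add_right ten_scale_right h'(2)[unfolded \<open>h' = h\<close> conv_def fun_eq_iff])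
  ultimately show thesis using that[OF h(1)] by blast
qed

end

subsection \<open>Ergodic actions on \<open>C(X)\<close>\<close>

lemma eval_states: "(\<lambda>b :: 'x::topological_space \<Rightarrow>\<^sub>C complex. b y) \<in> states"
proof -
  define \<rho> where "\<rho> b = apply_bcontfun b y *\<^sub>C (1 :: unit ell2_op)" for b :: "'x \<Rightarrow>\<^sub>C complex"
  have "star_hom \<rho>"
    by (simp add: star_hom_def \<rho>_def apply_cstar_bcontfun scaleC_add_left scaleC_scaleC
        scaleC_mult_left scaleC_mult_right star_scaleC scaleC_complex_def star_complex_def mult.commute)
  from vector_functional_pos_fun[OF this, of "ell2_basis ()"]
  have "(\<lambda>b :: 'x \<Rightarrow>\<^sub>C complex. b y) \<in> pos_fun" by (simp add: \<rho>_def)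
  then show ?thesis by (simp add: states_def apply_one_bcontfun)
qed

lemma eval_dual: "(\<lambda>b :: 'x::topological_space \<Rightarrow>\<^sub>C complex. b y) \<in> dual"
  by (rule states_dual[OF eval_states])

text \<open>In C(X) the norm is tested by evaluations, which are states, so slicing algebraic
  tensors is contractive. Slices of approximants of t form a Cauchy sequence, and its limit is a
  true slice of t.\<close>

lemma slice_exists:
  fixes t :: "('x::topological_space \<Rightarrow>\<^sub>C complex) \<otimes> 'a::cstar_algebra"
  assumes \<phi>: "\<phi> \<in> states"
  shows "\<exists>b. \<forall>f\<in>dual. ten f \<phi> t = f b"
proof -
  note [simp] = states_dual[OF \<phi>]
  have approx: "\<forall>n. \<exists>s. s \<in> span {a \<otimes> b |(a :: 'x \<Rightarrow>\<^sub>C complex) (b :: 'a). True} \<and> norm (s - t) < 1 / real (Suc n)"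
  proof
    fix n
    show "\<exists>s. s \<in> span {a \<otimes> b |(a :: 'x \<Rightarrow>\<^sub>C complex) (b :: 'a). True} \<and> norm (s - t) < 1 / real (Suc n)"
      by (rule span_tens_approx[of "1 / real (Suc n)" t]) auto
  qed
  obtain s where "\<forall>n. s n \<in> span {a \<otimes> b |(a :: 'x \<Rightarrow>\<^sub>C complex) (b :: 'a). True} \<and> norm (s n - t) < 1 / real (Suc n)"
    using choice[OF approx] by blast
  then have s: "\<And>n. s n \<in> span {a \<otimes> b |(a :: 'x \<Rightarrow>\<^sub>C complex) (b :: 'a). True}"
    and sn: "\<And>n. norm (s n - t) < 1 / real (Suc n)" by blast+
  have st: "s \<longlonglongrightarrow> t"
  proof (rule LIMSEQ_I)
    fix r :: real assume "0 < r"
    then obtain n where n: "1 / real (Suc n) < r" using nat_approx_posE by blast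
    have "norm (s k - t) < r" if "Suc n \<le> k" for k
    proof -
      have "1 / real (Suc k) \<le> 1 / real (Suc n)" using that by (intro divide_left_mono) auto
      with sn[of k] n show ?thesis by linarith
    qed
    then show "\<exists>no. \<forall>k\<ge>no. norm (s k - t) < r" by blast
  qed
  obtain b where b: "\<And>n f. f \<in> dual \<Longrightarrow> ten f \<phi> (s n) = f (b n)"
    using span_slice_right[OF s states_dual[OF \<phi>]] by metis
  have "norm (b m - b n) \<le> norm (s m - s n)" for m n
  proof (rule norm_bound)
    fix y
    have "(b m - b n) y = ten (\<lambda>b. apply_bcontfun b y) \<phi> (s m - s n)"
      by (simp add: b eval_dual dual_diff ten_dual)
    then show "norm ((b m - b n) y) \<le> norm (s m - s n)"
      using states_norm[OF ten_states[OF eval_states \<phi>]] by simp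
  qed
  moreover have "Cauchy s" using st by (rule LIMSEQ_imp_Cauchy)
  ultimately have "Cauchy b" unfolding Cauchy_def dist_norm by (meson order_le_less_trans)
  then obtain l where l: "b \<longlonglongrightarrow> l" by (metis Cauchy_convergent convergent_def)
  have "ten f \<phi> t = f l" if f: "f \<in> dual" for f
  proof (rule LIMSEQ_unique)
    show "(\<lambda>n. ten f \<phi> (s n)) \<longlonglongrightarrow> ten f \<phi> t"
      by (rule bounded_linear.tendsto[OF bounded_linear_ten st]) (simp_all add: f)
    show "(\<lambda>n. ten f \<phi> (s n)) \<longlonglongrightarrow> f l"
      unfolding b[OF f] by (rule bounded_linear.tendsto[OF dual_bounded_linear[OF f] l])
  qed
  then show ?thesis by blast
qed

text \<open>\<open>E b\<close> is the slice \<open>(id \<otimes> h)\<alpha>(b)\<close>. Left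
  invariance of h puts it among the fixed points, where ergodicity makes it scalar; right invariance
  of h makes the resulting \<mu> invariant.\<close>

lemma ergodic_invariant_state:
  fixes \<Delta> :: "'a::cstar_algebra \<Rightarrow> 'a \<otimes> 'a"
    and \<alpha> :: "('x::topological_space \<Rightarrow>\<^sub>C complex) \<Rightarrow> ('x \<Rightarrow>\<^sub>C complex) \<otimes> 'a"
  assumes cqg: "compact_quantum_group \<Delta>" and act: "quantum_group_action \<Delta> \<alpha>" and erg: "ergodic \<alpha>"
    and h: "h \<in> states" and left: "\<And>\<phi>. \<phi> \<in> dual \<Longrightarrow> conv \<Delta> \<phi> h = (\<lambda>a. \<phi> 1 * h a)"
    and right: "\<And>\<phi>. \<phi> \<in> dual \<Longrightarrow> conv \<Delta> h \<phi> = (\<lambda>a. \<phi> 1 * h a)"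
  obtains \<mu> where "\<mu> \<in> states" "\<And>f b. f \<in> dual \<Longrightarrow> ten f h (\<alpha> b) = f 1 * \<mu> b"
    "\<And>\<phi> b. \<phi> \<in> dual \<Longrightarrow> ten \<mu> \<phi> (\<alpha> b) = \<phi> 1 * \<mu> b"
proof -
  have \<alpha>: "star_hom \<alpha>" "\<alpha> 1 = 1" and coact: "coaction_identity \<Delta> \<alpha>"
    using act by (auto simp: quantum_group_action_def unital_star_hom_def)
  note coaction = coaction_convolution[OF coact \<alpha>(1) star_hom_comult[OF cqg], folded conv_def]
  note [simp] = states_dual[OF h] statesD(2)[OF h]
  have act_dual: "(\<lambda>b. ten f \<phi> (\<alpha> b)) \<in> dual" if "f \<in> dual" "\<phi> \<in> dual" for f \<phi>
    by (rule dual_pullback[OF ten_dual[OF that] \<alpha>(1)])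
  obtain E where E: "\<And>f b. f \<in> dual \<Longrightarrow> ten f h (\<alpha> b) = f (E b)"
    using slice_exists[OF h, of "\<alpha> _"] by metis
  have "\<alpha> (E b) = E b \<otimes> 1" for b
  proof -
    have "ten f \<phi> (\<alpha> (E b) - E b \<otimes> 1) = 0" if "f \<in> pos_fun" "\<phi> \<in> pos_fun" for f \<phi>
    proof -
      note [simp] = dual.pos[OF that(1)] dual.pos[OF that(2)]
      have "ten f \<phi> (\<alpha> (E b)) = ten (\<lambda>b. ten f \<phi> (\<alpha> b)) h (\<alpha> b)"
        by (simp add: E act_dual)
      also have "\<dots> = ten f (\<lambda>a. \<phi> 1 * h a) (\<alpha> b)" by (simp add: coaction left)
      also have "\<dots> = ten f \<phi> (E b \<otimes> 1)" by (simp add: ten_scale_right E)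
      finally show ?thesis by (simp add: dual_diff ten_dual)
    qed
    then show ?thesis using tensor_separation[of "\<alpha> (E b) - E b \<otimes> 1"] by auto
  qed
  then have "E b \<in> {c *\<^sub>C 1 |c. True}" for b using erg by (auto simp: ergodic_def)
  then have "\<exists>c. E b = c *\<^sub>C 1" for b by blast
  then obtain \<mu> where \<mu>: "\<And>b. E b = \<mu> b *\<^sub>C 1" by metis
  have act_h: "ten f h (\<alpha> b) = f 1 * \<mu> b" if "f \<in> dual" for f b
    using E[OF that] by (simp add: \<mu> dual_scaleC[OF that])
  \<comment> \<open>\<open>E b\<close> is constant, so any point, here \<open>undefined\<close>,
    yields the same functional. Writing \<mu> through an evaluation shows that it is a
    state.\<close>
  define ev where "ev = (\<lambda>b :: 'x \<Rightarrow>\<^sub>C complex. b undefined)"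
  have ev: "ev \<in> states" unfolding ev_def by (rule eval_states)
  have \<mu>_ev: "\<mu> = (\<lambda>b. ten ev h (\<alpha> b))" using act_h[OF states_dual[OF ev]] statesD(2)[OF ev] by simp
  have "\<mu> \<in> states" unfolding \<mu>_ev
    by (rule states_pullback[OF ten_states[OF ev h] \<alpha>])
  moreover have "ten \<mu> \<phi> (\<alpha> b) = \<phi> 1 * \<mu> b" if "\<phi> \<in> dual" for \<phi> b
    using that unfolding \<mu>_ev by (simp add: coaction states_dual[OF ev] right ten_scale_right)
  ultimately show thesis using act_h that by blast
qed

text \<open>\<open>ev\<close> is a character, so under \<open>ten ev \<phi>\<close> a factor
  \<open>b \<otimes> 1\<close> acts as the scalar \<open>b y\<close> even in the middle of a
  product.\<close>

lemma eval_tensor_central: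
  fixes b :: "'x::topological_space \<Rightarrow>\<^sub>C complex" and y :: 'x
  defines "ev \<equiv> \<lambda>b :: 'x \<Rightarrow>\<^sub>C complex. b y"
  assumes \<phi>: "\<phi> \<in> dual"
  shows "ten ev \<phi> (s * ((b \<otimes> 1) * t)) = b y * ten ev \<phi> (s * t)"
proof -
  have ev: "ev \<in> dual" unfolding ev_def by (rule eval_dual)
  note bl = bounded_linear_compose[OF bounded_linear_ten[OF ev \<phi>]]
  have "(\<lambda>s. ten ev \<phi> (s * ((b \<otimes> 1) * t))) = (\<lambda>s. b y * ten ev \<phi> (s * t))"
  proof (rule tensor_extension_unique)
    fix c a
    have "(\<lambda>t. ten ev \<phi> ((c \<otimes> a) * ((b \<otimes> 1) * t))) = (\<lambda>t. b y * ten ev \<phi> ((c \<otimes> a) * t))"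
    proof (rule tensor_extension_unique)
      show "bounded_linear (\<lambda>t. ten ev \<phi> ((c \<otimes> a) * ((b \<otimes> 1) * t)))"
        by (intro bl bounded_linear_compose[OF bounded_linear_mult_right] bounded_linear_mult_right)
      show "bounded_linear (\<lambda>t. b y * ten ev \<phi> ((c \<otimes> a) * t))"
        by (intro bounded_linear_const_mult bl bounded_linear_mult_right)
    qed (simp add: tens_simps ev \<phi>, simp add: ev_def apply_cstar_bcontfun mult_ac)
    then show "ten ev \<phi> ((c \<otimes> a) * ((b \<otimes> 1) * t)) = b y * ten ev \<phi> ((c \<otimes> a) * t)"
      by (rule fun_cong)
  next
    show "bounded_linear (\<lambda>s. ten ev \<phi> (s * ((b \<otimes> 1) * t)))"
      by (intro bl bounded_linear_mult_left)
    show "bounded_linear (\<lambda>s. b y * ten ev \<phi> (s * t))"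
      by (intro bounded_linear_const_mult bl bounded_linear_mult_left)
  qed
  then show ?thesis by (rule fun_cong)
qed

text \<open>\<open>\<phi>\<close> arises by compressing \<open>ev \<otimes> h\<close> with the projection \<open>p\<close>.\<close>

lemma eval_tensor_compression:
  fixes p :: "('x::topological_space \<Rightarrow>\<^sub>C complex) \<otimes> 'a::cstar_algebra" and y :: 'x
  defines "ev \<equiv> \<lambda>b :: 'x \<Rightarrow>\<^sub>C complex. b y"
  assumes p: "p * p = p" "star p = p" and h: "h \<in> states" and nz: "ten ev h p \<noteq> 0"
  obtains \<phi> where "\<phi> \<in> states" "ten ev \<phi> p = 1"
proof -
  have ev: "ev \<in> states" unfolding ev_def by (rule eval_states)
  have L: "ten ev h \<in> pos_fun" by (intro statesD ten_states ev h)
  define v where "v = Re (ten ev h p)"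
  have v: "ten ev h p = complex_of_real v" "0 < v"
    using pos_fun_nonneg[OF L, of p] p nz by (auto simp: v_def less_le)
  define M where "M t = complex_of_real (1 / v) * ten ev h (star p * t * p)" for t
  have M: "M \<in> pos_fun"
    unfolding M_def using v by (intro pos_fun_scale pos_fun_conj L) auto
  have "M 1 = 1" using v by (simp add: M_def p)
  define \<phi> where "\<phi> a = M (1 \<otimes> a)" for a
  have \<phi>: "\<phi> \<in> states"
    using pos_fun_pullback[OF M star_hom_tens_right] \<open>M 1 = 1\<close> by (simp add: states_def \<phi>_def[abs_def] tens_simps)
  \<comment> \<open>The factor \<open>b \<otimes> 1\<close> leaves the compression as the scalar
    \<open>b y\<close>, so the compressed functional still has \<open>ev\<close> in its first
    leg.\<close>
  have "ten ev \<phi> = M"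
  proof (rule ten_eqI)
    show "bounded_linear M" by (rule dual_bounded_linear[OF dual.pos[OF M]])
    fix b a
    have "star p * (b \<otimes> a) * p = p * ((b \<otimes> 1) * ((1 \<otimes> a) * p))"
      by (simp add: p tens_simps mult.assoc flip: mult.assoc[of "_ \<otimes> _" "_ \<otimes> _"])
    then show "M (b \<otimes> a) = ev b * \<phi> a"
      using eval_tensor_central[OF states_dual[OF h], of y p b "(1 \<otimes> a) * p"]
      by (simp add: M_def \<phi>_def p mult.assoc ev_def)
  qed
  moreover have "M p = 1" using v by (simp add: M_def p)
  ultimately show thesis using that[OF \<phi>] by simp
qed

section \<open>Positivity and clopen sets in C(X)\<close>

lemma pos_fun_nonneg_bcontfun:
  fixes f :: "'x::topological_space \<Rightarrow>\<^sub>C complex"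
  assumes \<phi>: "\<phi> \<in> pos_fun" and f: "\<And>x. Im (f x) = 0" "\<And>x. 0 \<le> Re (f x)"
  shows "0 \<le> Re (\<phi> f)"
proof -
  define g where "g = Bcontfun (\<lambda>x. complex_of_real (sqrt (Re (f x))))"
  have g: "apply_bcontfun g = (\<lambda>x. complex_of_real (sqrt (Re (f x))))"
    unfolding g_def
  proof (rule apply_Bcontfun)
    show "continuous_on UNIV (\<lambda>x. complex_of_real (sqrt (Re (f x))))"
      by (intro continuous_intros continuous_on_apply_bcontfun)
    show "norm (complex_of_real (sqrt (Re (f x)))) \<le> sqrt (norm f)" for x
      using f(2)[of x] order_trans[OF complex_Re_le_cmod norm_bounded, of f x] by simp
  qed
  have "f = star g * g"
    by (rule bcontfun_eqI)
      (simp add: apply_cstar_bcontfun g star_complex_def complex_eq_iff f flip: of_real_mult)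
  then show ?thesis using pos_fun_nonneg(2)[OF \<phi>, of g] by simp
qed

lemma pos_fun_mono_bcontfun:
  fixes f g :: "'x::topological_space \<Rightarrow>\<^sub>C complex"
  assumes \<phi>: "\<phi> \<in> pos_fun" and "\<And>x. Im (f x) = 0" "\<And>x. Im (g x) = 0" "\<And>x. Re (f x) \<le> Re (g x)"
  shows "Re (\<phi> f) \<le> Re (\<phi> g)"
  using pos_fun_nonneg_bcontfun[OF \<phi>, of "g - f"] assms by (simp add: pos_fun_diff[OF \<phi>])

definition ind :: "'x::topological_space set \<Rightarrow> 'x \<Rightarrow>\<^sub>C complex" where
  "ind U = Bcontfun (\<lambda>x. if x \<in> U then 1 else 0)"

lemma apply_ind:
  assumes "open U" "closed U"
  shows "apply_bcontfun (ind U) = (\<lambda>x. if x \<in> U then 1 else 0)"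
  unfolding ind_def
proof (rule apply_Bcontfun[where b = 1])
  have "continuous_on (U \<union> - U) (\<lambda>x. if x \<in> U then 1 else 0 :: complex)"
    by (rule continuous_on_cases) (use assms in auto)
  then show "continuous_on UNIV (\<lambda>x. if x \<in> U then 1 else 0 :: complex)" by simp
qed simp

lemma ind_projection:
  assumes "open U" "closed U"
  shows "ind U * ind U = ind U" "star (ind U) = ind U"
  by (rule bcontfun_eqI; simp add: apply_cstar_bcontfun apply_ind[OF assms] star_complex_def)+

text \<open>An Urysohn function on a countable space omits a value in \<open>(0, 1)\<close>, at which it can be cut.\<close>

lemma clopen_neighbourhood:
  fixes y :: "'x::t2_space"
  assumes X: "compact (UNIV :: 'x set)" "countable (UNIV :: 'x set)" and W: "open W" "y \<in> W"
  obtains U where "open U" "closed U" "y \<in> U" "U \<subseteq> W"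
proof -
  have "Hausdorff_space (euclidean :: 'x topology)"
    unfolding Hausdorff_space_def disjnt_def using hausdorff by (metis open_openin)
  moreover have "compact_space (euclidean :: 'x topology)"
    using X by (simp add: compact_space_def compactin_euclidean_iff)
  ultimately have "normal_space (euclidean :: 'x topology)"
    by (intro compact_Hausdorff_or_regular_imp_normal_space) auto
  moreover have "closedin euclidean {y}" "closedin euclidean (- W)" "disjnt {y} (- W)"
    using W by (auto simp: disjnt_def)
  ultimately obtain f :: "'x \<Rightarrow> real" where f: "continuous_map euclidean euclideanreal f"
      "f ` {y} \<subseteq> {0}" "f ` (- W) \<subseteq> {1}"
    by (rule Urysohn_lemma_alt)
  then have cont: "continuous_on UNIV f" by simp
  have "countable (range f)" using X by simp
  then have "\<not> {0<..<1} \<subseteq> range f"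
    using countable_subset uncountable_open_interval[of 0 "1::real"] by auto
  then obtain r where "r \<in> {0<..<1}" and r_range: "r \<notin> range f" by blast
  then have r: "0 < r" "r < 1" by auto
  show thesis
  proof (rule that)
    show "open {x. f x < r}" by (intro open_Collect_less cont continuous_on_const)
    have "{x. f x < r} = {x. f x \<le> r}" using r_range by (auto simp: less_le)
    then show "closed {x. f x < r}" by (simp add: closed_Collect_le cont)
    show "y \<in> {x. f x < r}" using f(2) r by auto
    show "{x. f x < r} \<subseteq> W" using f(3) r by force
  qed
qed

subsection \<open>States on \<open>C(X)\<close> for countable \<open>X\<close>\<close>

lemma dual_bump_functions:
  fixes F :: "'x::t2_space set"
  assumes X: "compact (UNIV :: 'x set)" "countable (UNIV :: 'x set)" and "finite F"
  obtains e :: "'x \<Rightarrow> 'x \<Rightarrow>\<^sub>C complex" where "\<And>i k. i \<in> F \<Longrightarrow> k \<in> F \<Longrightarrow> e i k = (if i = k then 1 else 0)"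
    "\<And>i x. e i x \<in> {0, 1}"
proof -
  have "\<exists>U. open U \<and> closed U \<and> i \<in> U \<and> U \<subseteq> - (F - {i})" for i
  proof -
    have "open (- (F - {i}))" by (rule open_Compl[OF finite_imp_closed]) (use assms in simp)
    then show ?thesis by (rule clopen_neighbourhood[OF X, of _ i]) auto
  qed
  then obtain U where U: "\<And>i. open (U i)" "\<And>i. closed (U i)" "\<And>i. i \<in> U i" "\<And>i. U i \<subseteq> - (F - {i})"
    by metis
  show thesis
    by (rule that[of "\<lambda>i. ind (U i)"]) (use U(3,4) in \<open>auto simp: apply_ind U(1,2)\<close>)
qed

context
  fixes \<mu> :: "('x::t2_space \<Rightarrow>\<^sub>C complex) \<Rightarrow> complex"
  assumes X: "compact (UNIV :: 'x set)" "countable (UNIV :: 'x set)" and \<mu>: "\<mu> \<in> states"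
begin

text \<open>The measure of the point y under the Radon measure representing \<mu>, by outer
  regularity; clopen sets form a base of X.\<close>

definition mass :: "'x \<Rightarrow> real" where
  "mass y = Inf {Re (\<mu> (ind U)) |U. open U \<and> closed U \<and> y \<in> U}"

lemma Re_ind_nonneg: "open U \<Longrightarrow> closed U \<Longrightarrow> 0 \<le> Re (\<mu> (ind U))"
  by (rule pos_fun_nonneg_bcontfun[OF statesD(1)[OF \<mu>]]) (auto simp: apply_ind)

lemma mass_le: "open U \<Longrightarrow> closed U \<Longrightarrow> y \<in> U \<Longrightarrow> mass y \<le> Re (\<mu> (ind U))"
  unfolding mass_def by (rule cInf_lower) (auto intro!: bdd_belowI[of _ 0] Re_ind_nonneg)

lemma mass_geI: "(\<And>U. open U \<Longrightarrow> closed U \<Longrightarrow> y \<in> U \<Longrightarrow> m \<le> Re (\<mu> (ind U))) \<Longrightarrow> m \<le> mass y"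
  unfolding mass_def by (rule cInf_greatest) (auto intro!: exI[of _ UNIV])

lemma mass_nonneg: "0 \<le> mass y"
  by (rule mass_geI) (rule Re_ind_nonneg)

lemma mass_approx:
  assumes "0 < e"
  obtains U where "open U" "closed U" "y \<in> U" "Re (\<mu> (ind U)) < mass y + e"
proof -
  have "\<not> mass y + e \<le> mass y" using assms by simp
  then show thesis using mass_geI[of y "mass y + e"] that by force
qed

text \<open>For \<open>r < f(y)\<close> some clopen neighbourhood V of y has
  \<open>r 1\<^sub>V \<le> f\<close>; then r tends to \<open>f(y)\<close>.\<close>

lemma mass_times_value_le:
  assumes f: "\<And>x. Im (apply_bcontfun f x) = 0" "\<And>x. 0 \<le> Re (apply_bcontfun f x)"
  shows "mass y * Re (f y) \<le> Re (\<mu> f)"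
proof -
  have \<mu>p: "\<mu> \<in> pos_fun" by (rule statesD(1)[OF \<mu>])
  have key: "r * mass y \<le> Re (\<mu> f)" if r: "0 \<le> r" "r < Re (f y)" for r
  proof -
    have "open {x. r < Re (f x)}"
      by (intro open_Collect_less continuous_intros continuous_on_apply_bcontfun)
    then obtain V where V: "open V" "closed V" "y \<in> V" "V \<subseteq> {x. r < Re (f x)}"
      using clopen_neighbourhood[OF X, of "{x. r < Re (f x)}" y] r by auto
    have "r * mass y \<le> r * Re (\<mu> (ind V))"
      using mass_le[OF V(1-3)] r by (intro mult_left_mono)
    also have "\<dots> = Re (\<mu> (complex_of_real r *\<^sub>C ind V))" by (simp add: pos_fun_scaleC[OF \<mu>p])
    also have "\<dots> \<le> Re (\<mu> f)"
      by (rule pos_fun_mono_bcontfun[OF \<mu>p])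
        (use V(4) f in \<open>auto simp: apply_ind[OF V(1,2)] apply_cstar_bcontfun scaleC_complex_def less_imp_le\<close>)
    finally show ?thesis .
  qed
  show ?thesis
  proof (cases "Re (f y) = 0")
    case True
    then show ?thesis using pos_fun_nonneg_bcontfun[OF \<mu>p f] by simp
  next
    case False
    then have pos: "0 < Re (f y)" using f(2)[of y] by simp
    have "((\<lambda>r. r * mass y) \<longlongrightarrow> Re (f y) * mass y) (at_left (Re (f y)))"
      by (intro tendsto_intros)
    moreover have "\<forall>\<^sub>F r in at_left (Re (f y)). r * mass y \<le> Re (\<mu> f)"
      unfolding eventually_at_left_field using key pos by (intro exI[of _ 0]) auto
    ultimately show ?thesis
      by (simp add: mult.commute tendsto_upperbound trivial_limit_at_left_real)
  qed
qed

text \<open>A clopen set containing the new point and avoiding the old ones splits f into two parts,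
  one for the one-point bound and one for the induction hypothesis.\<close>

lemma sum_mass_le:
  assumes "finite F" and "\<And>x. Im (apply_bcontfun f x) = 0" "\<And>x. 0 \<le> Re (apply_bcontfun f x)"
  shows "(\<Sum>k\<in>F. mass k * Re (f k)) \<le> Re (\<mu> f)"
  using assms
proof (induction F arbitrary: f rule: finite_induct)
  case empty
  then show ?case using pos_fun_nonneg_bcontfun[OF statesD(1)[OF \<mu>], of f] by simp
next
  case (insert z F)
  have "open (- F)" using insert by (simp add: finite_imp_closed open_Compl)
  then obtain U where U: "open U" "closed U" "z \<in> U" "U \<subseteq> - F"
    using clopen_neighbourhood[OF X, of "- F" z] insert by auto
  note val = apply_cstar_bcontfun apply_ind[OF U(1,2)]
  let ?g = "f * ind U" and ?h = "f * (1 - ind U)"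
  have "mass z * Re (?g z) \<le> Re (\<mu> ?g)"
    by (rule mass_times_value_le) (use insert.prems in \<open>auto simp: val\<close>)
  moreover have "(\<Sum>k\<in>F. mass k * Re (?h k)) \<le> Re (\<mu> ?h)"
    by (rule insert.IH) (use insert.prems in \<open>auto simp: val\<close>)
  moreover have "(\<Sum>k\<in>F. mass k * Re (?h k)) = (\<Sum>k\<in>F. mass k * Re (f k))"
    using U(4) by (intro sum.cong) (auto simp: val)
  moreover have "?g z = f z" using U(3) by (simp add: val)
  moreover have "f = ?g + ?h" by (simp add: algebra_simps)
  then have "\<mu> f = \<mu> ?g + \<mu> ?h" using pos_fun_plus[OF statesD(1)[OF \<mu>]] by metis
  ultimately show ?case using insert.hyps by simp
qed

text \<open>Countable additivity: cover \<open>X\<close> by neighbourhoods whose measures exceed the masses of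
  their centres by a summable amount.\<close>

lemma one_le_sum_mass:
  assumes F: "finite F" "\<And>y. 0 < mass y \<Longrightarrow> y \<in> F"
  shows "1 \<le> (\<Sum>k\<in>F. mass k)"
proof (rule field_le_epsilon)
  fix e :: real assume e: "0 < e"
  define n where "n = to_nat_on (UNIV :: 'x set)"
  have inj: "inj n" unfolding n_def by (rule inj_on_to_nat_on[OF X(2)])
  define d where "d y = e * (1/2) ^ Suc (n y)" for y
  have "0 < d y" for y using e by (simp add: d_def)
  then have "\<exists>U. open U \<and> closed U \<and> y \<in> U \<and> Re (\<mu> (ind U)) < mass y + d y" for y
    using mass_approx[of "d y" y] by metis
  then obtain V where V: "\<And>y. open (V y)" "\<And>y. closed (V y)" "\<And>y. y \<in> V y"
      "\<And>y. Re (\<mu> (ind (V y))) < mass y + d y" by metis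
  obtain S where S: "finite S" "UNIV \<subseteq> (\<Union>y\<in>S. V y)"
    using compactE_image[OF X(1), of UNIV V] V by (metis UNIV_I UN_I subsetI)
  have app: "apply_bcontfun (\<Sum>y\<in>S. ind (V y)) x = (\<Sum>y\<in>S. apply_bcontfun (ind (V y)) x)" for x
    using S(1) by (induction S rule: finite_induct) simp_all
  have "1 = Re (\<mu> 1)" by (simp add: statesD(2)[OF \<mu>])
  also have "\<dots> \<le> Re (\<mu> (\<Sum>y\<in>S. ind (V y)))"
  proof (rule pos_fun_mono_bcontfun[OF statesD(1)[OF \<mu>]])
    fix x
    obtain y where y: "y \<in> S" "x \<in> V y" using S(2) by blast
    have "(1::real) = (if x \<in> V y then 1 else 0)" using y by simp
    also have "\<dots> \<le> (\<Sum>y\<in>S. if x \<in> V y then 1 else 0)"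
      by (rule member_le_sum[OF y(1), of "\<lambda>y. if x \<in> V y then 1 else 0"]) (use S in auto)
    also have "\<dots> = Re ((\<Sum>y\<in>S. ind (V y)) x)"
      unfolding app Re_sum by (intro sum.cong) (auto simp: apply_ind V)
    finally show "Re ((1 :: 'x \<Rightarrow>\<^sub>C complex) x) \<le> Re ((\<Sum>y\<in>S. ind (V y)) x)"
      by (simp add: apply_one_bcontfun)
  qed (auto simp: app apply_one_bcontfun apply_ind V intro!: sum.neutral)
  also have "\<dots> = (\<Sum>y\<in>S. Re (\<mu> (ind (V y))))"
    by (simp add: pos_fun_sum_arg[OF statesD(1)[OF \<mu>]])
  also have "\<dots> \<le> (\<Sum>y\<in>S. mass y + d y)" by (intro sum_mono less_imp_le V)
  also have "\<dots> = (\<Sum>y\<in>S. mass y) + (\<Sum>y\<in>S. d y)" by (rule sum.distrib)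
  also have "(\<Sum>y\<in>S. d y) \<le> e"
  proof -
    have "(\<Sum>y\<in>S. d y) = e * (\<Sum>m\<in>n ` S. (1/2) ^ Suc m)"
      using inj by (simp add: d_def sum_distrib_left sum.reindex[OF inj_on_subset[OF inj]])
    also have "(\<Sum>m\<in>n ` S. (1/2) ^ Suc m) \<le> (1::real)"
      using sum_le_suminf[OF sums_summable[OF power_half_series], of "n ` S"] S(1)
        sums_unique[OF power_half_series] by simp
    finally show ?thesis using e by simp
  qed
  also have "(\<Sum>y\<in>S. mass y) \<le> (\<Sum>y\<in>F. mass y)"
  proof -
    have "(\<Sum>y\<in>S. mass y) = (\<Sum>y\<in>S \<inter> F. mass y)"
      using S(1) F(2) mass_nonneg by (intro sum.mono_neutral_right) (auto simp: less_le)
    also have "\<dots> \<le> (\<Sum>y\<in>F. mass y)"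
      using F(1) mass_nonneg by (intro sum_mono2) auto
    finally show ?thesis .
  qed
  finally show "1 \<le> (\<Sum>k\<in>F. mass k) + e" by simp
qed

text \<open>By hypothesis the mass of any point is a lower bound for every clopen neighbourhood of
  an atom, hence for the mass of that atom. All atoms therefore have the same mass M.\<close>

lemma uniform_finite_support:
  assumes dich: "\<And>y U. open U \<Longrightarrow> closed U \<Longrightarrow> 0 < Re (\<mu> (ind U)) \<Longrightarrow> mass y \<le> Re (\<mu> (ind U))"
  obtains F M where "finite F" "M * real (card F) = 1" "\<And>f. \<mu> f = complex_of_real M * (\<Sum>k\<in>F. apply_bcontfun f k)"
proof -
  have \<mu>p: "\<mu> \<in> pos_fun" by (rule statesD(1)[OF \<mu>])
  define F where "F = {y. 0 < mass y}"
  have "mass y \<le> mass z" if "z \<in> F" for y z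
  proof (rule mass_geI)
    fix U assume U: "open U" "closed U" "z \<in> U"
    then have "0 < Re (\<mu> (ind U))" using that mass_le[of U z] by (simp add: F_def)
    then show "mass y \<le> Re (\<mu> (ind U))" using dich U by blast
  qed
  then obtain M where M: "\<And>y. y \<in> F \<Longrightarrow> mass y = M" by (metis antisym)
  have one: "(\<Sum>k\<in>G. mass k) \<le> 1" if "finite G" for G
    using sum_mass_le[OF that, of 1] by (simp add: apply_one_bcontfun statesD(2)[OF \<mu>])
  have fin: "finite F"
  proof (rule ccontr)
    assume inf: "infinite F"
    then obtain y where y: "y \<in> F" by fastforce
    have "0 < mass y" using y by (simp add: F_def)
    then have "0 < M" using M[OF y] by simp
    obtain N :: nat where N: "1 / M < real N" using reals_Archimedean2 by blast
    obtain G where G: "G \<subseteq> F" "finite G" "card G = N" using infinite_arbitrarily_large[OF inf] by metis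
    have "(\<Sum>k\<in>G. mass k) = (\<Sum>k\<in>G. M)" using G(1) M by (intro sum.cong) auto
    then have "real N * M \<le> 1" using one[OF G(2)] G(3) by simp
    then show False using N \<open>0 < M\<close> by (simp add: field_simps)
  qed
  have sumF: "(\<Sum>k\<in>F. mass k) = 1"
    using one[OF fin] one_le_sum_mass[OF fin] by (simp add: F_def)
  have "(\<Sum>k\<in>F. mass k) = M * real (card F)" using M by simp
  with sumF have MF: "M * real (card F) = 1" by simp
  have nonneg: "Re (\<mu> f) = M * (\<Sum>k\<in>F. Re (apply_bcontfun f k))"
    if f: "\<And>x. Im (apply_bcontfun f x) = 0" "\<And>x. 0 \<le> Re (apply_bcontfun f x)" for f
  proof -
    have eq: "(\<Sum>k\<in>F. mass k * Re (g k)) = M * (\<Sum>k\<in>F. Re (g k))" for g :: "'x \<Rightarrow>\<^sub>C complex"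
      using M by (simp add: sum_distrib_left)
    \<comment> \<open>The lower bound \<open>sum_mass_le\<close> for \<open>norm f - f\<close> is an
      upper bound for f, because the masses on F add up to 1.\<close>
    let ?g = "complex_of_real (norm f) *\<^sub>C 1 - f"
    have "(\<Sum>k\<in>F. mass k * Re (?g k)) \<le> Re (\<mu> ?g)"
      by (rule sum_mass_le[OF fin])
        (use order_trans[OF complex_Re_le_cmod norm_bounded] f in
          \<open>auto simp: apply_cstar_bcontfun scaleC_complex_def\<close>)
    moreover have "Re (\<mu> ?g) = norm f - Re (\<mu> f)"
      by (simp add: pos_fun_diff[OF \<mu>p] pos_fun_scaleC[OF \<mu>p] statesD(2)[OF \<mu>])
    moreover have "(\<Sum>k\<in>F. mass k * Re (?g k)) = norm f * 1 - (\<Sum>k\<in>F. mass k * Re (f k))"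
      unfolding sumF[symmetric] sum_distrib_left sum_subtractf[symmetric]
      by (intro sum.cong) (simp_all add: apply_cstar_bcontfun scaleC_complex_def algebra_simps)
    ultimately show ?thesis using sum_mass_le[OF fin f] eq[of f] by simp
  qed
  obtain e :: "'x \<Rightarrow> 'x \<Rightarrow>\<^sub>C complex" where e: "\<And>i k. i \<in> F \<Longrightarrow> k \<in> F \<Longrightarrow> e i k = (if i = k then 1 else 0)"
    and e01: "\<And>i x. e i x \<in> {0, 1}"
    using dual_bump_functions[OF X fin] by blast
  have "\<mu> f = complex_of_real M * (\<Sum>k\<in>F. f k)" for f
  proof -
    \<comment> \<open>n vanishes on F, so \<mu> kills \<open>star n * n\<close> by the nonnegative
      case and n by Cauchy-Schwarz. A combination of the bumps \<open>e i\<close> remains, whatever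
      the complex values of f.\<close>
    define n where "n = f - (\<Sum>i\<in>F. f i *\<^sub>C e i)"
    have app: "apply_bcontfun (\<Sum>i\<in>G. f i *\<^sub>C e i) x = (\<Sum>i\<in>G. f i * e i x)" if "finite G" for G x
      using that by (induction G rule: finite_induct) (simp_all add: apply_cstar_bcontfun scaleC_complex_def)
    have n0: "n k = 0" if "k \<in> F" for k
    proof -
      have "(\<Sum>i\<in>F. f i * e i k) = (\<Sum>i\<in>F. if i = k then f i else 0)"
        using e[OF _ that] by (intro sum.cong) auto
      then show ?thesis using that fin by (simp add: n_def app[OF fin])
    qed
    have val: "apply_bcontfun (star n * n) x = complex_of_real ((cmod (n x))\<^sup>2)" for x
      by (simp add: apply_cstar_bcontfun star_complex_def mult.commute complex_norm_square[symmetric])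
    have "Re (\<mu> (star n * n)) = M * (\<Sum>k\<in>F. Re ((star n * n) k))"
      by (rule nonneg) (simp_all only: val Im_complex_of_real Re_complex_of_real zero_le_power2)
    also have "\<dots> = 0" by (simp add: val n0)
    finally have "(cmod (\<mu> (star 1 * n)))\<^sup>2 \<le> 0"
      using pos_fun_Cauchy_Schwarz[OF \<mu>p, of 1 n] by simp
    then have "\<mu> n = 0" by simp
    have \<mu>e: "\<mu> (e i) = complex_of_real M" if i: "i \<in> F" for i
    proof -
      have real: "Im (e i x) = 0" "0 \<le> Re (e i x)" for x using e01[of i x] by auto
      have "Re (\<mu> (e i)) = M * (\<Sum>k\<in>F. Re (e i k))" by (rule nonneg[OF real])
      also have "(\<Sum>k\<in>F. Re (e i k)) = (\<Sum>k\<in>F. if i = k then 1 else 0)"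
        using e[OF i] by (intro sum.cong) auto
      finally have "Re (\<mu> (e i)) = M" using i fin by simp
      moreover have "star (e i) = e i"
        by (rule bcontfun_eqI) (simp add: apply_cstar_bcontfun star_complex_def complex_eq_iff real)
      then have "Im (\<mu> (e i)) = 0" using pos_fun_star[OF \<mu>p, of "e i"] by (simp add: complex_eq_iff)
      ultimately show ?thesis by (simp add: complex_eq_iff)
    qed
    have "f = n + (\<Sum>i\<in>F. f i *\<^sub>C e i)" by (simp add: n_def)
    then have "\<mu> f = \<mu> n + \<mu> (\<Sum>i\<in>F. f i *\<^sub>C e i)" using pos_fun_plus[OF \<mu>p] by metis
    also have "\<dots> = (\<Sum>i\<in>F. f i * complex_of_real M)"
      by (simp add: \<open>\<mu> n = 0\<close> pos_fun_sum_arg[OF \<mu>p] pos_fun_scaleC[OF \<mu>p] \<mu>e)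
    finally show ?thesis by (simp add: sum_distrib_left mult.commute)
  qed
  with fin MF show thesis by (rule that)
qed

end

subsection \<open>The invariant state determines the space\<close>

text \<open>Write \<open>u\<^sub>k\<^sub>i\<close> for the value of \<open>\<alpha> (e i)\<close> at \<open>k\<close> and \<open>v\<^sub>i\<close> for its value at \<open>y\<close>. Then
  \<open>\<chi>\<^sub>c x = h (v\<^sub>c x)\<close> and \<open>G k = \<Sum>\<^sub>i h (v\<^sub>i u\<^sub>k\<^sub>i)\<close>. The proof rests on strong invariance in
  the form \<open>1 \<otimes> u\<^sub>i\<^sub>j = \<Sum>\<^sub>k (u\<^sub>k\<^sub>i \<otimes> 1) \<Delta>(u\<^sub>k\<^sub>j)\<close>, which holds since \<open>\<Sum>\<^sub>k u\<^sub>k\<^sub>i = 1\<close>.\<close>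

lemma evaluations_spanned_by_support:
  fixes \<Delta> :: "'a::cstar_algebra \<Rightarrow> 'a \<otimes> 'a"
    and \<alpha> :: "('x::topological_space \<Rightarrow>\<^sub>C complex) \<Rightarrow> ('x \<Rightarrow>\<^sub>C complex) \<otimes> 'a"
    and e :: "'x \<Rightarrow> 'x \<Rightarrow>\<^sub>C complex"
  assumes cqg: "compact_quantum_group \<Delta>" and act: "quantum_group_action \<Delta> \<alpha>"
    and h: "h \<in> states" and left: "\<And>\<phi>. \<phi> \<in> dual \<Longrightarrow> conv \<Delta> \<phi> h = (\<lambda>a. \<phi> 1 * h a)"
    and act_h: "\<And>f b. f \<in> dual \<Longrightarrow> ten f h (\<alpha> b) = f 1 * \<mu> b"
    and \<mu>_inv: "\<And>\<phi> b. \<phi> \<in> dual \<Longrightarrow> ten \<mu> \<phi> (\<alpha> b) = \<phi> 1 * \<mu> b"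
    and F: "finite F" and M: "M \<noteq> 0" and \<mu>: "\<And>f. \<mu> f = M * (\<Sum>k\<in>F. apply_bcontfun f k)"
    and e: "\<And>i k. i \<in> F \<Longrightarrow> k \<in> F \<Longrightarrow> e i k = (if i = k then 1 else 0)"
  shows "\<exists>G. \<forall>c :: 'x \<Rightarrow>\<^sub>C complex. c y = (\<Sum>k\<in>F. G k * c k)"
proof -
  define ev where "ev k = (\<lambda>b :: 'x \<Rightarrow>\<^sub>C complex. b k)" for k
  have ev_dual [simp]: "ev k \<in> dual" for k unfolding ev_def by (rule eval_dual)
  have ev_mult: "ev k (b * c) = ev k b * ev k c" and ev_one: "ev k 1 = 1" for k b c
    by (simp_all add: ev_def apply_cstar_bcontfun)
  note [simp] = states_dual[OF h] statesD(2)[OF h]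
  have \<alpha>: "star_hom \<alpha>" and coact: "coaction_identity \<Delta> \<alpha>"
    and dense: "closure (cspan {\<alpha> b * (1 \<otimes> a) |a b. True}) = UNIV"
    using act by (auto simp: quantum_group_action_def unital_star_hom_def)
  obtain \<alpha>_id id_\<Delta> asc where m: "is_tensor_map \<alpha> (id :: 'a \<Rightarrow> 'a) \<alpha>_id" "is_tensor_map id \<Delta> id_\<Delta>"
      "is_tensor_assoc asc" and coaction: "\<And>b. asc (\<alpha>_id (\<alpha> b)) = id_\<Delta> (\<alpha> b)"
    using coact unfolding coaction_identity_def by blast
  have bl: "bounded_linear \<alpha>_id" "bounded_linear id_\<Delta>" "bounded_linear asc"
    and el: "\<And>b a. \<alpha>_id (b \<otimes> a) = \<alpha> b \<otimes> a" "\<And>b a. id_\<Delta> (b \<otimes> a) = b \<otimes> \<Delta> a"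
      "\<And>b a d. asc ((b \<otimes> a) \<otimes> d) = b \<otimes> (a \<otimes> d)"
    using m by (auto simp: is_tensor_map_def is_tensor_assoc_def)
  note asc_tens = bounded_linear_compose[OF bl(3) bounded_linear_tens_left]
  note \<Delta>_hom = star_homD[OF star_hom_comult[OF cqg]]
  have h_conv: "ten \<phi> h (\<Delta> a) = \<phi> 1 * h a" if "\<phi> \<in> dual" for \<phi> a
    using fun_cong[OF left[OF that], of a] by (simp add: conv_def)

  define Ch where "Ch p = (\<lambda>x. ten (ev y) h (p * (1 \<otimes> x)))" for p
  have Ch_dual [simp]: "Ch p \<in> dual" for p
    unfolding Ch_def by (intro dual_pullback[OF _ star_hom_tens_right] dual_mult_left ten_dual) auto
  \<comment> \<open>The first factor in Cauchy-Schwarz is \<open>(ev\<^sub>y \<otimes> h)\<alpha>(n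
    star(n)) = \<mu>(n star(n))\<close>, which sees only F although y is arbitrary.\<close>
  have Ch_null: "Ch (\<alpha> n) = (\<lambda>x. 0)" if n: "\<And>k. k \<in> F \<Longrightarrow> ev k n = 0" for n
  proof
    fix x
    have "ten (ev y) h \<in> pos_fun" unfolding ev_def by (intro ten_pos_fun statesD eval_states h)
    from pos_fun_Cauchy_Schwarz_right[OF this, of "\<alpha> n" "1 \<otimes> x"]
    have "(cmod (Ch (\<alpha> n) x))\<^sup>2 \<le> Re (\<mu> (n * star n)) * Re (ten (ev y) h (star (1 \<otimes> x) * (1 \<otimes> x)))"
      by (simp add: Ch_def act_h ev_one flip: star_homD[OF \<alpha>])
    also have "\<mu> (n * star n) = 0"
      using n ev_mult by (simp add: \<mu> ev_def)
    finally show "Ch (\<alpha> n) x = 0" by simp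
  qed
  have Ch_expand: "Ch (\<alpha> c) = (\<lambda>x. \<Sum>i\<in>F. ev i c * Ch (\<alpha> (e i)) x)" for c
  proof
    fix x
    define n where "n = c - (\<Sum>i\<in>F. ev i c *\<^sub>C e i)"
    have "ev k n = 0" if k: "k \<in> F" for k
    proof -
      have "ev k (\<Sum>i\<in>F. ev i c *\<^sub>C e i) = (\<Sum>i\<in>F. ev i c * ev k (e i))"
        by (simp add: dual_sum_arg dual_scaleC)
      also have "\<dots> = (\<Sum>i\<in>F. if i = k then ev i c else 0)"
        using e[OF _ k] by (intro sum.cong) (auto simp: ev_def)
      finally show ?thesis using k F by (simp add: n_def dual_diff)
    qed
    then have zero: "ten (ev y) h (\<alpha> n * (1 \<otimes> x)) = 0"
      using fun_cong[OF Ch_null[of n], of x] by (simp add: Ch_def)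
    define L where "L = (\<lambda>b. ten (ev y) h (\<alpha> b * (1 \<otimes> x)))"
    have L: "L \<in> dual"
      unfolding L_def by (intro dual_pullback[OF _ \<alpha>] dual_mult_right ten_dual) auto
    have "c = n + (\<Sum>i\<in>F. ev i c *\<^sub>C e i)" by (simp add: n_def)
    then have "L c = L n + L (\<Sum>i\<in>F. ev i c *\<^sub>C e i)" using dual_plus[OF L] by metis
    also have "\<dots> = (\<Sum>i\<in>F. ev i c * L (e i))"
      using zero by (simp add: dual_sum_arg[OF L] dual_scaleC[OF L]) (simp add: L_def)
    finally show "Ch (\<alpha> c) x = (\<Sum>i\<in>F. ev i c * Ch (\<alpha> (e i)) x)" by (simp add: L_def Ch_def)
  qed

  \<comment> \<open>The three legs are paired with \<open>ev y\<close>, h and h. Absorbing the first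
    two into \<open>Ch p\<close> leaves a functional on two legs.\<close>
  have A: "ten (ev y) (ten h h) (asc (p \<otimes> d) * (1 \<otimes> w)) = ten (Ch p) h ((1 \<otimes> d) * w)" for p d w
  proof -
    have "(\<lambda>w. ten (ev y) (ten h h) (asc (p \<otimes> d) * (1 \<otimes> w))) = (\<lambda>w. ten (Ch p) h ((1 \<otimes> d) * w))"
    proof (rule tensor_extension_unique)
      fix w1 w2
      have "(\<lambda>p. ten (ev y) (ten h h) (asc (p \<otimes> d) * (1 \<otimes> (w1 \<otimes> w2)))) =
          (\<lambda>p. ten (ev y) h (p * (1 \<otimes> w1)) * h (d * w2))"
      proof (rule tensor_extension_unique)
        show "bounded_linear (\<lambda>p. ten (ev y) (ten h h) (asc (p \<otimes> d) * (1 \<otimes> (w1 \<otimes> w2))))"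
          by (rule bounded_linear_compose[OF bounded_linear_ten
                bounded_linear_compose[OF bounded_linear_mult_left asc_tens]]) (simp_all add: ten_dual)
        show "bounded_linear (\<lambda>p. ten (ev y) h (p * (1 \<otimes> w1)) * h (d * w2))"
          by (rule bounded_linear_mult_const[OF bounded_linear_compose[OF bounded_linear_ten
                bounded_linear_mult_left]]) simp_all
      qed (simp add: el tens_simps ten_dual)
      then have "ten (ev y) (ten h h) (asc (p \<otimes> d) * (1 \<otimes> (w1 \<otimes> w2))) =
          ten (ev y) h (p * (1 \<otimes> w1)) * h (d * w2)" by (rule fun_cong)
      then show "ten (ev y) (ten h h) (asc (p \<otimes> d) * (1 \<otimes> (w1 \<otimes> w2))) =
          ten (Ch p) h ((1 \<otimes> d) * (w1 \<otimes> w2))"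
        by (simp add: tens_simps) (simp add: Ch_def)
    next
      show "bounded_linear (\<lambda>w. ten (ev y) (ten h h) (asc (p \<otimes> d) * (1 \<otimes> w)))"
        by (rule bounded_linear_compose[OF bounded_linear_ten
              bounded_linear_compose[OF bounded_linear_mult_right bounded_linear_tens_right]])
          (simp_all add: ten_dual)
      show "bounded_linear (\<lambda>w. ten (Ch p) h ((1 \<otimes> d) * w))"
        by (rule bounded_linear_compose[OF bounded_linear_ten bounded_linear_mult_right]) simp_all
    qed
    then show ?thesis by (rule fun_cong)
  qed

  have B: "id_\<Delta> (s * (1 \<otimes> a)) = id_\<Delta> s * (1 \<otimes> \<Delta> a)" for s a
  proof -
    have "(\<lambda>s. id_\<Delta> (s * (1 \<otimes> a))) = (\<lambda>s. id_\<Delta> s * (1 \<otimes> \<Delta> a))"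
      by (rule tensor_extension_unique)
        (auto intro!: bounded_linear_compose[OF bl(2) bounded_linear_mult_left]
          bounded_linear_compose[OF bounded_linear_mult_left bl(2)] simp: tens_simps el \<Delta>_hom)
    then show ?thesis by (rule fun_cong)
  qed

  have slice_dual: "(\<lambda>x. \<zeta> (x \<otimes> d)) \<in> dual" "(\<lambda>x. \<zeta> (1 \<otimes> x)) \<in> dual" if "\<zeta> \<in> dual"
    for \<zeta> :: "'a \<otimes> 'a \<Rightarrow> complex" and d
  proof -
    have "(\<lambda>x. \<zeta> ((x \<otimes> 1) * (1 \<otimes> d))) \<in> dual"
      by (rule dual_pullback[OF dual_mult_right[OF that] star_hom_tens_left])
    then show "(\<lambda>x. \<zeta> (x \<otimes> d)) \<in> dual" by (simp add: tens_simps)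
    show "(\<lambda>x. \<zeta> (1 \<otimes> x)) \<in> dual" by (rule dual_pullback[OF that star_hom_tens_right])
  qed

  have C: "ten f \<zeta> (asc (p \<otimes> d)) = ten f (\<lambda>x. \<zeta> (x \<otimes> d)) p"
    if "f \<in> dual" "\<zeta> \<in> dual" for f \<zeta> p d
  proof -
    have "ten f (\<lambda>x. \<zeta> (x \<otimes> d)) = (\<lambda>p. ten f \<zeta> (asc (p \<otimes> d)))"
      by (rule ten_eqI) (use that in \<open>auto intro!: bounded_linear_compose[OF bounded_linear_ten asc_tens] simp: el\<close>)
    then show ?thesis by simp
  qed

  \<comment> \<open>Left invariance of h tested against \<open>\<lambda>x. \<tau> (a * x)\<close>
    gives \<open>ten \<tau> h ((a \<otimes> 1) * \<Delta> d) = \<tau> a * h d\<close>, which removes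
    the comultiplication.\<close>
  have D: "ten (ev k) (ten \<tau> h) (asc (p \<otimes> 1) * id_\<Delta> s) = ten (ev k) \<tau> p * ten (ev k) h s"
    if \<tau>: "\<tau> \<in> dual" for k \<tau> p s
  proof -
    note blt = bounded_linear_compose[OF bounded_linear_ten[OF ev_dual[of k] ten_dual[OF \<tau> states_dual[OF h]]]]
    have "(\<lambda>p. ten (ev k) (ten \<tau> h) (asc (p \<otimes> 1) * id_\<Delta> s)) = (\<lambda>p. ten (ev k) \<tau> p * ten (ev k) h s)"
    proof (rule tensor_extension_unique)
      fix b a
      have "(\<lambda>s. ten (ev k) (ten \<tau> h) (asc ((b \<otimes> a) \<otimes> 1) * id_\<Delta> s)) = (\<lambda>s. ten (ev k) \<tau> (b \<otimes> a) * ten (ev k) h s)"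
      proof (rule tensor_extension_unique)
        fix c d
        have "ten \<tau> h ((a \<otimes> 1) * \<Delta> d) = \<tau> a * h d"
          using h_conv[OF dual_mult_left[OF \<tau>], of a d] by (simp add: ten_mult_left \<tau>)
        then show "ten (ev k) (ten \<tau> h) (asc ((b \<otimes> a) \<otimes> 1) * id_\<Delta> (c \<otimes> d)) =
            ten (ev k) \<tau> (b \<otimes> a) * ten (ev k) h (c \<otimes> d)"
          by (simp add: el tens_simps \<tau> ten_dual ev_mult mult_ac)
      next
        show "bounded_linear (\<lambda>s. ten (ev k) (ten \<tau> h) (asc ((b \<otimes> a) \<otimes> 1) * id_\<Delta> s))"
          by (rule blt[OF bounded_linear_compose[OF bounded_linear_mult_right bl(2)]])
        show "bounded_linear (\<lambda>s. ten (ev k) \<tau> (b \<otimes> a) * ten (ev k) h s)"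
          by (rule bounded_linear_const_mult[OF bounded_linear_ten]) simp_all
      qed
      then show "ten (ev k) (ten \<tau> h) (asc ((b \<otimes> a) \<otimes> 1) * id_\<Delta> s) = ten (ev k) \<tau> (b \<otimes> a) * ten (ev k) h s"
        by (rule fun_cong)
    next
      show "bounded_linear (\<lambda>p. ten (ev k) (ten \<tau> h) (asc (p \<otimes> 1) * id_\<Delta> s))"
        by (rule blt[OF bounded_linear_compose[OF bounded_linear_mult_left asc_tens]])
      show "bounded_linear (\<lambda>p. ten (ev k) \<tau> p * ten (ev k) h s)"
        by (rule bounded_linear_mult_const[OF bounded_linear_ten]) (simp_all add: \<tau>)
    qed
    then show ?thesis by (rule fun_cong)
  qed

  \<comment> \<open>The associator and \<open>\<alpha>_id\<close> are only given as bounded linear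
    maps; the multiplicativity used below follows from their values on elementary tensors.\<close>
  have asc_mult: "asc ((p \<otimes> 1) * z) = asc (p \<otimes> 1) * asc z" for p z
  proof -
    have "(\<lambda>p. asc ((p \<otimes> 1) * z)) = (\<lambda>p. asc (p \<otimes> 1) * asc z)"
    proof (rule tensor_extension_unique)
      fix b a
      have "(\<lambda>z. asc (((b \<otimes> a) \<otimes> 1) * z)) = (\<lambda>z. asc ((b \<otimes> a) \<otimes> 1) * asc z)"
        by (rule tensor3_extension_unique)
          (auto intro!: bounded_linear_compose[OF bl(3) bounded_linear_mult_right]
            bounded_linear_compose[OF bounded_linear_mult_right bl(3)] simp: tens_simps el)
      then show "asc (((b \<otimes> a) \<otimes> 1) * z) = asc ((b \<otimes> a) \<otimes> 1) * asc z" by (rule fun_cong)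
    next
      show "bounded_linear (\<lambda>p. asc ((p \<otimes> 1) * z))"
        by (rule bounded_linear_compose[OF bl(3) bounded_linear_compose[OF bounded_linear_mult_left
              bounded_linear_tens_left]])
      show "bounded_linear (\<lambda>p. asc (p \<otimes> 1) * asc z)"
        by (rule bounded_linear_compose[OF bounded_linear_mult_left asc_tens])
    qed
    then show ?thesis by (rule fun_cong)
  qed
  have \<alpha>_id_mult: "\<alpha>_id ((c \<otimes> 1) * s) = (\<alpha> c \<otimes> 1) * \<alpha>_id s" for c s
  proof -
    have "(\<lambda>s. \<alpha>_id ((c \<otimes> 1) * s)) = (\<lambda>s. (\<alpha> c \<otimes> 1) * \<alpha>_id s)"
      by (rule tensor_extension_unique)
        (auto intro!: bounded_linear_compose[OF bl(1) bounded_linear_mult_right]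
          bounded_linear_compose[OF bounded_linear_mult_right bl(1)] simp: tens_simps el star_homD[OF \<alpha>])
    then show ?thesis by (rule fun_cong)
  qed

  have ten_\<mu>: "ten \<mu> \<phi> t = M * (\<Sum>k\<in>F. ten (ev k) \<phi> t)" if "\<phi> \<in> dual" for \<phi> t
  proof -
    have "\<mu> = (\<lambda>f. M * (\<Sum>k\<in>F. ev k f))" by (simp add: \<mu> ev_def fun_eq_iff)
    then show ?thesis
      using that ten_scale_left[OF dual_sum[of F ev] that, of M] ten_sum_left[of F ev \<phi>] by simp
  qed
  \<comment> \<open>Summation over F is \<mu> up to the factor M, so invariance of \<mu> removes the
    inner action.\<close>
  have R: "(\<Sum>k\<in>F. ten (ev k) \<zeta> (asc (\<alpha>_id s))) = (\<Sum>k\<in>F. ten (ev k) (\<lambda>d. \<zeta> (1 \<otimes> d)) s)"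
    if \<zeta>: "\<zeta> \<in> dual" for \<zeta> s
  proof -
    have "(\<lambda>s. \<Sum>k\<in>F. ten (ev k) \<zeta> (asc (\<alpha>_id s))) = (\<lambda>s. \<Sum>k\<in>F. ten (ev k) (\<lambda>d. \<zeta> (1 \<otimes> d)) s)"
    proof (rule tensor_extension_unique)
      fix c d
      have "M * (\<Sum>k\<in>F. ten (ev k) (\<lambda>x. \<zeta> (x \<otimes> d)) (\<alpha> c)) = \<zeta> (1 \<otimes> d) * \<mu> c"
        using \<mu>_inv[OF slice_dual(1)[OF \<zeta>]] ten_\<mu>[OF slice_dual(1)[OF \<zeta>]] by simp
      then have "(\<Sum>k\<in>F. ten (ev k) (\<lambda>x. \<zeta> (x \<otimes> d)) (\<alpha> c)) = (\<Sum>k\<in>F. ev k c) * \<zeta> (1 \<otimes> d)"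
        using M by (simp add: \<mu> ev_def)
      then show "(\<Sum>k\<in>F. ten (ev k) \<zeta> (asc (\<alpha>_id (c \<otimes> d)))) =
          (\<Sum>k\<in>F. ten (ev k) (\<lambda>d. \<zeta> (1 \<otimes> d)) (c \<otimes> d))"
        by (simp add: el C[OF ev_dual \<zeta>] slice_dual \<zeta> sum_distrib_right)
    next
      show "bounded_linear (\<lambda>s. \<Sum>k\<in>F. ten (ev k) \<zeta> (asc (\<alpha>_id s)))"
        by (intro bounded_linear_sum bounded_linear_compose[OF bounded_linear_ten
              bounded_linear_compose[OF bl(3) bl(1)]]) (simp_all add: \<zeta>)
      show "bounded_linear (\<lambda>s. \<Sum>k\<in>F. ten (ev k) (\<lambda>d. \<zeta> (1 \<otimes> d)) s)"
        by (intro bounded_linear_sum bounded_linear_ten) (simp_all add: slice_dual \<zeta>)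
    qed
    then show ?thesis by (rule fun_cong)
  qed

  define G where "G k = (\<Sum>i\<in>F. ten (ev k) (Ch (\<alpha> (e i))) (\<alpha> (e i)))" for k
  have main: "ten (ev y) h (\<alpha> b * (1 \<otimes> a)) = (\<Sum>k\<in>F. G k * ten (ev k) h (\<alpha> b * (1 \<otimes> a)))" for b a
  proof -
    define \<zeta> where "\<zeta> i = (\<lambda>z. ten (Ch (\<alpha> (e i))) h (z * \<Delta> a))" for i
    have \<zeta>: "\<zeta> i \<in> dual" for i
      unfolding \<zeta>_def by (intro dual_mult_right ten_dual) simp_all
    \<comment> \<open>Invariance allows h to be replaced by \<open>(h \<otimes> h)\<Delta>\<close>,
      and the coaction identity then turns \<Delta> into a second \<alpha>.\<close>
    have "ten (ev y) h (\<alpha> b * (1 \<otimes> a)) = ten (ev y) (ten h h) (id_\<Delta> (\<alpha> b * (1 \<otimes> a)))"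
      by (simp add: ten_map[OF m(2)] ten_dual h_conv)
    also have "\<dots> = ten (ev y) (ten h h) (asc (\<alpha>_id (\<alpha> b)) * (1 \<otimes> \<Delta> a))"
      by (simp only: B coaction)
    also have "\<dots> = (\<Sum>i\<in>F. ten (ev i) (\<lambda>d. \<zeta> i (1 \<otimes> d)) (\<alpha> b))"
    proof -
      have "(\<lambda>s. ten (ev y) (ten h h) (asc (\<alpha>_id s) * (1 \<otimes> \<Delta> a))) =
          (\<lambda>s. \<Sum>i\<in>F. ten (ev i) (\<lambda>d. \<zeta> i (1 \<otimes> d)) s)"
      proof (rule tensor_extension_unique)
        fix c d
        have "ten (ev y) (ten h h) (asc (\<alpha>_id (c \<otimes> d)) * (1 \<otimes> \<Delta> a)) = ten (Ch (\<alpha> c)) h ((1 \<otimes> d) * \<Delta> a)"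
          by (simp only: el A)
        also have "\<dots> = (\<Sum>i\<in>F. ev i c * ten (Ch (\<alpha> (e i))) h ((1 \<otimes> d) * \<Delta> a))"
          by (subst Ch_expand, subst ten_sum_left) (simp_all add: dual.scale ten_scale_left)
        finally show "ten (ev y) (ten h h) (asc (\<alpha>_id (c \<otimes> d)) * (1 \<otimes> \<Delta> a)) =
            (\<Sum>i\<in>F. ten (ev i) (\<lambda>d. \<zeta> i (1 \<otimes> d)) (c \<otimes> d))"
          by (simp add: slice_dual \<zeta>) (simp add: \<zeta>_def)
      next
        show "bounded_linear (\<lambda>s. ten (ev y) (ten h h) (asc (\<alpha>_id s) * (1 \<otimes> \<Delta> a)))"
          by (rule bounded_linear_compose[OF bounded_linear_ten bounded_linear_compose[OF
                bounded_linear_mult_left bounded_linear_compose[OF bl(3) bl(1)]]]) (simp_all add: ten_dual)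
        show "bounded_linear (\<lambda>s. \<Sum>i\<in>F. ten (ev i) (\<lambda>d. \<zeta> i (1 \<otimes> d)) s)"
          by (intro bounded_linear_sum bounded_linear_ten) (simp_all add: slice_dual \<zeta>)
      qed
      then show ?thesis by (rule fun_cong)
    qed
    \<comment> \<open>R is read from right to left: the factor \<open>e i \<otimes> 1\<close> kills
      every term with \<open>k \<noteq> i\<close>, so the single evaluation at i becomes a sum over
      F.\<close>
    also have "\<dots> = (\<Sum>i\<in>F. \<Sum>k\<in>F. ten (ev k) (\<zeta> i) (asc (\<alpha>_id ((e i \<otimes> 1) * \<alpha> b))))"
    proof (rule sum.cong[OF refl])
      fix i assume i: "i \<in> F"
      have "(\<Sum>k\<in>F. ten (ev k) (\<zeta> i) (asc (\<alpha>_id ((e i \<otimes> 1) * \<alpha> b)))) =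
          (\<Sum>k\<in>F. ten (ev k) (\<lambda>d. \<zeta> i (1 \<otimes> d)) ((e i \<otimes> 1) * \<alpha> b))"
        by (rule R[OF \<zeta>])
      also have "\<dots> = (\<Sum>k\<in>F. if k = i then ten (ev k) (\<lambda>d. \<zeta> i (1 \<otimes> d)) (\<alpha> b) else 0)"
      proof (rule sum.cong[OF refl])
        fix k assume k: "k \<in> F"
        show "ten (ev k) (\<lambda>d. \<zeta> i (1 \<otimes> d)) ((e i \<otimes> 1) * \<alpha> b) =
            (if k = i then ten (ev k) (\<lambda>d. \<zeta> i (1 \<otimes> d)) (\<alpha> b) else 0)"
          using eval_tensor_central[OF slice_dual(2)[OF \<zeta>[of i]], where y = k and s = 1 and b = "e i" and t = "\<alpha> b"]
            e[OF i k] by (simp add: ev_def[symmetric])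
      qed
      finally show "ten (ev i) (\<lambda>d. \<zeta> i (1 \<otimes> d)) (\<alpha> b) =
          (\<Sum>k\<in>F. ten (ev k) (\<zeta> i) (asc (\<alpha>_id ((e i \<otimes> 1) * \<alpha> b))))"
        using i F by simp
    qed
    also have "\<dots> = (\<Sum>i\<in>F. \<Sum>k\<in>F. ten (ev k) (Ch (\<alpha> (e i))) (\<alpha> (e i)) * ten (ev k) h (\<alpha> b * (1 \<otimes> a)))"
    proof (intro sum.cong refl)
      fix i k
      have "ten (ev k) (\<zeta> i) (asc (\<alpha>_id ((e i \<otimes> 1) * \<alpha> b))) =
          ten (ev k) (\<zeta> i) (asc (\<alpha> (e i) \<otimes> 1) * id_\<Delta> (\<alpha> b))"
        by (simp only: \<alpha>_id_mult asc_mult coaction)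
      also have "\<dots> = ten (ev k) (ten (Ch (\<alpha> (e i))) h) (asc (\<alpha> (e i) \<otimes> 1) * id_\<Delta> (\<alpha> b) * (1 \<otimes> \<Delta> a))"
        by (simp add: ten_mult_right ten_dual \<zeta>_def)
      also have "\<dots> = ten (ev k) (Ch (\<alpha> (e i))) (\<alpha> (e i)) * ten (ev k) h (\<alpha> b * (1 \<otimes> a))"
        by (simp only: mult.assoc B[symmetric] D[OF Ch_dual])
      finally show "ten (ev k) (\<zeta> i) (asc (\<alpha>_id ((e i \<otimes> 1) * \<alpha> b))) =
          ten (ev k) (Ch (\<alpha> (e i))) (\<alpha> (e i)) * ten (ev k) h (\<alpha> b * (1 \<otimes> a))" .
    qed
    also have "\<dots> = (\<Sum>k\<in>F. G k * ten (ev k) h (\<alpha> b * (1 \<otimes> a)))"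
      unfolding G_def sum_distrib_right by (rule sum.swap)
    finally show ?thesis .
  qed
  \<comment> \<open>The density condition on the action carries the relation to the whole tensor
    product, in particular to \<open>c \<otimes> 1\<close>.\<close>
  have "ten (ev y) h = (\<lambda>t. \<Sum>k\<in>F. G k * ten (ev k) h t)"
  proof (rule eq_on_dense_cspan[OF dense])
    show "bounded_linear (\<lambda>t. \<Sum>k\<in>F. G k * ten (ev k) h t)"
      by (intro bounded_linear_sum bounded_linear_const_mult bounded_linear_ten) simp_all
    show "bounded_linear (ten (ev y) h)" by (rule bounded_linear_ten) simp_all
    fix c x assume "x \<in> {\<alpha> b * (1 \<otimes> a) |a b. True}"
    then obtain b a where x: "x = \<alpha> b * (1 \<otimes> a)" by blast
    show "ten (ev y) h (c *\<^sub>C x) = (\<Sum>k\<in>F. G k * ten (ev k) h (c *\<^sub>C x))"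
      using main[of b a] by (simp add: x dual_scaleC ten_dual sum_distrib_left mult_ac)
  qed
  then have "ten (ev y) h (c \<otimes> 1) = (\<Sum>k\<in>F. G k * ten (ev k) h (c \<otimes> 1))" for c by (rule fun_cong)
  then show ?thesis by (intro exI[of _ G]) (simp add: ev_def[symmetric] , simp add: ev_def)
qed

theorem theorem1p1:
  assumes "compact (UNIV :: 'x::t2_space set)"
    and "countable (UNIV :: 'x set)"
    and "infinite (UNIV :: 'x set)"
  shows "\<not> (\<exists>(\<Delta> :: 'a::cstar_algebra \<Rightarrow> 'a \<otimes> 'a)
            (\<alpha> :: ('x \<Rightarrow>\<^sub>C complex) \<Rightarrow> ('x \<Rightarrow>\<^sub>C complex) \<otimes> 'a).
            compact_quantum_group \<Delta> \<and> quantum_group_action \<Delta> \<alpha> \<and> ergodic \<alpha>)"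
proof
  assume "\<exists>(\<Delta> :: 'a \<Rightarrow> 'a \<otimes> 'a) (\<alpha> :: ('x \<Rightarrow>\<^sub>C complex) \<Rightarrow> ('x \<Rightarrow>\<^sub>C complex) \<otimes> 'a).
            compact_quantum_group \<Delta> \<and> quantum_group_action \<Delta> \<alpha> \<and> ergodic \<alpha>"
  then obtain \<Delta> :: "'a \<Rightarrow> 'a \<otimes> 'a" and \<alpha> :: "('x \<Rightarrow>\<^sub>C complex) \<Rightarrow> ('x \<Rightarrow>\<^sub>C complex) \<otimes> 'a"
    where cqg: "compact_quantum_group \<Delta>" and act: "quantum_group_action \<Delta> \<alpha>" and erg: "ergodic \<alpha>"
    by blast
  have \<alpha>: "star_hom \<alpha>" using act by (simp add: quantum_group_action_def unital_star_hom_def)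
  note X = assms(1,2)
  \<comment> \<open>A may be the zero algebra. Without states there are no nonzero positive
    functionals, so the tensor product is zero and every function is fixed; ergodicity would make
    all functions constant, although X has two points.\<close>
  have "\<exists>\<phi>0. \<phi>0 \<in> (states :: ('a \<Rightarrow> complex) set)"
  proof (rule ccontr)
    assume none: "\<nexists>\<phi>0. \<phi>0 \<in> (states :: ('a \<Rightarrow> complex) set)"
    have zero: "\<phi> x = 0" if \<phi>: "\<phi> \<in> pos_fun" for \<phi> :: "'a \<Rightarrow> complex" and x
    proof (rule pos_fun_eq_0[OF \<phi>], rule ccontr)
      assume "\<phi> 1 \<noteq> 0"
      then have "(\<lambda>a. complex_of_real (1 / Re (\<phi> 1)) * \<phi> a) \<in> states"
        using pos_fun_scale[OF \<phi>, of "1 / Re (\<phi> 1)"] pos_fun_one[OF \<phi>]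
        by (simp add: states_def)
      with none show False by blast
    qed
    have "t = 0" for t :: "('x \<Rightarrow>\<^sub>C complex) \<otimes> 'a"
    proof (rule tensor_separation)
      fix f :: "('x \<Rightarrow>\<^sub>C complex) \<Rightarrow> complex" and \<phi> :: "'a \<Rightarrow> complex"
      assume "f \<in> pos_fun" "\<phi> \<in> pos_fun"
      then have "ten f \<phi> = (\<lambda>_. 0)" by (intro ten_eqI) (auto simp: zero)
      then show "ten f \<phi> t = 0" by simp
    qed
    then have "\<alpha> b = b \<otimes> 1" for b by metis
    then have scalar: "\<exists>c. b = c *\<^sub>C 1" for b :: "'x \<Rightarrow>\<^sub>C complex"
      using erg by (auto simp: ergodic_def)
    obtain y z :: 'x where yz: "y \<noteq> z"
      using assms(3) by (metis (full_types) UNIV_eq_I finite.simps insertI1 ex_new_if_finite)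
    obtain U where U: "open U" "closed U" "y \<in> U" "U \<subseteq> - {z}"
      using clopen_neighbourhood[OF X, of "- {z}" y] yz by auto
    obtain c where "ind U = c *\<^sub>C 1" using scalar by blast
    then have "ind U y = ind U z" by (simp add: apply_cstar_bcontfun)
    with U show False by (auto simp: apply_ind)
  qed
  then obtain h :: "'a \<Rightarrow> complex" where h: "h \<in> states"
    and left: "\<And>\<phi>. \<phi> \<in> dual \<Longrightarrow> conv \<Delta> \<phi> h = (\<lambda>a. \<phi> 1 * h a)"
    and right: "\<And>\<phi>. \<phi> \<in> dual \<Longrightarrow> conv \<Delta> h \<phi> = (\<lambda>a. \<phi> 1 * h a)"
    using Haar_state_exists[OF cqg] by blast
  obtain \<mu> where \<mu>: "\<mu> \<in> states" and act_h: "\<And>f b. f \<in> dual \<Longrightarrow> ten f h (\<alpha> b) = f 1 * \<mu> b"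
    and \<mu>_inv: "\<And>\<phi> b. \<phi> \<in> dual \<Longrightarrow> ten \<mu> \<phi> (\<alpha> b) = \<phi> 1 * \<mu> b"
    using ergodic_invariant_state[OF cqg act erg h left right] by blast
  have dich: "mass \<mu> y \<le> Re (\<mu> (ind U))" if U: "open U" "closed U" and pos: "0 < Re (\<mu> (ind U))" for y U
  proof -
    let ?ev = "\<lambda>b :: 'x \<Rightarrow>\<^sub>C complex. b y" and ?p = "\<alpha> (ind U)"
    have p: "?p * ?p = ?p" "star ?p = ?p"
      by (simp_all add: ind_projection[OF U] flip: star_homD[OF \<alpha>])
    have "ten ?ev h ?p \<noteq> 0"
      using pos by (auto simp: act_h eval_dual apply_one_bcontfun)
    then obtain \<phi> where \<phi>: "\<phi> \<in> states" and one: "ten ?ev \<phi> ?p = 1"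
      using eval_tensor_compression[OF p h, of y] by blast
    \<comment> \<open>g is nonnegative because \<open>\<alpha>(1\<^sub>U)\<close> is a projection,
      has the value 1 at y, and by invariance has the same \<mu>-value as
      \<open>ind U\<close>.\<close>
    obtain g where g: "\<And>f. f \<in> dual \<Longrightarrow> ten f \<phi> ?p = f g"
      using slice_exists[OF \<phi>] by blast
    have "apply_bcontfun g x = complex_of_real (Re (g x)) \<and> 0 \<le> Re (g x)" for x
      using pos_fun_nonneg[OF statesD(1)[OF ten_states[OF eval_states \<phi>]], of x ?p] p
        g[OF eval_dual, of x] by simp
    then have "Im (g x) = 0" "0 \<le> Re (g x)" for x by (metis Im_complex_of_real)+
    from mass_times_value_le[OF X \<mu> this, of y]
    have "mass \<mu> y \<le> Re (\<mu> g)" using one g[OF eval_dual, of y] by simp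
    also have "\<mu> g = \<mu> (ind U)"
      using g[OF states_dual[OF \<mu>]] \<mu>_inv[OF states_dual[OF \<phi>]] statesD(2)[OF \<phi>] by simp
    finally show ?thesis .
  qed
  obtain F M where F: "finite F" "M * real (card F) = 1"
    and \<mu>_eq: "\<And>f. \<mu> f = complex_of_real M * (\<Sum>k\<in>F. apply_bcontfun f k)"
    using uniform_finite_support[OF X \<mu> dich] by blast
  obtain e :: "'x \<Rightarrow> 'x \<Rightarrow>\<^sub>C complex" where e: "\<And>i k. i \<in> F \<Longrightarrow> k \<in> F \<Longrightarrow> e i k = (if i = k then 1 else 0)"
    and "\<And>i x. e i x \<in> {0, 1}"
    using dual_bump_functions[OF X F(1)] by blast
  obtain y where y: "y \<notin> F" using assms(3) F(1) ex_new_if_finite by blast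
  have "complex_of_real M \<noteq> 0" using F(2) by auto
  then obtain G where G: "\<And>c :: 'x \<Rightarrow>\<^sub>C complex. c y = (\<Sum>k\<in>F. G k * c k)"
    using evaluations_spanned_by_support[OF cqg act h left act_h \<mu>_inv F(1) _ \<mu>_eq e] by metis
  have "open (- F)" using F(1) by (simp add: finite_imp_closed open_Compl)
  then obtain U where U: "open U" "closed U" "y \<in> U" "U \<subseteq> - F"
    using clopen_neighbourhood[OF X, of "- F" y] y by auto
  have "ind U y = (\<Sum>k\<in>F. G k * ind U k)" by (rule G)
  also have "\<dots> = 0" using U(4) by (intro sum.neutral) (auto simp: apply_ind[OF U(1,2)])
  finally show False using U(3) by (simp add: apply_ind[OF U(1,2)])
qed

end
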